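(* For any $a\in\mathbb{R}\setminus\mathbb{Z}$, the embeddings in the Colombeau algebra $\mathcal{G}(\mathbb{R})$ of the distributions $\nu_{+}^{a}$, $\nu_{-}^{-a-3}$, $\delta$ and $\delta'$ on $\mathbb{R}$ satisfy $$\widetilde{\nu_{+}^{a}}\cdot\widetilde{\nu_{-}^{-a-3}}\;+\;(2a+3)\,\widetilde{\delta}\cdot\widetilde{\delta'}\;\approx\;\frac{1}{2}\binom{a+2}{2}\,\delta''.$$ That is, the generalized function on the left-hand side admits the distribution on the right-hand side as associated distribution.
   Context: $\mathbb{N}=\{1,2,\dots\}$, $\mathbb{N}_0=\mathbb{N}\cup\{0\}$; $\mathcal{D}(\mathbb{R})$ is the space of smooth compactly supported test functions, $\mathcal{D}'(\mathbb{R})$ the space of distributions, $\delta$ the Dirac distribution at $0$, and $\delta',\delta''$ its distributional derivatives. For $x\in\mathbb{R}$ and $n\in\mathbb{N}$, $\binom{x}{n}=\frac{x(x-1)\cdots(x-n+1)}{n!}$. **Colombeau algebra.** For $q\in\mathbb{N}_0$ put $A_q(\mathbb{R})=\{\varphi\in\mathcal{D}(\mathbb{R}):\int_{\mathbb{R}}x^j\varphi(x)\,dx=\delta_{0j},\ j=0,1,\dots,q\}$, where $\delta_{0j}=1$ if $j=0$ and $0$ otherwise. For $\varphi\in A_q(\mathbb{R})$ and $\varepsilon>0$ put $\varphi_\varepsilon(x)=\varepsilon^{-1}\varphi(\varepsilon^{-1}x)$ and $\check\varphi(x)=\varphi(-x)$. Let $\mathcal{E}[\mathbb{R}]$ be the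 algebra (pointwise operations) of functions $f(\varphi,x):A_0(\mathbb{R})\times\mathbb{R}\to\mathbb{C}$ that are infinitely differentiable in $x$ for each fixed $\varphi$. Let $\mathcal{E}_M[\mathbb{R}]$ be the subalgebra of those $f$ such that for each compact $K\subset\mathbb{R}$ and $p\in\mathbb{N}_0$ there is $q\in\mathbb{N}$ such that for each $\varphi\in A_q(\mathbb{R})$, $\sup_{x\in K}|\partial_x^p f(\varphi_\varepsilon,x)|=O(\varepsilon^{-q})$ as $\varepsilon\to0_+$. Let $\mathcal{I}[\mathbb{R}]$ be the ideal of $\mathcal{E}_M[\mathbb{R}]$ of those $f$ such that for each compact $K\subset\mathbb{R}$ and $p\in\mathbb{N}_0$ there is $q\in\mathbb{N}$ such that for every $r\ge q$ and $\varphi\in A_r(\mathbb{R})$, $\sup_{x\in K}|\partial_x^p f(\varphi_\varepsilon,x)|=O(\varepsilon^{r-q})$ as $\varepsilon\to0_+$. Then $\mathcal{G}(\mathbb{R})=\mathcal{E}_M[\mathbb{R}]/\mathcal{I}[\mathbb{R}]$. **Embedding.** A distribution $u\in\mathcal{D}'(\mathbb{R})$ is embedded in $\mathcal{G}(\mathbb{R})$ as the class $\widetilde{u}$ of the representative $\widetilde{u}(\varphi,x)=(u*\check\varphi)(x)$. Products of embedded distributions are taken in $\mathcal{G}(\mathbb{R})$. **Association.** A generalized function $f\in\mathcal{G}(\mathbb{R})$ admits $u\in\mathcal{D}'(\mathbb{R})$ as associated distribution, written $f\approx u$, if for some representative $f(\varphi,x)$ of $f$ and any $\psi\in\mathcal{D}(\mathbb{R})$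 there is $q\in\mathbb{N}_0$ such that for any $\varphi\in A_q(\mathbb{R})$, $\lim_{\varepsilon\to0_+}\int_{\mathbb{R}}f(\varphi_\varepsilon,x)\psi(x)\,dx=\langle u,\psi\rangle$. (This does not depend on the representative.) **The distributions $\nu_\pm^a$.** For real $a>-1$, $\nu_+^a(x)=x^a/\Gamma(a+1)$ if $x>0$ and $0$ if $x<0$; $\nu_-^a(x)=(-x)^a/\Gamma(a+1)$ if $x<0$ and $0$ if $x>0$ (locally integrable functions). For arbitrary $a\in\mathbb{R}\setminus\{-1,-2,\dots\}$, $\nu_+^a=\partial_x^r\nu_+^{a+r}$ and $\nu_-^a=(-1)^r\partial_x^r\nu_-^{a+r}$, where $r\in\mathbb{N}_0$ is such that $a+r>-1$ and derivatives are in the distributional sense. *)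

theory Defs
  imports "HOL-Analysis.Analysis" "HOL-Library.Landau_Symbols"
begin

section \<open>Smooth functions on the real line\<close>

definition vderiv :: "(real \<Rightarrow> complex) \<Rightarrow> real \<Rightarrow> complex" where
  "vderiv f = (\<lambda>x. vector_derivative f (at x))"

definition smooth :: "(real \<Rightarrow> complex) \<Rightarrow> bool" where
  "smooth f \<longleftrightarrow> (\<forall>n x. (vderiv ^^ n) f differentiable (at x))"

lemma vderiv_funpow_vderiv: "(vderiv ^^ n) (vderiv f) = (vderiv ^^ Suc n) f"
  by (simp add: funpow_swap1)

lemma vderiv_funpow_funpow: "(vderiv ^^ n) ((vderiv ^^ m) f) = (vderiv ^^ (n + m)) f"
  by (simp add: funpow_add)

lemma smooth_funpow: "smooth f \<Longrightarrow> smooth ((vderiv ^^ n) f)"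
  unfolding smooth_def vderiv_funpow_funpow by blast

lemma smooth_vderiv: "smooth f \<Longrightarrow> smooth (vderiv f)"
  using smooth_funpow[of f 1] by simp

lemma smooth_has_vector_derivative:
  "smooth f \<Longrightarrow> ((vderiv ^^ n) f has_vector_derivative (vderiv ^^ Suc n) f x) (at x)"
  unfolding smooth_def by (simp add: vderiv_def vector_derivative_works)

lemma smooth_family:
  assumes "F 0 = f"
    and "\<And>n x. (F n has_vector_derivative F (Suc n) x) (at x)"
  shows "smooth f" and "(vderiv ^^ n) f = F n"
proof -
  have *: "(vderiv ^^ n) f = F n" for n
  proof (induction n)
    case 0
    then show ?case using assms(1) by simp
  next
    case (Suc n)
    show ?case
      by (simp add: Suc.IH) (auto simp: vderiv_def fun_eq_iff intro!: vector_derivative_at assms(2))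
  qed
  then show "(vderiv ^^ n) f = F n" .
  show "smooth f"
    unfolding smooth_def * using assms(2) by (meson differentiableI_vector)
qed

lemma smooth_continuous_on: "smooth f \<Longrightarrow> continuous_on S ((vderiv ^^ n) f)"
  unfolding smooth_def
  by (meson continuous_at_imp_continuous_on differentiable_imp_continuous_within)

lemma smooth_const: "smooth (\<lambda>x. c)" and funpow_vderiv_const:
  "(vderiv ^^ n) (\<lambda>x. c) = (\<lambda>x. if n = 0 then c else 0)"
  by (rule smooth_family[where F="\<lambda>n x. if n = 0 then c else 0"]; auto)+

lemma
  assumes "smooth f" "smooth g"
  shows smooth_add: "smooth (\<lambda>x. f x + g x)"
    and funpow_vderiv_add:
      "(vderiv ^^ n) (\<lambda>x. f x + g x) = (\<lambda>x. (vderiv ^^ n) f x + (vderiv ^^ n) g x)"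
  by (rule smooth_family[where F="\<lambda>n x. (vderiv ^^ n) f x + (vderiv ^^ n) g x"];
      auto intro!: has_vector_derivative_add smooth_has_vector_derivative[OF assms(1), simplified]
        smooth_has_vector_derivative[OF assms(2), simplified])+

lemma
  assumes "smooth f"
  shows smooth_cmult: "smooth (\<lambda>x. c * f x)"
    and funpow_vderiv_cmult: "(vderiv ^^ n) (\<lambda>x. c * f x) = (\<lambda>x. c * (vderiv ^^ n) f x)"
  by (rule smooth_family[where F="\<lambda>n x. c * (vderiv ^^ n) f x"];
      auto intro!: has_vector_derivative_mult_right
        smooth_has_vector_derivative[OF assms(1), simplified])+

lemma
  assumes "smooth f"
  shows smooth_affine: "smooth (\<lambda>x. f (a * x + b))"
    and funpow_vderiv_affine:
      "(vderiv ^^ n) (\<lambda>x. f (a * x + b)) = (\<lambda>x. a ^ n *\<^sub>R (vderiv ^^ n) f (a * x + b))"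
proof -
  have "((\<lambda>x. a ^ n *\<^sub>R (vderiv ^^ n) f (a * x + b)) has_vector_derivative
      a ^ Suc n *\<^sub>R (vderiv ^^ Suc n) f (a * x + b)) (at x)" for n x
  proof -
    have "((vderiv ^^ n) f \<circ> (\<lambda>x. a * x + b) has_vector_derivative
        a *\<^sub>R (vderiv ^^ Suc n) f (a * x + b)) (at x)"
      by (rule vector_diff_chain_at)
        (auto intro!: derivative_eq_intros smooth_has_vector_derivative[OF assms, simplified]
          simp flip: has_real_derivative_iff_has_vector_derivative)
    from bounded_linear.has_vector_derivative[OF bounded_linear_scaleR_right[of "a ^ n"] this]
    show ?thesis by (simp add: o_def mult.commute)
  qed
  then show "smooth (\<lambda>x. f (a * x + b))"
    and "(vderiv ^^ n) (\<lambda>x. f (a * x + b)) = (\<lambda>x. a ^ n *\<^sub>R (vderiv ^^ n) f (a * x + b))"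
    using smooth_family[where F="\<lambda>n x. a ^ n *\<^sub>R (vderiv ^^ n) f (a * x + b)"
        and f="\<lambda>x. f (a * x + b)"] by simp_all
qed

lemma
  assumes "smooth f" "smooth g"
  shows smooth_mult: "smooth (\<lambda>x. f x * g x)"
    and funpow_vderiv_mult: "(vderiv ^^ n) (\<lambda>x. f x * g x) =
      (\<lambda>x. \<Sum>k\<le>n. of_nat (n choose k) * ((vderiv ^^ k) f x * (vderiv ^^ (n - k)) g x))"
proof -
  let ?F = "\<lambda>n x. \<Sum>k\<le>n. of_nat (n choose k) * ((vderiv ^^ k) f x * (vderiv ^^ (n - k)) g x)"
  have "(?F n has_vector_derivative ?F (Suc n) x) (at x)" for n x
  proof -
    let ?a = "\<lambda>k. (vderiv ^^ k) f x" and ?b = "\<lambda>k. (vderiv ^^ k) g x"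
    have 1: "(?F n has_vector_derivative (\<Sum>k\<le>n. of_nat (n choose k) *
        (?a k * ?b (Suc (n - k)) + ?a (Suc k) * ?b (n - k)))) (at x)"
      by (intro has_vector_derivative_sum has_vector_derivative_mult_right
          has_vector_derivative_mult smooth_has_vector_derivative assms)
    have s1: "(\<Sum>k\<le>n. of_nat (n choose k) * (?a k * ?b (Suc (n - k)))) =
        (\<Sum>k\<le>Suc n. of_nat (n choose k) * (?a k * ?b (Suc n - k)))"
      by (simp add: Suc_diff_le del: funpow.simps)
    also have "\<dots> = ?a 0 * ?b (Suc n) +
        (\<Sum>k\<le>n. of_nat (n choose Suc k) * (?a (Suc k) * ?b (n - k)))"
      by (subst sum.atMost_Suc_shift) (simp del: funpow.simps)
    finally have s2: "(\<Sum>k\<le>n. of_nat (n choose k) * (?a k * ?b (Suc (n - k)))) = \<dots>" .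
    have s3: "?F (Suc n) x = ?a 0 * ?b (Suc n) +
        (\<Sum>k\<le>n. of_nat (Suc n choose Suc k) * (?a (Suc k) * ?b (n - k)))"
      by (subst sum.atMost_Suc_shift) (simp del: funpow.simps binomial_Suc_Suc)
    have "(\<Sum>k\<le>n. of_nat (n choose k) *
        (?a k * ?b (Suc (n - k)) + ?a (Suc k) * ?b (n - k))) = ?F (Suc n) x"
      unfolding s3 distrib_left sum.distrib s2
      by (simp add: sum.distrib[symmetric] algebra_simps del: funpow.simps)
    with 1 show ?thesis by simp
  qed
  then show "smooth (\<lambda>x. f x * g x)" and "(vderiv ^^ n) (\<lambda>x. f x * g x) = ?F n"
    using smooth_family[where F="?F" and f="\<lambda>x. f x * g x"] by simp_all
qed


section \<open>Test functions and distributions\<close>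

definition test_fun :: "(real \<Rightarrow> complex) \<Rightarrow> bool" where
  "test_fun \<phi> \<longleftrightarrow> smooth \<phi> \<and> (\<exists>K. compact K \<and> (\<forall>x. x \<notin> K \<longrightarrow> \<phi> x = 0))"

definition test_seminorm :: "nat \<Rightarrow> (real \<Rightarrow> complex) \<Rightarrow> real" where
  "test_seminorm N \<phi> = (\<Sum>k\<le>N. SUP x. norm ((vderiv ^^ k) \<phi> x))"

lemma vderiv_funpow_outside:
  assumes "closed K" "\<And>x. x \<notin> K \<Longrightarrow> \<phi> x = 0" "x \<notin> K"
  shows "(vderiv ^^ n) \<phi> x = 0"
  using assms(3)
proof (induction n arbitrary: x)
  case 0
  then show ?case using assms by simp
next
  case (Suc n)
  have "((\<lambda>x. 0) has_vector_derivative 0) (at x)" by simp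
  then have "((vderiv ^^ n) \<phi> has_vector_derivative 0) (at x)"
    by (rule has_vector_derivative_transform_within_open[where S="- K"])
      (use assms(1) Suc in auto)
  then show ?case by (simp add: vderiv_def[of "(vderiv ^^ n) \<phi>"] vector_derivative_at)
qed

lemma test_fun_smooth: "test_fun \<phi> \<Longrightarrow> smooth \<phi>"
  by (simp add: test_fun_def)

lemma test_fun_radius:
  assumes "test_fun \<phi>"
  obtains R where "R > 0" "\<And>x. \<bar>x\<bar> > R \<Longrightarrow> \<phi> x = 0"
proof -
  obtain K where K: "compact K" "\<And>x. x \<notin> K \<Longrightarrow> \<phi> x = 0"
    using assms unfolding test_fun_def by blast
  then obtain R where "R > 0" "\<And>x. x \<in> K \<Longrightarrow> norm x \<le> R"
    using compact_imp_bounded bounded_pos by metis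
  with K that[of R] show ?thesis by fastforce
qed

lemma test_funI:
  assumes "smooth \<phi>" "\<And>x. \<bar>x\<bar> > R \<Longrightarrow> \<phi> x = 0"
  shows "test_fun \<phi>"
  unfolding test_fun_def
  using assms by (intro conjI exI[of _ "{-R..R}"]) force+

lemma test_fun_funpow: "test_fun \<phi> \<Longrightarrow> test_fun ((vderiv ^^ n) \<phi>)"
  unfolding test_fun_def using vderiv_funpow_outside compact_imp_closed smooth_funpow by metis

lemma test_fun_vderiv: "test_fun \<phi> \<Longrightarrow> test_fun (vderiv \<phi>)"
  using test_fun_funpow[of \<phi> 1] by simp

lemma test_fun_zero: "test_fun (\<lambda>x. 0)"
  by (rule test_funI[of _ 0]) (auto intro: smooth_const)

lemma test_fun_add:
  assumes "test_fun \<phi>" "test_fun \<psi>"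
  shows "test_fun (\<lambda>x. \<phi> x + \<psi> x)"
proof -
  obtain R where R: "\<And>x. \<bar>x\<bar> > R \<Longrightarrow> \<phi> x = 0" using assms(1) test_fun_radius by metis
  obtain S where S: "\<And>x. \<bar>x\<bar> > S \<Longrightarrow> \<psi> x = 0" using assms(2) test_fun_radius by metis
  show ?thesis
    by (rule test_funI[of _ "max R S"])
      (use R S assms in \<open>auto intro: smooth_add simp: test_fun_smooth\<close>)
qed

lemma test_fun_cmult: "test_fun \<phi> \<Longrightarrow> test_fun (\<lambda>x. c * \<phi> x)"
  by (metis (no_types, lifting) mult_zero_right smooth_cmult test_funI test_fun_radius test_fun_smooth)

lemma test_fun_affine:
  assumes "test_fun \<phi>" "a \<noteq> 0"
  shows "test_fun (\<lambda>x. \<phi> (a * x + b))"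
proof -
  obtain R where R: "\<And>x. \<bar>x\<bar> > R \<Longrightarrow> \<phi> x = 0" using assms(1) test_fun_radius by metis
  have "\<bar>a * x + b\<bar> > R" if "\<bar>x\<bar> > (R + \<bar>b\<bar>) / \<bar>a\<bar>" for x
  proof -
    have "R + \<bar>b\<bar> < \<bar>a * x\<bar>"
      using that assms(2) by (simp add: abs_mult field_simps)
    then show ?thesis by linarith
  qed
  with R show ?thesis
    by (intro test_funI[of _ "(R + \<bar>b\<bar>) / \<bar>a\<bar>"]) (auto intro: smooth_affine test_fun_smooth assms)
qed

lemma test_fun_bounded:
  assumes "test_fun \<phi>"
  obtains B where "B \<ge> 0" "\<And>x. norm ((vderiv ^^ k) \<phi> x) \<le> B"
proof -
  have t: "test_fun ((vderiv ^^ k) \<phi>)" using assms by (rule test_fun_funpow)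
  then obtain R where R: "\<And>x. \<bar>x\<bar> > R \<Longrightarrow> (vderiv ^^ k) \<phi> x = 0" using test_fun_radius by metis
  have "compact ((vderiv ^^ k) \<phi> ` {-R..R})"
    by (intro compact_continuous_image smooth_continuous_on test_fun_smooth assms) simp
  then obtain B where B: "B > 0" "\<And>x. x \<in> {-R..R} \<Longrightarrow> norm ((vderiv ^^ k) \<phi> x) \<le> B"
    using compact_imp_bounded bounded_pos by (metis imageI)
  have "norm ((vderiv ^^ k) \<phi> x) \<le> B" for x
    using R[of x] B(1) B(2)[of x] by (cases "\<bar>x\<bar> > R") (auto simp: abs_le_iff not_less)
  with B show ?thesis by (intro that[of B]) auto
qed

lemma test_fun_bdd_above: "test_fun \<phi> \<Longrightarrow> bdd_above (range (\<lambda>x. norm ((vderiv ^^ k) \<phi> x)))"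
  using test_fun_bounded[of \<phi> k] by (metis bdd_above.I2)

lemma norm_le_test_seminorm:
  assumes "test_fun \<phi>" "k \<le> N"
  shows "norm ((vderiv ^^ k) \<phi> x) \<le> test_seminorm N \<phi>"
proof -
  have "norm ((vderiv ^^ k) \<phi> x) \<le> (SUP x. norm ((vderiv ^^ k) \<phi> x))"
    using test_fun_bdd_above[OF assms(1)] by (intro cSUP_upper) auto
  also have "\<dots> \<le> test_seminorm N \<phi>"
    unfolding test_seminorm_def
    by (rule member_le_sum[where f="\<lambda>k. SUP x. norm ((vderiv ^^ k) \<phi> x)"])
      (use assms test_fun_bdd_above in \<open>auto intro!: cSUP_upper2[where x=0]\<close>)
  finally show ?thesis .
qed

lemma test_seminorm_nonneg: "test_fun \<phi> \<Longrightarrow> test_seminorm N \<phi> \<ge> 0"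
  using norm_le_test_seminorm[of \<phi> 0 N 0] norm_ge_zero order_trans by blast

lemma test_seminorm_le:
  assumes "\<And>k x. k \<le> N \<Longrightarrow> norm ((vderiv ^^ k) \<phi> x) \<le> B"
  shows "test_seminorm N \<phi> \<le> (N + 1) * B"
proof -
  have "test_seminorm N \<phi> \<le> (\<Sum>k\<le>N. B)"
    unfolding test_seminorm_def by (intro sum_mono cSUP_least) (use assms in auto)
  then show ?thesis by (simp add: add.commute)
qed

lemma test_seminorm_mono:
  assumes "test_fun \<phi>" "M \<le> N"
  shows "test_seminorm M \<phi> \<le> test_seminorm N \<phi>"
  unfolding test_seminorm_def
  by (rule sum_mono2) (use assms test_fun_bdd_above in \<open>auto intro!: cSUP_upper2[where x=0]\<close>)

lemma test_seminorm_vderiv: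
  assumes "test_fun \<phi>"
  shows "test_seminorm N (vderiv \<phi>) \<le> real (N + 1) * test_seminorm (Suc N) \<phi>"
proof -
  have "norm ((vderiv ^^ k) (vderiv \<phi>) x) \<le> test_seminorm (Suc N) \<phi>" if "k \<le> N" for k x
    unfolding vderiv_funpow_vderiv by (rule norm_le_test_seminorm) (use assms that in auto)
  from test_seminorm_le[where N=N, OF this] show ?thesis by (simp add: add.commute)
qed

text \<open>Test functions are complex valued and distributions are complex linear.
  Continuity on the inductive limit of the spaces of test functions supported in compact sets
  is expressed by the usual seminorm estimates. A distribution is extended by zero to arguments that
  are not test functions, so that equality of distributions is equality of functionals.\<close>

definition is_distribution :: "((real \<Rightarrow> complex) \<Rightarrow> complex) \<Rightarrow> bool" where
  "is_distribution u \<longleftrightarrow>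
     (\<forall>\<phi> \<psi>. test_fun \<phi> \<longrightarrow> test_fun \<psi> \<longrightarrow> u (\<lambda>x. \<phi> x + \<psi> x) = u \<phi> + u \<psi>) \<and>
     (\<forall>c \<phi>. test_fun \<phi> \<longrightarrow> u (\<lambda>x. c * \<phi> x) = c * u \<phi>) \<and>
     (\<forall>K. compact K \<longrightarrow> (\<exists>C N. \<forall>\<phi>. test_fun \<phi> \<longrightarrow> (\<forall>x. x \<notin> K \<longrightarrow> \<phi> x = 0) \<longrightarrow>
        norm (u \<phi>) \<le> C * test_seminorm N \<phi>)) \<and>
     (\<forall>\<phi>. \<not> test_fun \<phi> \<longrightarrow> u \<phi> = 0)"

typedef distribution = "{u. is_distribution u}"
  morphisms pairing Abs_distribution
proof (rule exI[of _ "\<lambda>_. 0"], rule CollectI)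
  show "is_distribution (\<lambda>_. 0)"
    unfolding is_distribution_def by (auto intro!: exI[of _ 0])
qed

setup_lifting type_definition_distribution

lemma is_distribution_add:
  assumes "is_distribution u" "test_fun \<phi>" "test_fun \<psi>"
  shows "u (\<lambda>x. \<phi> x + \<psi> x) = u \<phi> + u \<psi>"
  using conjunct1[OF assms(1)[unfolded is_distribution_def]] assms(2,3) by simp

lemma is_distribution_cmult:
  assumes "is_distribution u" "test_fun \<phi>"
  shows "u (\<lambda>x. c * \<phi> x) = c * u \<phi>"
  using conjunct1[OF conjunct2[OF assms(1)[unfolded is_distribution_def]]] assms(2) by simp

lemma is_distribution_outside:
  assumes "is_distribution u" "\<not> test_fun \<phi>"
  shows "u \<phi> = 0"
  using conjunct2[OF conjunct2[OF conjunct2[OF assms(1)[unfolded is_distribution_def]]]] assms(2)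
  by simp

lemma is_distributionI:
  assumes "\<And>\<phi> \<psi>. test_fun \<phi> \<Longrightarrow> test_fun \<psi> \<Longrightarrow> u (\<lambda>x. \<phi> x + \<psi> x) = u \<phi> + u \<psi>"
    and "\<And>c \<phi>. test_fun \<phi> \<Longrightarrow> u (\<lambda>x. c * \<phi> x) = c * u \<phi>"
    and "\<And>K. compact K \<Longrightarrow> \<exists>C N. \<forall>\<phi>. test_fun \<phi> \<longrightarrow> (\<forall>x. x \<notin> K \<longrightarrow> \<phi> x = 0) \<longrightarrow>
        norm (u \<phi>) \<le> C * test_seminorm N \<phi>"
    and "\<And>\<phi>. \<not> test_fun \<phi> \<Longrightarrow> u \<phi> = 0"
  shows "is_distribution u"
  unfolding is_distribution_def by (intro conjI allI impI assms)

lemma is_distribution_bound: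
  assumes "is_distribution u" "compact K"
  obtains C N where "C \<ge> 0" "\<forall>\<phi>. test_fun \<phi> \<longrightarrow> (\<forall>x. x \<notin> K \<longrightarrow> \<phi> x = 0) \<longrightarrow>
        norm (u \<phi>) \<le> C * test_seminorm N \<phi>"
proof -
  have "\<exists>C N. \<forall>\<phi>. test_fun \<phi> \<longrightarrow> (\<forall>x. x \<notin> K \<longrightarrow> \<phi> x = 0) \<longrightarrow>
        norm (u \<phi>) \<le> C * test_seminorm N \<phi>"
    using conjunct1[OF conjunct2[OF conjunct2[OF assms(1)[unfolded is_distribution_def]]],
        rule_format, OF assms(2)] by simp
  then obtain C N where *: "\<forall>\<phi>. test_fun \<phi> \<longrightarrow> (\<forall>x. x \<notin> K \<longrightarrow> \<phi> x = 0) \<longrightarrow>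
        norm (u \<phi>) \<le> C * test_seminorm N \<phi>"
    by (elim exE)
  have "norm (u \<phi>) \<le> \<bar>C\<bar> * test_seminorm N \<phi>"
    if "test_fun \<phi>" "\<And>x. x \<notin> K \<Longrightarrow> \<phi> x = 0" for \<phi>
  proof -
    have "norm (u \<phi>) \<le> C * test_seminorm N \<phi>" using * that by simp
    also have "\<dots> \<le> \<bar>C\<bar> * test_seminorm N \<phi>"
      by (intro mult_right_mono test_seminorm_nonneg that) simp
    finally show ?thesis .
  qed
  then show ?thesis using that[of "\<bar>C\<bar>" N] by auto
qed

instantiation distribution :: real_vector
begin

lift_definition zero_distribution :: distribution is "\<lambda>_. 0"
  unfolding is_distribution_def by (auto intro!: exI[of _ 0])

lift_definition plus_distribution :: "distribution \<Rightarrow> distribution \<Rightarrow> distribution"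
  is "\<lambda>u v \<phi>. u \<phi> + v \<phi>"
proof -
  fix u v assume uv: "is_distribution u" "is_distribution v"
  have "\<exists>C N. \<forall>\<phi>. test_fun \<phi> \<longrightarrow> (\<forall>x. x \<notin> K \<longrightarrow> \<phi> x = 0) \<longrightarrow>
        norm (u \<phi> + v \<phi>) \<le> C * test_seminorm N \<phi>" if K: "compact K" for K
  proof -
    obtain C N where u: "C \<ge> 0" "\<forall>\<phi>. test_fun \<phi> \<longrightarrow> (\<forall>x. x \<notin> K \<longrightarrow> \<phi> x = 0) \<longrightarrow>
        norm (u \<phi>) \<le> C * test_seminorm N \<phi>" by (rule is_distribution_bound[OF uv(1) K]) (rule that)
    obtain D M where v: "D \<ge> 0" "\<forall>\<phi>. test_fun \<phi> \<longrightarrow> (\<forall>x. x \<notin> K \<longrightarrow> \<phi> x = 0) \<longrightarrow>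
        norm (v \<phi>) \<le> D * test_seminorm M \<phi>" by (rule is_distribution_bound[OF uv(2) K]) (rule that)
    have "norm (u \<phi> + v \<phi>) \<le> (C + D) * test_seminorm (max N M) \<phi>"
      if \<phi>: "test_fun \<phi>" "\<forall>x. x \<notin> K \<longrightarrow> \<phi> x = 0" for \<phi>
    proof -
      have "norm (u \<phi>) \<le> C * test_seminorm (max N M) \<phi>"
        using u(2)[rule_format, of \<phi>] \<phi> mult_left_mono[OF test_seminorm_mono[of \<phi> N "max N M"] u(1)] by force
      moreover have "norm (v \<phi>) \<le> D * test_seminorm (max N M) \<phi>"
        using v(2)[rule_format, of \<phi>] \<phi> mult_left_mono[OF test_seminorm_mono[of \<phi> M "max N M"] v(1)] by force
      ultimately show ?thesis
        using norm_triangle_ineq[of "u \<phi>" "v \<phi>"] unfolding distrib_right by linarith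
    qed
    then show ?thesis by blast
  qed
  then show "is_distribution (\<lambda>\<phi>. u \<phi> + v \<phi>)"
    by (rule is_distributionI[rotated 2])
      (simp_all add: is_distribution_add uv is_distribution_cmult is_distribution_outside distrib_left)
qed

lift_definition scaleR_distribution :: "real \<Rightarrow> distribution \<Rightarrow> distribution"
  is "\<lambda>r u \<phi>. of_real r * u \<phi>"
proof -
  fix r u assume u: "is_distribution u"
  have "\<exists>C N. \<forall>\<phi>. test_fun \<phi> \<longrightarrow> (\<forall>x. x \<notin> K \<longrightarrow> \<phi> x = 0) \<longrightarrow>
        norm (of_real r * u \<phi>) \<le> C * test_seminorm N \<phi>" if K: "compact K" for K
  proof -
    obtain C N where "C \<ge> 0" and b: "\<forall>\<phi>. test_fun \<phi> \<longrightarrow> (\<forall>x. x \<notin> K \<longrightarrow> \<phi> x = 0) \<longrightarrow>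
        norm (u \<phi>) \<le> C * test_seminorm N \<phi>" by (rule is_distribution_bound[OF u K]) (rule that)
    show ?thesis
      by (rule exI[of _ "\<bar>r\<bar> * C"], rule exI[of _ N])
        (auto simp: norm_mult mult.assoc intro!: mult_left_mono b[rule_format])
  qed
  then show "is_distribution (\<lambda>\<phi>. of_real r * u \<phi>)"
    by (rule is_distributionI[rotated 2])
      (simp_all add: is_distribution_add u is_distribution_cmult is_distribution_outside distrib_left)
qed

definition uminus_distribution :: "distribution \<Rightarrow> distribution" where
  "uminus_distribution u = (-1) *\<^sub>R u"

definition minus_distribution :: "distribution \<Rightarrow> distribution \<Rightarrow> distribution" where
  "minus_distribution u v = u + - v"

lemma pairing_zero: "pairing 0 \<phi> = 0"
  and pairing_add: "pairing (u + v) \<phi> = pairing u \<phi> + pairing v \<phi>"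
  and pairing_scaleR: "pairing (r *\<^sub>R u) \<phi> = of_real r * pairing u \<phi>"
  by (simp_all add: zero_distribution.rep_eq plus_distribution.rep_eq scaleR_distribution.rep_eq)

lemma distribution_eqI: "(\<And>\<phi>. pairing u \<phi> = pairing v \<phi>) \<Longrightarrow> u = v"
  by (metis ext pairing_inject)

instance
  by standard
    (rule distribution_eqI; simp add: pairing_zero pairing_add pairing_scaleR
        uminus_distribution_def minus_distribution_def algebra_simps)+

end

lift_definition dirac :: distribution is "\<lambda>\<phi>. if test_fun \<phi> then \<phi> 0 else 0"
proof -
  have "norm (\<phi> 0) \<le> 1 * test_seminorm 0 \<phi>" if "test_fun \<phi>" for \<phi>
    using norm_le_test_seminorm[OF that, of 0 0 0] by simp
  then have "\<exists>C N. \<forall>\<phi>. test_fun \<phi> \<longrightarrow> norm (\<phi> 0) \<le> C * test_seminorm N \<phi>"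
    by blast
  then show "is_distribution (\<lambda>\<phi>. if test_fun \<phi> then \<phi> 0 else 0)"
    by (intro is_distributionI) (auto simp: test_fun_add test_fun_cmult)
qed

lift_definition dist_deriv :: "distribution \<Rightarrow> distribution"
  is "\<lambda>u \<phi>. if test_fun \<phi> then - u (vderiv \<phi>) else 0"
proof -
  fix u assume u: "is_distribution u"
  have "\<exists>C N. \<forall>\<phi>. test_fun \<phi> \<longrightarrow> (\<forall>x. x \<notin> K \<longrightarrow> \<phi> x = 0) \<longrightarrow>
        norm (u (vderiv \<phi>)) \<le> C * test_seminorm N \<phi>" if K: "compact K" for K
  proof -
    obtain C N where C: "C \<ge> 0" and b: "\<forall>\<phi>. test_fun \<phi> \<longrightarrow> (\<forall>x. x \<notin> K \<longrightarrow> \<phi> x = 0) \<longrightarrow>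
        norm (u \<phi>) \<le> C * test_seminorm N \<phi>" by (rule is_distribution_bound[OF u K]) (rule that)
    have "norm (u (vderiv \<phi>)) \<le> (C * real (N + 1)) * test_seminorm (Suc N) \<phi>"
      if \<phi>: "test_fun \<phi>" "\<forall>x. x \<notin> K \<longrightarrow> \<phi> x = 0" for \<phi>
    proof -
      have "norm (u (vderiv \<phi>)) \<le> C * test_seminorm N (vderiv \<phi>)"
        using vderiv_funpow_outside[of K \<phi> _ 1] \<phi> K
        by (intro b[rule_format]) (auto simp: compact_imp_closed test_fun_vderiv)
      also have "\<dots> \<le> C * (real (N + 1) * test_seminorm (Suc N) \<phi>)"
        by (intro mult_left_mono test_seminorm_vderiv C \<phi>)
      finally show ?thesis by (simp add: mult.assoc)
    qed
    then show ?thesis by blast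
  qed
  moreover have "vderiv (\<lambda>x. \<phi> x + \<psi> x) = (\<lambda>x. vderiv \<phi> x + vderiv \<psi> x)"
    if "test_fun \<phi>" "test_fun \<psi>" for \<phi> \<psi>
    using funpow_vderiv_add[of \<phi> \<psi> 1] that by (simp add: test_fun_smooth)
  moreover have "vderiv (\<lambda>x. c * \<phi> x) = (\<lambda>x. c * vderiv \<phi> x)"
    if "test_fun \<phi>" for c \<phi>
    using funpow_vderiv_cmult[of \<phi> 1] that by (simp add: test_fun_smooth)
  ultimately show "is_distribution (\<lambda>\<phi>. if test_fun \<phi> then - u (vderiv \<phi>) else 0)"
    by (intro is_distributionI)
      (simp_all add: test_fun_add test_fun_cmult test_fun_vderiv is_distribution_add[OF u]
        is_distribution_cmult[OF u])
qed

definition locally_integrable :: "(real \<Rightarrow> complex) \<Rightarrow> bool" where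
  "locally_integrable f \<longleftrightarrow> (\<forall>K. compact K \<longrightarrow> set_integrable lborel K f)"

lemma locally_integrable_mult_test:
  assumes f: "locally_integrable f" and \<phi>: "test_fun \<phi>" "\<And>x. x \<notin> K \<Longrightarrow> \<phi> x = 0" "compact K"
    and B: "\<And>x. norm (\<phi> x) \<le> B"
  shows "integrable lborel (\<lambda>x. f x * \<phi> x)"
    and "norm (LBINT x. f x * \<phi> x) \<le> (LBINT x:K. norm (f x)) * B"
proof -
  have fK: "set_integrable lborel K f" using f \<phi> unfolding locally_integrable_def by blast
  then have i: "integrable lborel (\<lambda>x. indicator K x *\<^sub>R norm (f x))"
    using set_integrable_norm unfolding set_integrable_def by blast
  have i': "integrable lborel (\<lambda>x. indicator K x *\<^sub>R norm (f x) * B)"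
    by (rule integrable_mult_left[OF i])
  have m: "(\<lambda>x. f x * \<phi> x) \<in> borel_measurable lborel"
  proof -
    have e: "(\<lambda>x. f x * \<phi> x) = (\<lambda>x. (indicator K x *\<^sub>R f x) * \<phi> x)"
      using \<phi> by (auto simp: fun_eq_iff indicator_def)
    have "\<phi> \<in> borel_measurable borel"
      using smooth_continuous_on[OF test_fun_smooth[OF \<phi>(1)], of UNIV 0]
      by (simp add: borel_measurable_continuous_onI)
    then have m\<phi>: "\<phi> \<in> borel_measurable lborel" by simp
    show ?thesis
      unfolding e using fK[unfolded set_integrable_def]
      by (intro borel_measurable_times m\<phi> borel_measurable_integrable)
  qed
  have le: "norm (f x * \<phi> x) \<le> indicator K x *\<^sub>R norm (f x) * B" for x
    using \<phi>(2)[of x] B by (cases "x \<in> K") (auto simp: norm_mult intro!: mult_left_mono)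
  show int: "integrable lborel (\<lambda>x. f x * \<phi> x)"
  proof (rule Bochner_Integration.integrable_bound[OF i' m])
    have "norm (f x * \<phi> x) \<le> norm (indicator K x *\<^sub>R norm (f x) * B)" for x
      by (rule order_trans[OF le]) simp
    then show "AE x in lborel. norm (f x * \<phi> x) \<le> norm (indicator K x *\<^sub>R norm (f x) * B)"
      by simp
  qed
  have "norm (LBINT x. f x * \<phi> x) \<le> (LBINT x. norm (f x * \<phi> x))"
    by (rule integral_norm_bound)
  also have "\<dots> \<le> (LBINT x. indicator K x *\<^sub>R norm (f x) * B)"
    by (intro integral_mono integrable_norm int i' le)
  also have "\<dots> = (LBINT x:K. norm (f x)) * B"
    unfolding set_lebesgue_integral_def by simp
  finally show "norm (LBINT x. f x * \<phi> x) \<le> (LBINT x:K. norm (f x)) * B" .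
qed

text \<open>Functions that are not locally integrable are mapped to zero.\<close>

lift_definition dist_of_fun :: "(real \<Rightarrow> complex) \<Rightarrow> distribution"
  is "\<lambda>f \<phi>. if locally_integrable f \<and> test_fun \<phi> then LBINT x. f x * \<phi> x else 0"
proof -
  fix f
  show "is_distribution (\<lambda>\<phi>. if locally_integrable f \<and> test_fun \<phi> then LBINT x. f x * \<phi> x else 0)"
  proof (cases "locally_integrable f")
    case True
    have int: "integrable lborel (\<lambda>x. f x * \<phi> x)" if \<phi>: "test_fun \<phi>" for \<phi>
    proof -
      obtain R where "\<And>x. \<bar>x\<bar> > R \<Longrightarrow> \<phi> x = 0" using \<phi> test_fun_radius by metis
      then have "\<And>x. x \<notin> {-R..R} \<Longrightarrow> \<phi> x = 0" by force
      moreover obtain B where "\<And>x. norm (\<phi> x) \<le> B" using test_fun_bounded[OF \<phi>, of 0] by auto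
      ultimately show ?thesis using locally_integrable_mult_test(1)[OF True \<phi>] by blast
    qed
    have "\<exists>C N. \<forall>\<phi>. test_fun \<phi> \<longrightarrow> (\<forall>x. x \<notin> K \<longrightarrow> \<phi> x = 0) \<longrightarrow>
        norm (LBINT x. f x * \<phi> x) \<le> C * test_seminorm N \<phi>" if K: "compact K" for K
      by (rule exI[of _ "LBINT x:K. norm (f x)"], rule exI[of _ 0], intro allI impI,
          rule locally_integrable_mult_test(2)[OF True _ _ K])
        (use norm_le_test_seminorm[where k=0 and N=0] in auto)
    moreover have "(LBINT x. f x * (\<phi> x + \<psi> x)) = (LBINT x. f x * \<phi> x) + (LBINT x. f x * \<psi> x)"
      if "test_fun \<phi>" "test_fun \<psi>" for \<phi> \<psi>
      using int[OF that(1)] int[OF that(2)] by (simp add: distrib_left)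
    moreover have "(LBINT x. f x * (c * \<phi> x)) = c * (LBINT x. f x * \<phi> x)" for \<phi> c
      by (simp add: mult.left_commute)
    ultimately show ?thesis
      using True by (intro is_distributionI) (simp_all add: test_fun_add test_fun_cmult)
  next
    case False
    then show ?thesis unfolding is_distribution_def by (auto intro!: exI[of _ 0])
  qed
qed

definition conv :: "distribution \<Rightarrow> (real \<Rightarrow> complex) \<Rightarrow> real \<Rightarrow> complex" where
  "conv u \<phi> x = pairing u (\<lambda>y. \<phi> (x - y))"

text \<open>The distributions below do not depend on the number of differentiations, as long as
  \<open>a + r > -1\<close>; the least one is used. The values of the functions at \<open>0\<close> are irrelevant.\<close>

definition nu_plus_fun :: "real \<Rightarrow> real \<Rightarrow> complex" where
  "nu_plus_fun a x = (if x > 0 then of_real (x powr a / Gamma (a + 1)) else 0)"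

definition nu_minus_fun :: "real \<Rightarrow> real \<Rightarrow> complex" where
  "nu_minus_fun a x = (if x < 0 then of_real ((- x) powr a / Gamma (a + 1)) else 0)"

definition nu_plus :: "real \<Rightarrow> distribution" where
  "nu_plus a = (let r = (LEAST r::nat. a + r > -1)
     in (dist_deriv ^^ r) (dist_of_fun (nu_plus_fun (a + r))))"

definition nu_minus :: "real \<Rightarrow> distribution" where
  "nu_minus a = (let r = (LEAST r::nat. a + r > -1)
     in (-1) ^ r *\<^sub>R (dist_deriv ^^ r) (dist_of_fun (nu_minus_fun (a + r))))"


section \<open>The Colombeau algebra\<close>

definition mollifiers :: "nat \<Rightarrow> (real \<Rightarrow> complex) set" where
  "mollifiers q = {\<phi>. test_fun \<phi> \<and>
     (\<forall>j\<le>q. (LBINT x. of_real (x ^ j) * \<phi> x) = (if j = 0 then 1 else 0))}"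

definition dilate :: "real \<Rightarrow> (real \<Rightarrow> complex) \<Rightarrow> real \<Rightarrow> complex" where
  "dilate \<epsilon> \<phi> = (\<lambda>x. \<phi> (x / \<epsilon>) /\<^sub>R \<epsilon>)"

text \<open>Representatives are total in \<open>\<phi>\<close>, but only their values on \<open>mollifiers 0\<close> are ever used:
  two representatives that agree there differ by an element of \<open>negligible_nets\<close>, so the quotient is the
  one obtained from functions with domain \<open>mollifiers 0\<close>. The empty compact set is excluded since
  the supremum of the empty set of reals is unspecified.\<close>

type_synonym net = "(real \<Rightarrow> complex) \<Rightarrow> real \<Rightarrow> complex"

definition smooth_nets :: "net set" where
  "smooth_nets = {f. \<forall>\<phi>\<in>mollifiers 0. smooth (f \<phi>)}"

definition moderate :: "net set" where
  "moderate = {f \<in> smooth_nets. \<forall>K p. compact K \<longrightarrow> K \<noteq> {} \<longrightarrow>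
     (\<exists>q\<ge>1. \<forall>\<phi>\<in>mollifiers q.
       (\<lambda>\<epsilon>. SUP x\<in>K. norm ((vderiv ^^ p) (f (dilate \<epsilon> \<phi>)) x)) \<in> O[at_right 0](\<lambda>\<epsilon>. 1 / \<epsilon> ^ q))}"

definition negligible_nets :: "net set" where
  "negligible_nets = {f \<in> moderate. \<forall>K p. compact K \<longrightarrow> K \<noteq> {} \<longrightarrow>
     (\<exists>q\<ge>1. \<forall>r\<ge>q. \<forall>\<phi>\<in>mollifiers r.
       (\<lambda>\<epsilon>. SUP x\<in>K. norm ((vderiv ^^ p) (f (dilate \<epsilon> \<phi>)) x)) \<in> O[at_right 0](\<lambda>\<epsilon>. \<epsilon> ^ (r - q)))}"

lemma mollifiers_mono: "q \<le> r \<Longrightarrow> mollifiers r \<subseteq> mollifiers q"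
  unfolding mollifiers_def by auto

lemma mollifiers_test_fun: "\<phi> \<in> mollifiers q \<Longrightarrow> test_fun \<phi>"
  by (simp add: mollifiers_def)

lemma dilate_eq: "dilate \<epsilon> \<phi> = (\<lambda>x. of_real (1 / \<epsilon>) * \<phi> ((1 / \<epsilon>) * x + 0))"
  by (simp add: dilate_def scaleR_conv_of_real field_simps)

lemma test_fun_dilate: "test_fun \<phi> \<Longrightarrow> \<epsilon> > 0 \<Longrightarrow> test_fun (dilate \<epsilon> \<phi>)"
  unfolding dilate_eq by (intro test_fun_cmult test_fun_affine) auto

lemma funpow_vderiv_dilate:
  assumes "smooth \<phi>"
  shows "(vderiv ^^ n) (dilate \<epsilon> \<phi>) = (\<lambda>x. (vderiv ^^ n) \<phi> (x / \<epsilon>) /\<^sub>R \<epsilon> ^ Suc n)"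
  unfolding dilate_eq funpow_vderiv_cmult[OF smooth_affine[OF assms]] funpow_vderiv_affine[OF assms]
  by (simp add: scaleR_conv_of_real field_simps)

lemma mollifiers_dilate:
  assumes "\<phi> \<in> mollifiers q" "\<epsilon> > 0"
  shows "dilate \<epsilon> \<phi> \<in> mollifiers q"
proof -
  have "(LBINT x. of_real (x ^ j) * dilate \<epsilon> \<phi> x) = of_real (\<epsilon> ^ j) * (LBINT x. of_real (x ^ j) * \<phi> x)"
    for j
  proof -
    have "(LBINT x. of_real (x ^ j) * dilate \<epsilon> \<phi> x) =
        \<bar>\<epsilon>\<bar> *\<^sub>R (LBINT x. of_real ((0 + \<epsilon> * x) ^ j) * dilate \<epsilon> \<phi> (0 + \<epsilon> * x))"
      using assms(2) by (intro lborel_integral_real_affine) auto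
    also have "(\<lambda>x. of_real ((0 + \<epsilon> * x) ^ j) * dilate \<epsilon> \<phi> (0 + \<epsilon> * x)) =
        (\<lambda>x. of_real (\<epsilon> ^ j / \<epsilon>) * (of_real (x ^ j) * \<phi> x))"
      using assms(2) by (auto simp: dilate_def scaleR_conv_of_real power_mult_distrib field_simps)
    finally show ?thesis
      using assms(2) by (simp only: integral_mult_right_zero) (simp add: scaleR_conv_of_real)
  qed
  then show ?thesis
    using assms unfolding mollifiers_def by (auto intro: test_fun_dilate)
qed

lemma eventually_unit_interval: "\<forall>\<^sub>F \<epsilon> in at_right (0::real). 0 < \<epsilon> \<and> \<epsilon> < 1"
  by (auto simp: eventually_at_right_field intro!: exI[of _ 1])

lemma bigo_SUP_iff:
  assumes f: "f \<in> smooth_nets" and \<phi>: "\<phi> \<in> mollifiers q" and K: "compact K" "K \<noteq> {}"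
  shows "(\<lambda>\<epsilon>. SUP x\<in>K. norm ((vderiv ^^ p) (f (dilate \<epsilon> \<phi>)) x)) \<in> O[at_right 0](g) \<longleftrightarrow>
    (\<exists>C. \<forall>\<^sub>F \<epsilon> in at_right 0. \<forall>x\<in>K. norm ((vderiv ^^ p) (f (dilate \<epsilon> \<phi>)) x) \<le> C * norm (g \<epsilon> :: real))"
    (is "?S \<in> _ \<longleftrightarrow> ?R")
proof -
  have bdd: "bdd_above ((\<lambda>x. norm ((vderiv ^^ p) (f (dilate \<epsilon> \<phi>)) x)) ` K)" if "\<epsilon> > 0" for \<epsilon>
  proof -
    have "dilate \<epsilon> \<phi> \<in> mollifiers 0"
      using mollifiers_dilate[OF \<phi> that] mollifiers_mono[of 0 q] by auto
    then have "smooth (f (dilate \<epsilon> \<phi>))" using f unfolding smooth_nets_def by blast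
    then have "compact ((\<lambda>x. norm ((vderiv ^^ p) (f (dilate \<epsilon> \<phi>)) x)) ` K)"
      using K by (intro compact_continuous_image continuous_on_norm smooth_continuous_on) auto
    then show ?thesis by (intro bounded_imp_bdd_above compact_imp_bounded)
  qed
  show ?thesis
  proof
    assume "?S \<in> O[at_right 0](g)"
    then obtain c where "\<forall>\<^sub>F \<epsilon> in at_right 0. norm (?S \<epsilon>) \<le> c * norm (g \<epsilon>)"
      by (elim landau_o.bigE)
    then have "\<forall>\<^sub>F \<epsilon> in at_right 0. \<forall>x\<in>K.
        norm ((vderiv ^^ p) (f (dilate \<epsilon> \<phi>)) x) \<le> c * norm (g \<epsilon>)"
      using eventually_unit_interval
    proof eventually_elim
      case (elim \<epsilon>)
      show ?case
      proof
        fix x assume "x \<in> K"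
        then have "norm ((vderiv ^^ p) (f (dilate \<epsilon> \<phi>)) x) \<le> ?S \<epsilon>"
          using bdd elim by (intro cSUP_upper) auto
        then show "norm ((vderiv ^^ p) (f (dilate \<epsilon> \<phi>)) x) \<le> c * norm (g \<epsilon>)"
          using elim by (auto simp: abs_le_iff)
      qed
    qed
    then show ?R by blast
  next
    assume ?R
    then obtain c where c: "\<forall>\<^sub>F \<epsilon> in at_right 0. \<forall>x\<in>K.
        norm ((vderiv ^^ p) (f (dilate \<epsilon> \<phi>)) x) \<le> c * norm (g \<epsilon>)" by blast
    obtain x0 where x0: "x0 \<in> K" using K by blast
    have "\<forall>\<^sub>F \<epsilon> in at_right 0. norm (?S \<epsilon>) \<le> c * norm (g \<epsilon>)"
      using c eventually_unit_interval
    proof eventually_elim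
      case (elim \<epsilon>)
      then have "?S \<epsilon> \<le> c * norm (g \<epsilon>)" using K by (intro cSUP_least) auto
      moreover have "0 \<le> ?S \<epsilon>" using bdd elim x0 by (intro cSUP_upper2[where x=x0]) auto
      ultimately show ?case by simp
    qed
    then show "?S \<in> O[at_right 0](g)" by (rule bigoI)
  qed
qed

lemma norm_bound_weaken:
  fixes C C' y y' :: real
  assumes "z \<le> C * y" "0 \<le> y" "y \<le> y'"
  shows "z \<le> max \<bar>C\<bar> \<bar>C'\<bar> * y'" "z \<le> max \<bar>C'\<bar> \<bar>C\<bar> * y'"
proof -
  have "C * y \<le> max \<bar>C\<bar> \<bar>C'\<bar> * y'" using assms by (intro mult_mono) auto
  then show "z \<le> max \<bar>C\<bar> \<bar>C'\<bar> * y'" "z \<le> max \<bar>C'\<bar> \<bar>C\<bar> * y'"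
    using assms(1) by (auto simp: max.commute)
qed

lemma moderateI:
  assumes "f \<in> smooth_nets"
    and "\<And>K p. compact K \<Longrightarrow> K \<noteq> {} \<Longrightarrow> \<exists>q\<ge>1. \<forall>\<phi>\<in>mollifiers q. \<exists>C. \<forall>\<^sub>F \<epsilon> in at_right 0. \<forall>x\<in>K.
      norm ((vderiv ^^ p) (f (dilate \<epsilon> \<phi>)) x) \<le> C * (1 / \<epsilon> ^ q)"
  shows "f \<in> moderate"
proof -
  have "\<exists>q\<ge>1. \<forall>\<phi>\<in>mollifiers q.
       (\<lambda>\<epsilon>. SUP x\<in>K. norm ((vderiv ^^ p) (f (dilate \<epsilon> \<phi>)) x)) \<in> O[at_right 0](\<lambda>\<epsilon>. 1 / \<epsilon> ^ q)"
    if K: "compact K" "K \<noteq> {}" for K p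
  proof -
    obtain q where q: "q \<ge> 1" "\<forall>\<phi>\<in>mollifiers q. \<exists>C. \<forall>\<^sub>F \<epsilon> in at_right 0. \<forall>x\<in>K.
      norm ((vderiv ^^ p) (f (dilate \<epsilon> \<phi>)) x) \<le> C * (1 / \<epsilon> ^ q)"
      using assms(2)[OF K, of p] by blast
    show ?thesis
    proof (intro exI[of _ q] conjI q(1) ballI)
      fix \<phi> assume \<phi>: "\<phi> \<in> mollifiers q"
      obtain C where C: "\<forall>\<^sub>F \<epsilon> in at_right 0. \<forall>x\<in>K.
          norm ((vderiv ^^ p) (f (dilate \<epsilon> \<phi>)) x) \<le> C * (1 / \<epsilon> ^ q)"
        using q(2) \<phi> by blast
      have "\<forall>\<^sub>F \<epsilon> in at_right 0. \<forall>x\<in>K.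
          norm ((vderiv ^^ p) (f (dilate \<epsilon> \<phi>)) x) \<le> C * norm (1 / \<epsilon> ^ q)"
        using C eventually_unit_interval by eventually_elim simp
      then show "(\<lambda>\<epsilon>. SUP x\<in>K. norm ((vderiv ^^ p) (f (dilate \<epsilon> \<phi>)) x))
          \<in> O[at_right 0](\<lambda>\<epsilon>. 1 / \<epsilon> ^ q)"
        using bigo_SUP_iff[OF assms(1) \<phi> K] by blast
    qed
  qed
  with assms(1) show ?thesis unfolding moderate_def by blast
qed

lemma moderate_bounds:
  assumes f: "f \<in> moderate" and K: "compact K" "K \<noteq> {}"
  shows "\<exists>q\<ge>1. \<forall>\<phi>\<in>mollifiers q. \<exists>C. \<forall>\<^sub>F \<epsilon> in at_right 0. \<forall>k\<le>p. \<forall>x\<in>K.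
      norm ((vderiv ^^ k) (f (dilate \<epsilon> \<phi>)) x) \<le> C * (1 / \<epsilon> ^ q)"
proof -
  have E: "f \<in> smooth_nets" using f unfolding moderate_def by blast
  have single: "\<exists>q\<ge>1. \<forall>\<phi>\<in>mollifiers q. \<exists>C. \<forall>\<^sub>F \<epsilon> in at_right 0. \<forall>x\<in>K.
      norm ((vderiv ^^ p) (f (dilate \<epsilon> \<phi>)) x) \<le> C * norm (1 / \<epsilon> ^ q)" for p
  proof -
    obtain q where q: "q \<ge> 1" "\<forall>\<phi>\<in>mollifiers q.
       (\<lambda>\<epsilon>. SUP x\<in>K. norm ((vderiv ^^ p) (f (dilate \<epsilon> \<phi>)) x)) \<in> O[at_right 0](\<lambda>\<epsilon>. 1 / \<epsilon> ^ q)"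
      using f K unfolding moderate_def by blast
    show ?thesis
      using q(2) bigo_SUP_iff[OF E _ K] by (intro exI[of _ q] conjI q(1) ballI) simp
  qed
  show ?thesis
  proof (induction p)
    case 0
    obtain q where q: "q \<ge> 1" "\<forall>\<phi>\<in>mollifiers q. \<exists>C. \<forall>\<^sub>F \<epsilon> in at_right 0. \<forall>x\<in>K.
      norm ((vderiv ^^ 0) (f (dilate \<epsilon> \<phi>)) x) \<le> C * norm (1 / \<epsilon> ^ q)" using single[of 0] by blast
    show ?case
    proof (intro exI[of _ q] conjI q(1) ballI)
      fix \<phi> assume "\<phi> \<in> mollifiers q"
      then obtain C where C: "\<forall>\<^sub>F \<epsilon> in at_right 0. \<forall>x\<in>K.
        norm ((vderiv ^^ 0) (f (dilate \<epsilon> \<phi>)) x) \<le> C * norm (1 / \<epsilon> ^ q)" using q(2) by blast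
      show "\<exists>C. \<forall>\<^sub>F \<epsilon> in at_right 0. \<forall>k\<le>0. \<forall>x\<in>K.
          norm ((vderiv ^^ k) (f (dilate \<epsilon> \<phi>)) x) \<le> C * (1 / \<epsilon> ^ q)"
        by (rule exI[of _ C]) (use C eventually_unit_interval in eventually_elim, simp)
    qed
  next
    case (Suc p)
    obtain q where q: "q \<ge> 1" "\<forall>\<phi>\<in>mollifiers q. \<exists>C. \<forall>\<^sub>F \<epsilon> in at_right 0. \<forall>k\<le>p. \<forall>x\<in>K.
      norm ((vderiv ^^ k) (f (dilate \<epsilon> \<phi>)) x) \<le> C * (1 / \<epsilon> ^ q)" using Suc.IH by blast
    obtain r where r: "r \<ge> 1" "\<forall>\<phi>\<in>mollifiers r. \<exists>C. \<forall>\<^sub>F \<epsilon> in at_right 0. \<forall>x\<in>K.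
      norm ((vderiv ^^ Suc p) (f (dilate \<epsilon> \<phi>)) x) \<le> C * norm (1 / \<epsilon> ^ r)"
      using single[of "Suc p"] by blast
    define s where "s = max q r"
    show ?case
    proof (intro exI[of _ s] conjI ballI)
      show "s \<ge> 1" using q(1) by (simp add: s_def)
      fix \<phi> assume "\<phi> \<in> mollifiers s"
      then have "\<phi> \<in> mollifiers q" "\<phi> \<in> mollifiers r"
        using mollifiers_mono[of q s] mollifiers_mono[of r s] by (auto simp: s_def)
      then obtain C D where C: "\<forall>\<^sub>F \<epsilon> in at_right 0. \<forall>k\<le>p. \<forall>x\<in>K.
          norm ((vderiv ^^ k) (f (dilate \<epsilon> \<phi>)) x) \<le> C * (1 / \<epsilon> ^ q)"
        and D: "\<forall>\<^sub>F \<epsilon> in at_right 0. \<forall>x\<in>K.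
          norm ((vderiv ^^ Suc p) (f (dilate \<epsilon> \<phi>)) x) \<le> D * norm (1 / \<epsilon> ^ r)"
        using q(2) r(2) by blast
      have "\<forall>\<^sub>F \<epsilon> in at_right 0. \<forall>k\<le>Suc p. \<forall>x\<in>K.
          norm ((vderiv ^^ k) (f (dilate \<epsilon> \<phi>)) x) \<le> max \<bar>C\<bar> \<bar>D\<bar> * (1 / \<epsilon> ^ s)"
        using C D eventually_unit_interval
      proof eventually_elim
        case (elim \<epsilon>)
        have le: "0 \<le> 1 / \<epsilon> ^ q" "1 / \<epsilon> ^ q \<le> 1 / \<epsilon> ^ s" "0 \<le> 1 / \<epsilon> ^ r" "1 / \<epsilon> ^ r \<le> 1 / \<epsilon> ^ s"
          using elim(3) by (auto simp: s_def intro!: divide_left_mono power_decreasing)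
        show ?case
        proof (intro allI impI ballI)
          fix k x assume k: "k \<le> Suc p" and x: "x \<in> K"
          show "norm ((vderiv ^^ k) (f (dilate \<epsilon> \<phi>)) x) \<le> max \<bar>C\<bar> \<bar>D\<bar> * (1 / \<epsilon> ^ s)"
          proof (cases "k = Suc p")
            case True
            have "norm ((vderiv ^^ Suc p) (f (dilate \<epsilon> \<phi>)) x) \<le> D * norm (1 / \<epsilon> ^ r)"
              using elim(2) x by blast
            then have "norm ((vderiv ^^ Suc p) (f (dilate \<epsilon> \<phi>)) x) \<le> D * (1 / \<epsilon> ^ r)"
              using elim(3) by simp
            from norm_bound_weaken(2)[OF this le(3,4)] show ?thesis using True by blast
          next
            case False
            then have "norm ((vderiv ^^ k) (f (dilate \<epsilon> \<phi>)) x) \<le> C * (1 / \<epsilon> ^ q)"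
              using elim(1) x k by (simp add: le_Suc_eq)
            from norm_bound_weaken(1)[OF this le(1,2)] show ?thesis .
          qed
        qed
      qed
      then show "\<exists>C. \<forall>\<^sub>F \<epsilon> in at_right 0. \<forall>k\<le>Suc p. \<forall>x\<in>K.
          norm ((vderiv ^^ k) (f (dilate \<epsilon> \<phi>)) x) \<le> C * (1 / \<epsilon> ^ s)" by blast
    qed
  qed
qed

lemma negligible_netsI:
  assumes "f \<in> moderate"
    and "\<And>K p. compact K \<Longrightarrow> K \<noteq> {} \<Longrightarrow> \<exists>q\<ge>1. \<forall>r\<ge>q. \<forall>\<phi>\<in>mollifiers r. \<exists>C.
      \<forall>\<^sub>F \<epsilon> in at_right 0. \<forall>x\<in>K. norm ((vderiv ^^ p) (f (dilate \<epsilon> \<phi>)) x) \<le> C * \<epsilon> ^ (r - q)"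
  shows "f \<in> negligible_nets"
proof -
  have E: "f \<in> smooth_nets" using assms(1) unfolding moderate_def by blast
  have "\<exists>q\<ge>1. \<forall>r\<ge>q. \<forall>\<phi>\<in>mollifiers r.
       (\<lambda>\<epsilon>. SUP x\<in>K. norm ((vderiv ^^ p) (f (dilate \<epsilon> \<phi>)) x)) \<in> O[at_right 0](\<lambda>\<epsilon>. \<epsilon> ^ (r - q))"
    if K: "compact K" "K \<noteq> {}" for K p
  proof -
    obtain q where q: "q \<ge> 1" "\<forall>r\<ge>q. \<forall>\<phi>\<in>mollifiers r. \<exists>C.
      \<forall>\<^sub>F \<epsilon> in at_right 0. \<forall>x\<in>K. norm ((vderiv ^^ p) (f (dilate \<epsilon> \<phi>)) x) \<le> C * \<epsilon> ^ (r - q)"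
      using assms(2)[OF K, of p] by blast
    show ?thesis
    proof (intro exI[of _ q] conjI q(1) ballI allI impI)
      fix r \<phi> assume r: "r \<ge> q" and \<phi>: "\<phi> \<in> mollifiers r"
      obtain C where C: "\<forall>\<^sub>F \<epsilon> in at_right 0. \<forall>x\<in>K.
          norm ((vderiv ^^ p) (f (dilate \<epsilon> \<phi>)) x) \<le> C * \<epsilon> ^ (r - q)"
        using q(2) r \<phi> by blast
      have "\<forall>\<^sub>F \<epsilon> in at_right 0. \<forall>x\<in>K.
          norm ((vderiv ^^ p) (f (dilate \<epsilon> \<phi>)) x) \<le> C * norm (\<epsilon> ^ (r - q))"
        using C eventually_unit_interval by eventually_elim simp
      then show "(\<lambda>\<epsilon>. SUP x\<in>K. norm ((vderiv ^^ p) (f (dilate \<epsilon> \<phi>)) x))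
          \<in> O[at_right 0](\<lambda>\<epsilon>. \<epsilon> ^ (r - q))"
        using bigo_SUP_iff[OF E \<phi> K] by blast
    qed
  qed
  with assms(1) show ?thesis unfolding negligible_nets_def by blast
qed

lemma negligible_nets_bounds:
  assumes f: "f \<in> negligible_nets" and K: "compact K" "K \<noteq> {}"
  shows "\<exists>q\<ge>1. \<forall>r\<ge>q. \<forall>\<phi>\<in>mollifiers r. \<exists>C. \<forall>\<^sub>F \<epsilon> in at_right 0. \<forall>k\<le>p. \<forall>x\<in>K.
      norm ((vderiv ^^ k) (f (dilate \<epsilon> \<phi>)) x) \<le> C * \<epsilon> ^ (r - q)"
proof -
  have E: "f \<in> smooth_nets" using f unfolding negligible_nets_def moderate_def by blast
  have single: "\<exists>q\<ge>1. \<forall>r\<ge>q. \<forall>\<phi>\<in>mollifiers r. \<exists>C. \<forall>\<^sub>F \<epsilon> in at_right 0. \<forall>x\<in>K.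
      norm ((vderiv ^^ p) (f (dilate \<epsilon> \<phi>)) x) \<le> C * norm (\<epsilon> ^ (r - q))" for p
  proof -
    obtain q where q: "q \<ge> 1" "\<forall>r\<ge>q. \<forall>\<phi>\<in>mollifiers r.
       (\<lambda>\<epsilon>. SUP x\<in>K. norm ((vderiv ^^ p) (f (dilate \<epsilon> \<phi>)) x)) \<in> O[at_right 0](\<lambda>\<epsilon>. \<epsilon> ^ (r - q))"
      using f K unfolding negligible_nets_def by blast
    show ?thesis
      using q(2) bigo_SUP_iff[OF E _ K] by (intro exI[of _ q] conjI q(1) ballI allI impI) simp
  qed
  show ?thesis
  proof (induction p)
    case 0
    obtain q where q: "q \<ge> 1" "\<forall>r\<ge>q. \<forall>\<phi>\<in>mollifiers r. \<exists>C. \<forall>\<^sub>F \<epsilon> in at_right 0. \<forall>x\<in>K.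
      norm ((vderiv ^^ 0) (f (dilate \<epsilon> \<phi>)) x) \<le> C * norm (\<epsilon> ^ (r - q))" using single[of 0] by blast
    show ?case
    proof (intro exI[of _ q] conjI q(1) ballI allI impI)
      fix r \<phi> assume "r \<ge> q" "\<phi> \<in> mollifiers r"
      then obtain C where C: "\<forall>\<^sub>F \<epsilon> in at_right 0. \<forall>x\<in>K.
        norm ((vderiv ^^ 0) (f (dilate \<epsilon> \<phi>)) x) \<le> C * norm (\<epsilon> ^ (r - q))" using q(2) by blast
      show "\<exists>C. \<forall>\<^sub>F \<epsilon> in at_right 0. \<forall>k\<le>0. \<forall>x\<in>K.
          norm ((vderiv ^^ k) (f (dilate \<epsilon> \<phi>)) x) \<le> C * \<epsilon> ^ (r - q)"
        by (rule exI[of _ C]) (use C eventually_unit_interval in eventually_elim, simp)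
    qed
  next
    case (Suc p)
    obtain q where q: "q \<ge> 1" "\<forall>r\<ge>q. \<forall>\<phi>\<in>mollifiers r. \<exists>C. \<forall>\<^sub>F \<epsilon> in at_right 0. \<forall>k\<le>p. \<forall>x\<in>K.
      norm ((vderiv ^^ k) (f (dilate \<epsilon> \<phi>)) x) \<le> C * \<epsilon> ^ (r - q)" using Suc.IH by blast
    obtain q' where q': "q' \<ge> 1" "\<forall>r\<ge>q'. \<forall>\<phi>\<in>mollifiers r. \<exists>C. \<forall>\<^sub>F \<epsilon> in at_right 0. \<forall>x\<in>K.
      norm ((vderiv ^^ Suc p) (f (dilate \<epsilon> \<phi>)) x) \<le> C * norm (\<epsilon> ^ (r - q'))"
      using single[of "Suc p"] by blast
    define s where "s = max q q'"
    show ?case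
    proof (intro exI[of _ s] conjI ballI allI impI)
      show "s \<ge> 1" using q(1) by (simp add: s_def)
      fix r \<phi> assume rs: "r \<ge> s" and \<phi>: "\<phi> \<in> mollifiers r"
      then have "r \<ge> q" "r \<ge> q'" by (auto simp: s_def)
      with \<phi> obtain C D where C: "\<forall>\<^sub>F \<epsilon> in at_right 0. \<forall>k\<le>p. \<forall>x\<in>K.
          norm ((vderiv ^^ k) (f (dilate \<epsilon> \<phi>)) x) \<le> C * \<epsilon> ^ (r - q)"
        and D: "\<forall>\<^sub>F \<epsilon> in at_right 0. \<forall>x\<in>K.
          norm ((vderiv ^^ Suc p) (f (dilate \<epsilon> \<phi>)) x) \<le> D * norm (\<epsilon> ^ (r - q'))"
        using q(2) q'(2) by blast
      have "\<forall>\<^sub>F \<epsilon> in at_right 0. \<forall>k\<le>Suc p. \<forall>x\<in>K.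
          norm ((vderiv ^^ k) (f (dilate \<epsilon> \<phi>)) x) \<le> max \<bar>C\<bar> \<bar>D\<bar> * \<epsilon> ^ (r - s)"
        using C D eventually_unit_interval
      proof eventually_elim
        case (elim \<epsilon>)
        have le: "0 \<le> \<epsilon> ^ (r - q)" "\<epsilon> ^ (r - q) \<le> \<epsilon> ^ (r - s)"
            "0 \<le> \<epsilon> ^ (r - q')" "\<epsilon> ^ (r - q') \<le> \<epsilon> ^ (r - s)"
          using elim(3) rs by (auto simp: s_def intro!: power_decreasing)
        show ?case
        proof (intro allI impI ballI)
          fix k x assume k: "k \<le> Suc p" and x: "x \<in> K"
          show "norm ((vderiv ^^ k) (f (dilate \<epsilon> \<phi>)) x) \<le> max \<bar>C\<bar> \<bar>D\<bar> * \<epsilon> ^ (r - s)"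
          proof (cases "k = Suc p")
            case True
            have "norm ((vderiv ^^ Suc p) (f (dilate \<epsilon> \<phi>)) x) \<le> D * norm (\<epsilon> ^ (r - q'))"
              using elim(2) x by blast
            then have "norm ((vderiv ^^ Suc p) (f (dilate \<epsilon> \<phi>)) x) \<le> D * \<epsilon> ^ (r - q')"
              using elim(3) by simp
            from norm_bound_weaken(2)[OF this le(3,4)] show ?thesis using True by blast
          next
            case False
            then have "norm ((vderiv ^^ k) (f (dilate \<epsilon> \<phi>)) x) \<le> C * \<epsilon> ^ (r - q)"
              using elim(1) x k by (simp add: le_Suc_eq)
            from norm_bound_weaken(1)[OF this le(1,2)] show ?thesis .
          qed
        qed
      qed
      then show "\<exists>C. \<forall>\<^sub>F \<epsilon> in at_right 0. \<forall>k\<le>Suc p. \<forall>x\<in>K.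
          norm ((vderiv ^^ k) (f (dilate \<epsilon> \<phi>)) x) \<le> C * \<epsilon> ^ (r - s)" by blast
    qed
  qed
qed

lemma moderate_smooth:
  assumes "f \<in> moderate" "\<phi> \<in> mollifiers q" "\<epsilon> > 0"
  shows "smooth (f (dilate \<epsilon> \<phi>))"
proof -
  have "dilate \<epsilon> \<phi> \<in> mollifiers 0"
    using mollifiers_dilate[OF assms(2,3)] mollifiers_mono[of 0 q] by auto
  with assms(1) show ?thesis unfolding moderate_def smooth_nets_def by blast
qed

lemma norm_funpow_vderiv_mult_le:
  assumes "smooth f" "smooth g"
    and "\<And>k. k \<le> n \<Longrightarrow> norm ((vderiv ^^ k) f x) \<le> A" "\<And>k. k \<le> n \<Longrightarrow> norm ((vderiv ^^ k) g x) \<le> B"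
  shows "norm ((vderiv ^^ n) (\<lambda>x. f x * g x) x) \<le> 2 ^ n * (A * B)"
proof -
  have A: "A \<ge> 0" using assms(3)[of 0] norm_ge_zero order_trans by blast
  have "norm ((vderiv ^^ n) (\<lambda>x. f x * g x) x) \<le>
      (\<Sum>k\<le>n. norm (of_nat (n choose k) * ((vderiv ^^ k) f x * (vderiv ^^ (n - k)) g x)))"
    unfolding funpow_vderiv_mult[OF assms(1,2)] by (rule norm_sum)
  also have "\<dots> \<le> (\<Sum>k\<le>n. real (n choose k) * (A * B))"
    unfolding norm_mult norm_of_nat using assms(3,4) A by (intro sum_mono mult_left_mono mult_mono) auto
  also have "\<dots> = 2 ^ n * (A * B)"
    unfolding sum_distrib_right[symmetric] of_nat_sum[symmetric] choose_row_sum by simp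
  finally show ?thesis .
qed

lemma moderate_const: "(\<lambda>_ _. c) \<in> moderate"
proof (rule moderateI)
  show "(\<lambda>_ _. c) \<in> smooth_nets" by (simp add: smooth_nets_def smooth_const)
  fix K :: "real set" and p :: nat
  have "\<forall>\<^sub>F \<epsilon> in at_right 0. \<forall>x\<in>K. norm ((vderiv ^^ p) (\<lambda>_. c) x) \<le> norm c * (1 / \<epsilon> ^ 1)"
    using eventually_unit_interval
  proof eventually_elim
    case (elim \<epsilon>)
    have "norm c * 1 \<le> norm c * (1 / \<epsilon> ^ 1)" using elim by (intro mult_left_mono) auto
    then show ?case using elim by (auto simp: funpow_vderiv_const)
  qed
  then show "\<exists>q\<ge>1. \<forall>\<phi>\<in>mollifiers q. \<exists>C. \<forall>\<^sub>F \<epsilon> in at_right 0. \<forall>x\<in>K.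
      norm ((vderiv ^^ p) (\<lambda>_. c) x) \<le> C * (1 / \<epsilon> ^ q)" by blast
qed

lemma moderate_add:
  assumes f: "f \<in> moderate" and g: "g \<in> moderate"
  shows "(\<lambda>\<phi> x. f \<phi> x + g \<phi> x) \<in> moderate"
proof (rule moderateI)
  show "(\<lambda>\<phi> x. f \<phi> x + g \<phi> x) \<in> smooth_nets"
    using f g unfolding moderate_def smooth_nets_def by (auto intro: smooth_add)
  fix K :: "real set" and p :: nat assume K: "compact K" "K \<noteq> {}"
  obtain q where q: "q \<ge> 1" "\<forall>\<phi>\<in>mollifiers q. \<exists>C. \<forall>\<^sub>F \<epsilon> in at_right 0. \<forall>k\<le>p. \<forall>x\<in>K.
      norm ((vderiv ^^ k) (f (dilate \<epsilon> \<phi>)) x) \<le> C * (1 / \<epsilon> ^ q)"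
    using moderate_bounds[OF f K, of p] by blast
  obtain r where r: "r \<ge> 1" "\<forall>\<phi>\<in>mollifiers r. \<exists>C. \<forall>\<^sub>F \<epsilon> in at_right 0. \<forall>k\<le>p. \<forall>x\<in>K.
      norm ((vderiv ^^ k) (g (dilate \<epsilon> \<phi>)) x) \<le> C * (1 / \<epsilon> ^ r)"
    using moderate_bounds[OF g K, of p] by blast
  define s where "s = max q r"
  show "\<exists>q\<ge>1. \<forall>\<phi>\<in>mollifiers q. \<exists>C. \<forall>\<^sub>F \<epsilon> in at_right 0. \<forall>x\<in>K.
      norm ((vderiv ^^ p) (\<lambda>x. f (dilate \<epsilon> \<phi>) x + g (dilate \<epsilon> \<phi>) x) x) \<le> C * (1 / \<epsilon> ^ q)"
  proof (intro exI[of _ s] conjI ballI)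
    show "s \<ge> 1" using q(1) by (simp add: s_def)
    fix \<phi> assume \<phi>: "\<phi> \<in> mollifiers s"
    then have "\<phi> \<in> mollifiers q" "\<phi> \<in> mollifiers r"
      using mollifiers_mono[of q s] mollifiers_mono[of r s] by (auto simp: s_def)
    then obtain C D where C: "\<forall>\<^sub>F \<epsilon> in at_right 0. \<forall>k\<le>p. \<forall>x\<in>K.
        norm ((vderiv ^^ k) (f (dilate \<epsilon> \<phi>)) x) \<le> C * (1 / \<epsilon> ^ q)"
      and D: "\<forall>\<^sub>F \<epsilon> in at_right 0. \<forall>k\<le>p. \<forall>x\<in>K.
        norm ((vderiv ^^ k) (g (dilate \<epsilon> \<phi>)) x) \<le> D * (1 / \<epsilon> ^ r)"
      using q(2) r(2) by blast
    have "\<forall>\<^sub>F \<epsilon> in at_right 0. \<forall>x\<in>K. norm ((vderiv ^^ p)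
        (\<lambda>x. f (dilate \<epsilon> \<phi>) x + g (dilate \<epsilon> \<phi>) x) x) \<le> (2 * max \<bar>C\<bar> \<bar>D\<bar>) * (1 / \<epsilon> ^ s)"
      using C D eventually_unit_interval
    proof eventually_elim
      case (elim \<epsilon>)
      have le: "0 \<le> 1 / \<epsilon> ^ q" "1 / \<epsilon> ^ q \<le> 1 / \<epsilon> ^ s" "0 \<le> 1 / \<epsilon> ^ r" "1 / \<epsilon> ^ r \<le> 1 / \<epsilon> ^ s"
        using elim(3) by (auto simp: s_def intro!: divide_left_mono power_decreasing)
      show ?case
      proof
        fix x assume x: "x \<in> K"
        have "norm ((vderiv ^^ p) (f (dilate \<epsilon> \<phi>)) x) \<le> max \<bar>C\<bar> \<bar>D\<bar> * (1 / \<epsilon> ^ s)"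
          using elim(1) x by (intro norm_bound_weaken(1)[OF _ le(1,2)]) blast
        moreover have "norm ((vderiv ^^ p) (g (dilate \<epsilon> \<phi>)) x) \<le> max \<bar>C\<bar> \<bar>D\<bar> * (1 / \<epsilon> ^ s)"
          using elim(2) x by (intro norm_bound_weaken(2)[OF _ le(3,4)]) blast
        moreover have "(vderiv ^^ p) (\<lambda>x. f (dilate \<epsilon> \<phi>) x + g (dilate \<epsilon> \<phi>) x) x =
            (vderiv ^^ p) (f (dilate \<epsilon> \<phi>)) x + (vderiv ^^ p) (g (dilate \<epsilon> \<phi>)) x"
          using elim(3) by (subst funpow_vderiv_add) (auto intro: moderate_smooth[OF f \<phi>] moderate_smooth[OF g \<phi>])
        ultimately have "norm ((vderiv ^^ p) (\<lambda>x. f (dilate \<epsilon> \<phi>) x + g (dilate \<epsilon> \<phi>) x) x)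
            \<le> max \<bar>C\<bar> \<bar>D\<bar> * (1 / \<epsilon> ^ s) + max \<bar>C\<bar> \<bar>D\<bar> * (1 / \<epsilon> ^ s)"
          by (simp only: norm_triangle_mono)
        also have "\<dots> = (2 * max \<bar>C\<bar> \<bar>D\<bar>) * (1 / \<epsilon> ^ s)"
          by (simp only: mult_2 distrib_right)
        finally show "norm ((vderiv ^^ p) (\<lambda>x. f (dilate \<epsilon> \<phi>) x + g (dilate \<epsilon> \<phi>) x) x)
            \<le> (2 * max \<bar>C\<bar> \<bar>D\<bar>) * (1 / \<epsilon> ^ s)" .
      qed
    qed
    then show "\<exists>C. \<forall>\<^sub>F \<epsilon> in at_right 0. \<forall>x\<in>K. norm ((vderiv ^^ p)
        (\<lambda>x. f (dilate \<epsilon> \<phi>) x + g (dilate \<epsilon> \<phi>) x) x) \<le> C * (1 / \<epsilon> ^ s)" by blast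
  qed
qed

lemma moderate_mult:
  assumes f: "f \<in> moderate" and g: "g \<in> moderate"
  shows "(\<lambda>\<phi> x. f \<phi> x * g \<phi> x) \<in> moderate"
proof (rule moderateI)
  show "(\<lambda>\<phi> x. f \<phi> x * g \<phi> x) \<in> smooth_nets"
    using f g unfolding moderate_def smooth_nets_def by (auto intro: smooth_mult)
  fix K :: "real set" and p :: nat assume K: "compact K" "K \<noteq> {}"
  obtain q where q: "q \<ge> 1" "\<forall>\<phi>\<in>mollifiers q. \<exists>C. \<forall>\<^sub>F \<epsilon> in at_right 0. \<forall>k\<le>p. \<forall>x\<in>K.
      norm ((vderiv ^^ k) (f (dilate \<epsilon> \<phi>)) x) \<le> C * (1 / \<epsilon> ^ q)"
    using moderate_bounds[OF f K, of p] by blast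
  obtain r where r: "r \<ge> 1" "\<forall>\<phi>\<in>mollifiers r. \<exists>C. \<forall>\<^sub>F \<epsilon> in at_right 0. \<forall>k\<le>p. \<forall>x\<in>K.
      norm ((vderiv ^^ k) (g (dilate \<epsilon> \<phi>)) x) \<le> C * (1 / \<epsilon> ^ r)"
    using moderate_bounds[OF g K, of p] by blast
  show "\<exists>q\<ge>1. \<forall>\<phi>\<in>mollifiers q. \<exists>C. \<forall>\<^sub>F \<epsilon> in at_right 0. \<forall>x\<in>K.
      norm ((vderiv ^^ p) (\<lambda>x. f (dilate \<epsilon> \<phi>) x * g (dilate \<epsilon> \<phi>) x) x) \<le> C * (1 / \<epsilon> ^ q)"
  proof (intro exI[of _ "q + r"] conjI ballI)
    show "q + r \<ge> 1" using q(1) by simp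
    fix \<phi> assume \<phi>: "\<phi> \<in> mollifiers (q + r)"
    then have "\<phi> \<in> mollifiers q" "\<phi> \<in> mollifiers r"
      using mollifiers_mono[of q "q + r"] mollifiers_mono[of r "q + r"] by auto
    then obtain C D where C: "\<forall>\<^sub>F \<epsilon> in at_right 0. \<forall>k\<le>p. \<forall>x\<in>K.
        norm ((vderiv ^^ k) (f (dilate \<epsilon> \<phi>)) x) \<le> C * (1 / \<epsilon> ^ q)"
      and D: "\<forall>\<^sub>F \<epsilon> in at_right 0. \<forall>k\<le>p. \<forall>x\<in>K.
        norm ((vderiv ^^ k) (g (dilate \<epsilon> \<phi>)) x) \<le> D * (1 / \<epsilon> ^ r)"
      using q(2) r(2) by blast
    have "\<forall>\<^sub>F \<epsilon> in at_right 0. \<forall>x\<in>K. norm ((vderiv ^^ p)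
        (\<lambda>x. f (dilate \<epsilon> \<phi>) x * g (dilate \<epsilon> \<phi>) x) x) \<le> (2 ^ p * (C * D)) * (1 / \<epsilon> ^ (q + r))"
      using C D eventually_unit_interval
    proof eventually_elim
      case (elim \<epsilon>)
      show ?case
      proof
        fix x assume x: "x \<in> K"
        have "norm ((vderiv ^^ p) (\<lambda>x. f (dilate \<epsilon> \<phi>) x * g (dilate \<epsilon> \<phi>) x) x) \<le>
            2 ^ p * ((C * (1 / \<epsilon> ^ q)) * (D * (1 / \<epsilon> ^ r)))"
          using elim x
          by (intro norm_funpow_vderiv_mult_le moderate_smooth[OF f \<phi>] moderate_smooth[OF g \<phi>]) blast+
        also have "\<dots> = (2 ^ p * (C * D)) * (1 / \<epsilon> ^ (q + r))"
          by (simp add: power_add)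
        finally show "norm ((vderiv ^^ p) (\<lambda>x. f (dilate \<epsilon> \<phi>) x * g (dilate \<epsilon> \<phi>) x) x) \<le>
            (2 ^ p * (C * D)) * (1 / \<epsilon> ^ (q + r))" .
      qed
    qed
    then show "\<exists>C. \<forall>\<^sub>F \<epsilon> in at_right 0. \<forall>x\<in>K. norm ((vderiv ^^ p)
        (\<lambda>x. f (dilate \<epsilon> \<phi>) x * g (dilate \<epsilon> \<phi>) x) x) \<le> C * (1 / \<epsilon> ^ (q + r))" by blast
  qed
qed

lemma negligible_nets_moderate: "f \<in> negligible_nets \<Longrightarrow> f \<in> moderate"
  unfolding negligible_nets_def by blast

lemma negligible_nets_zero: "(\<lambda>_ _. 0) \<in> negligible_nets"
proof (rule negligible_netsI[OF moderate_const])
  fix K :: "real set" and p :: nat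
  have "\<forall>\<^sub>F \<epsilon>::real in at_right 0. \<forall>x\<in>K. norm ((vderiv ^^ p) (\<lambda>_. 0) x) \<le> 0 * \<epsilon> ^ (r - 1)" for r
    by (simp add: funpow_vderiv_const)
  then show "\<exists>q\<ge>1. \<forall>r\<ge>q. \<forall>\<phi>\<in>mollifiers r. \<exists>C. \<forall>\<^sub>F \<epsilon> in at_right 0. \<forall>x\<in>K.
      norm ((vderiv ^^ p) (\<lambda>_. 0) x) \<le> C * \<epsilon> ^ (r - q)" by blast
qed

lemma negligible_nets_add:
  assumes f: "f \<in> negligible_nets" and g: "g \<in> negligible_nets"
  shows "(\<lambda>\<phi> x. f \<phi> x + g \<phi> x) \<in> negligible_nets"
proof (rule negligible_netsI)
  note fm = negligible_nets_moderate[OF f] and gm = negligible_nets_moderate[OF g]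
  show "(\<lambda>\<phi> x. f \<phi> x + g \<phi> x) \<in> moderate" using fm gm by (rule moderate_add)
  fix K :: "real set" and p :: nat assume K: "compact K" "K \<noteq> {}"
  obtain q where q: "q \<ge> 1" "\<forall>r\<ge>q. \<forall>\<phi>\<in>mollifiers r. \<exists>C. \<forall>\<^sub>F \<epsilon> in at_right 0. \<forall>k\<le>p. \<forall>x\<in>K.
      norm ((vderiv ^^ k) (f (dilate \<epsilon> \<phi>)) x) \<le> C * \<epsilon> ^ (r - q)"
    using negligible_nets_bounds[OF f K, of p] by blast
  obtain q' where q': "q' \<ge> 1" "\<forall>r\<ge>q'. \<forall>\<phi>\<in>mollifiers r. \<exists>C. \<forall>\<^sub>F \<epsilon> in at_right 0. \<forall>k\<le>p. \<forall>x\<in>K.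
      norm ((vderiv ^^ k) (g (dilate \<epsilon> \<phi>)) x) \<le> C * \<epsilon> ^ (r - q')"
    using negligible_nets_bounds[OF g K, of p] by blast
  define s where "s = max q q'"
  show "\<exists>q\<ge>1. \<forall>r\<ge>q. \<forall>\<phi>\<in>mollifiers r. \<exists>C. \<forall>\<^sub>F \<epsilon> in at_right 0. \<forall>x\<in>K.
      norm ((vderiv ^^ p) (\<lambda>x. f (dilate \<epsilon> \<phi>) x + g (dilate \<epsilon> \<phi>) x) x) \<le> C * \<epsilon> ^ (r - q)"
  proof (intro exI[of _ s] conjI ballI allI impI)
    show "s \<ge> 1" using q(1) by (simp add: s_def)
    fix r \<phi> assume rs: "r \<ge> s" and \<phi>: "\<phi> \<in> mollifiers r"
    then have "r \<ge> q" "r \<ge> q'" by (auto simp: s_def)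
    with \<phi> obtain C D where C: "\<forall>\<^sub>F \<epsilon> in at_right 0. \<forall>k\<le>p. \<forall>x\<in>K.
        norm ((vderiv ^^ k) (f (dilate \<epsilon> \<phi>)) x) \<le> C * \<epsilon> ^ (r - q)"
      and D: "\<forall>\<^sub>F \<epsilon> in at_right 0. \<forall>k\<le>p. \<forall>x\<in>K.
        norm ((vderiv ^^ k) (g (dilate \<epsilon> \<phi>)) x) \<le> D * \<epsilon> ^ (r - q')"
      using q(2) q'(2) by blast
    have "\<forall>\<^sub>F \<epsilon> in at_right 0. \<forall>x\<in>K. norm ((vderiv ^^ p)
        (\<lambda>x. f (dilate \<epsilon> \<phi>) x + g (dilate \<epsilon> \<phi>) x) x) \<le> (2 * max \<bar>C\<bar> \<bar>D\<bar>) * \<epsilon> ^ (r - s)"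
      using C D eventually_unit_interval
    proof eventually_elim
      case (elim \<epsilon>)
      have le: "0 \<le> \<epsilon> ^ (r - q)" "\<epsilon> ^ (r - q) \<le> \<epsilon> ^ (r - s)"
          "0 \<le> \<epsilon> ^ (r - q')" "\<epsilon> ^ (r - q') \<le> \<epsilon> ^ (r - s)"
        using elim(3) rs by (auto simp: s_def intro!: power_decreasing)
      show ?case
      proof
        fix x assume x: "x \<in> K"
        have "norm ((vderiv ^^ p) (f (dilate \<epsilon> \<phi>)) x) \<le> max \<bar>C\<bar> \<bar>D\<bar> * \<epsilon> ^ (r - s)"
          using elim(1) x by (intro norm_bound_weaken(1)[OF _ le(1,2)]) blast
        moreover have "norm ((vderiv ^^ p) (g (dilate \<epsilon> \<phi>)) x) \<le> max \<bar>C\<bar> \<bar>D\<bar> * \<epsilon> ^ (r - s)"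
          using elim(2) x by (intro norm_bound_weaken(2)[OF _ le(3,4)]) blast
        moreover have "(vderiv ^^ p) (\<lambda>x. f (dilate \<epsilon> \<phi>) x + g (dilate \<epsilon> \<phi>) x) x =
            (vderiv ^^ p) (f (dilate \<epsilon> \<phi>)) x + (vderiv ^^ p) (g (dilate \<epsilon> \<phi>)) x"
          using elim(3) by (subst funpow_vderiv_add) (auto intro: moderate_smooth[OF fm \<phi>] moderate_smooth[OF gm \<phi>])
        ultimately have "norm ((vderiv ^^ p) (\<lambda>x. f (dilate \<epsilon> \<phi>) x + g (dilate \<epsilon> \<phi>) x) x)
            \<le> max \<bar>C\<bar> \<bar>D\<bar> * \<epsilon> ^ (r - s) + max \<bar>C\<bar> \<bar>D\<bar> * \<epsilon> ^ (r - s)"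
          by (simp only: norm_triangle_mono)
        also have "\<dots> = (2 * max \<bar>C\<bar> \<bar>D\<bar>) * \<epsilon> ^ (r - s)"
          by (simp only: mult_2 distrib_right)
        finally show "norm ((vderiv ^^ p) (\<lambda>x. f (dilate \<epsilon> \<phi>) x + g (dilate \<epsilon> \<phi>) x) x)
            \<le> (2 * max \<bar>C\<bar> \<bar>D\<bar>) * \<epsilon> ^ (r - s)" .
      qed
    qed
    then show "\<exists>C. \<forall>\<^sub>F \<epsilon> in at_right 0. \<forall>x\<in>K. norm ((vderiv ^^ p)
        (\<lambda>x. f (dilate \<epsilon> \<phi>) x + g (dilate \<epsilon> \<phi>) x) x) \<le> C * \<epsilon> ^ (r - s)" by blast
  qed
qed

lemma negligible_nets_mult:
  assumes f: "f \<in> negligible_nets" and g: "g \<in> moderate"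
  shows "(\<lambda>\<phi> x. f \<phi> x * g \<phi> x) \<in> negligible_nets"
proof (rule negligible_netsI)
  note fm = negligible_nets_moderate[OF f]
  show "(\<lambda>\<phi> x. f \<phi> x * g \<phi> x) \<in> moderate" using fm g by (rule moderate_mult)
  fix K :: "real set" and p :: nat assume K: "compact K" "K \<noteq> {}"
  obtain q where q: "q \<ge> 1" "\<forall>r\<ge>q. \<forall>\<phi>\<in>mollifiers r. \<exists>C. \<forall>\<^sub>F \<epsilon> in at_right 0. \<forall>k\<le>p. \<forall>x\<in>K.
      norm ((vderiv ^^ k) (f (dilate \<epsilon> \<phi>)) x) \<le> C * \<epsilon> ^ (r - q)"
    using negligible_nets_bounds[OF f K, of p] by blast
  obtain q' where q': "q' \<ge> 1" "\<forall>\<phi>\<in>mollifiers q'. \<exists>C. \<forall>\<^sub>F \<epsilon> in at_right 0. \<forall>k\<le>p. \<forall>x\<in>K.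
      norm ((vderiv ^^ k) (g (dilate \<epsilon> \<phi>)) x) \<le> C * (1 / \<epsilon> ^ q')"
    using moderate_bounds[OF g K, of p] by blast
  show "\<exists>q\<ge>1. \<forall>r\<ge>q. \<forall>\<phi>\<in>mollifiers r. \<exists>C. \<forall>\<^sub>F \<epsilon> in at_right 0. \<forall>x\<in>K.
      norm ((vderiv ^^ p) (\<lambda>x. f (dilate \<epsilon> \<phi>) x * g (dilate \<epsilon> \<phi>) x) x) \<le> C * \<epsilon> ^ (r - q)"
  proof (intro exI[of _ "q + q'"] conjI ballI allI impI)
    show "q + q' \<ge> 1" using q(1) by simp
    fix r \<phi> assume r: "r \<ge> q + q'" and \<phi>: "\<phi> \<in> mollifiers r"
    then have "r \<ge> q" "\<phi> \<in> mollifiers q'"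
      using mollifiers_mono[of q' r] by auto
    with \<phi> obtain C D where C: "\<forall>\<^sub>F \<epsilon> in at_right 0. \<forall>k\<le>p. \<forall>x\<in>K.
        norm ((vderiv ^^ k) (f (dilate \<epsilon> \<phi>)) x) \<le> C * \<epsilon> ^ (r - q)"
      and D: "\<forall>\<^sub>F \<epsilon> in at_right 0. \<forall>k\<le>p. \<forall>x\<in>K.
        norm ((vderiv ^^ k) (g (dilate \<epsilon> \<phi>)) x) \<le> D * (1 / \<epsilon> ^ q')"
      using q(2) q'(2) by blast
    have "\<forall>\<^sub>F \<epsilon> in at_right 0. \<forall>x\<in>K. norm ((vderiv ^^ p)
        (\<lambda>x. f (dilate \<epsilon> \<phi>) x * g (dilate \<epsilon> \<phi>) x) x) \<le> (2 ^ p * (C * D)) * \<epsilon> ^ (r - (q + q'))"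
      using C D eventually_unit_interval
    proof eventually_elim
      case (elim \<epsilon>)
      show ?case
      proof
        fix x assume x: "x \<in> K"
        have "norm ((vderiv ^^ p) (\<lambda>x. f (dilate \<epsilon> \<phi>) x * g (dilate \<epsilon> \<phi>) x) x) \<le>
            2 ^ p * ((C * \<epsilon> ^ (r - q)) * (D * (1 / \<epsilon> ^ q')))"
          using elim x
          by (intro norm_funpow_vderiv_mult_le moderate_smooth[OF fm \<phi>] moderate_smooth[OF g \<phi>]) blast+
        also have "\<epsilon> ^ (r - q) = \<epsilon> ^ (r - (q + q')) * \<epsilon> ^ q'"
          using r by (simp flip: power_add)
        also have "2 ^ p * ((C * (\<epsilon> ^ (r - (q + q')) * \<epsilon> ^ q')) * (D * (1 / \<epsilon> ^ q'))) =
            (2 ^ p * (C * D)) * \<epsilon> ^ (r - (q + q'))"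
          using elim(3) by simp
        finally show "norm ((vderiv ^^ p) (\<lambda>x. f (dilate \<epsilon> \<phi>) x * g (dilate \<epsilon> \<phi>) x) x) \<le>
            (2 ^ p * (C * D)) * \<epsilon> ^ (r - (q + q'))" .
      qed
    qed
    then show "\<exists>C. \<forall>\<^sub>F \<epsilon> in at_right 0. \<forall>x\<in>K. norm ((vderiv ^^ p)
        (\<lambda>x. f (dilate \<epsilon> \<phi>) x * g (dilate \<epsilon> \<phi>) x) x) \<le> C * \<epsilon> ^ (r - (q + q'))" by blast
  qed
qed

lemma moderate_cmult: "f \<in> moderate \<Longrightarrow> (\<lambda>\<phi> x. c * f \<phi> x) \<in> moderate"
  using moderate_mult[OF moderate_const] .

lemma negligible_nets_cmult: "f \<in> negligible_nets \<Longrightarrow> (\<lambda>\<phi> x. c * f \<phi> x) \<in> negligible_nets"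
  using negligible_nets_mult[OF _ moderate_const] by (simp add: mult.commute)

definition colombeau_rel :: "net \<Rightarrow> net \<Rightarrow> bool" where
  "colombeau_rel f g \<longleftrightarrow>
     f \<in> moderate \<and> g \<in> moderate \<and> (\<lambda>\<phi> x. f \<phi> x - g \<phi> x) \<in> negligible_nets"

lemma colombeau_rel_refl: "f \<in> moderate \<Longrightarrow> colombeau_rel f f"
  unfolding colombeau_rel_def by (simp add: negligible_nets_zero)

quotient_type colombeau = net / partial: colombeau_rel
proof (rule part_equivpI)
  show "\<exists>f. colombeau_rel f f" using colombeau_rel_refl moderate_const by blast
  show "symp colombeau_rel"
  proof (rule sympI)
    fix f g assume "colombeau_rel f g"
    then show "colombeau_rel g f"
      using negligible_nets_cmult[of "\<lambda>\<phi> x. f \<phi> x - g \<phi> x" "-1"]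
      unfolding colombeau_rel_def by simp
  qed
  show "transp colombeau_rel"
  proof (rule transpI)
    fix f g h assume "colombeau_rel f g" "colombeau_rel g h"
    then show "colombeau_rel f h"
      using negligible_nets_add[of "\<lambda>\<phi> x. f \<phi> x - g \<phi> x" "\<lambda>\<phi> x. g \<phi> x - h \<phi> x"]
      unfolding colombeau_rel_def by simp
  qed
qed

lemma colombeau_rel_add:
  assumes "colombeau_rel f f'" "colombeau_rel g g'"
  shows "colombeau_rel (\<lambda>\<phi> x. f \<phi> x + g \<phi> x) (\<lambda>\<phi> x. f' \<phi> x + g' \<phi> x)"
  using assms negligible_nets_add[of "\<lambda>\<phi> x. f \<phi> x - f' \<phi> x" "\<lambda>\<phi> x. g \<phi> x - g' \<phi> x"]
  unfolding colombeau_rel_def by (simp add: moderate_add algebra_simps)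

lemma colombeau_rel_mult:
  assumes "colombeau_rel f f'" "colombeau_rel g g'"
  shows "colombeau_rel (\<lambda>\<phi> x. f \<phi> x * g \<phi> x) (\<lambda>\<phi> x. f' \<phi> x * g' \<phi> x)"
proof -
  have "(\<lambda>\<phi> x. (f \<phi> x - f' \<phi> x) * g \<phi> x + (g \<phi> x - g' \<phi> x) * f' \<phi> x) \<in> negligible_nets"
    using assms unfolding colombeau_rel_def
    by (intro negligible_nets_add negligible_nets_mult) auto
  then show ?thesis
    using assms unfolding colombeau_rel_def by (simp add: moderate_mult algebra_simps)
qed

lemma colombeau_rel_cmult:
  assumes "colombeau_rel f f'"
  shows "colombeau_rel (\<lambda>\<phi> x. c * f \<phi> x) (\<lambda>\<phi> x. c * f' \<phi> x)"
  using assms negligible_nets_cmult[of "\<lambda>\<phi> x. f \<phi> x - f' \<phi> x" c]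
  unfolding colombeau_rel_def by (simp add: moderate_cmult algebra_simps)

instantiation colombeau :: "{comm_ring, real_algebra}"
begin

lift_definition zero_colombeau :: colombeau is "\<lambda>_ _. 0"
  by (rule colombeau_rel_refl[OF moderate_const])

lift_definition plus_colombeau :: "colombeau \<Rightarrow> colombeau \<Rightarrow> colombeau"
  is "\<lambda>f g \<phi> x. f \<phi> x + g \<phi> x"
  by (rule colombeau_rel_add)

lift_definition times_colombeau :: "colombeau \<Rightarrow> colombeau \<Rightarrow> colombeau"
  is "\<lambda>f g \<phi> x. f \<phi> x * g \<phi> x"
  by (rule colombeau_rel_mult)

lift_definition scaleR_colombeau :: "real \<Rightarrow> colombeau \<Rightarrow> colombeau"
  is "\<lambda>r f \<phi> x. of_real r * f \<phi> x"
  by (rule colombeau_rel_cmult)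

definition uminus_colombeau :: "colombeau \<Rightarrow> colombeau" where
  "uminus_colombeau f = (-1) *\<^sub>R f"

definition minus_colombeau :: "colombeau \<Rightarrow> colombeau \<Rightarrow> colombeau" where
  "minus_colombeau f g = f + - g"

lemma colombeau_rel_eqI: "f \<in> moderate \<Longrightarrow> f = g \<Longrightarrow> colombeau_rel f g"
  using colombeau_rel_refl by blast

lemma colombeau_rel_self: "colombeau_rel f f \<longleftrightarrow> f \<in> moderate"
  using colombeau_rel_refl unfolding colombeau_rel_def by blast

instance
proof
  fix a b c :: colombeau and r s :: real
  show "a + b + c = a + (b + c)"
    by transfer (rule colombeau_rel_eqI,
      simp_all add: colombeau_rel_self moderate_add moderate_mult moderate_cmult fun_eq_iff algebra_simps)
  show "a + b = b + a"
    by transfer (rule colombeau_rel_eqI,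
      simp_all add: colombeau_rel_self moderate_add moderate_mult moderate_cmult fun_eq_iff algebra_simps)
  show "0 + a = a"
    by transfer simp
  show "- a + a = 0"
    unfolding uminus_colombeau_def
    by transfer (simp add: colombeau_rel_refl[OF moderate_const])
  show "a - b = a + - b"
    by (simp add: minus_colombeau_def)
  show "a * b * c = a * (b * c)"
    by transfer (rule colombeau_rel_eqI,
      simp_all add: colombeau_rel_self moderate_add moderate_mult moderate_cmult fun_eq_iff algebra_simps)
  show "a * b = b * a"
    by transfer (rule colombeau_rel_eqI,
      simp_all add: colombeau_rel_self moderate_add moderate_mult moderate_cmult fun_eq_iff algebra_simps)
  show "(a + b) * c = a * c + b * c"
    by transfer (rule colombeau_rel_eqI,
      simp_all add: colombeau_rel_self moderate_add moderate_mult moderate_cmult fun_eq_iff algebra_simps)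
  show "a * (b + c) = a * b + a * c"
    by transfer (rule colombeau_rel_eqI,
      simp_all add: colombeau_rel_self moderate_add moderate_mult moderate_cmult fun_eq_iff algebra_simps)
  show "r *\<^sub>R (a + b) = r *\<^sub>R a + r *\<^sub>R b"
    by transfer (rule colombeau_rel_eqI,
      simp_all add: colombeau_rel_self moderate_add moderate_mult moderate_cmult fun_eq_iff algebra_simps)
  show "(r + s) *\<^sub>R a = r *\<^sub>R a + s *\<^sub>R a"
    by transfer (rule colombeau_rel_eqI,
      simp_all add: colombeau_rel_self moderate_add moderate_mult moderate_cmult fun_eq_iff algebra_simps)
  show "r *\<^sub>R s *\<^sub>R a = (r * s) *\<^sub>R a"
    by transfer (rule colombeau_rel_eqI,
      simp_all add: colombeau_rel_self moderate_add moderate_mult moderate_cmult fun_eq_iff algebra_simps)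
  show "1 *\<^sub>R a = a"
    by transfer simp
  show "r *\<^sub>R a * b = r *\<^sub>R (a * b)"
    by transfer (rule colombeau_rel_eqI,
      simp_all add: colombeau_rel_self moderate_add moderate_mult moderate_cmult fun_eq_iff algebra_simps)
  show "a * r *\<^sub>R b = r *\<^sub>R (a * b)"
    by transfer (rule colombeau_rel_eqI,
      simp_all add: colombeau_rel_self moderate_add moderate_mult moderate_cmult fun_eq_iff algebra_simps)
qed

end


section \<open>Embedding of distributions and association\<close>

lemma test_fun_shift: "test_fun \<phi> \<Longrightarrow> test_fun (\<lambda>y. \<phi> (y - x))"
  using test_fun_affine[of \<phi> 1 "- x"] by simp

lemma funpow_vderiv_shift: "smooth \<phi> \<Longrightarrow> (vderiv ^^ n) (\<lambda>y. \<phi> (y - x)) = (\<lambda>y. (vderiv ^^ n) \<phi> (y - x))"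
  using funpow_vderiv_affine[of \<phi> n 1 "- x"] by simp

lemma smooth_taylor_bound:
  assumes f: "smooth f" and M: "\<And>t. norm ((vderiv ^^ Suc (Suc k)) f t) \<le> M"
  shows "norm ((vderiv ^^ k) f (t - h) - (vderiv ^^ k) f t + h *\<^sub>R (vderiv ^^ Suc k) f t) \<le> M * h\<^sup>2"
proof -
  have b: "norm ((vderiv ^^ Suc k) f x - (vderiv ^^ Suc k) f t) \<le> M * norm (x - t)" for x
  proof (rule differentiable_bound[of UNIV _ "\<lambda>x h. h *\<^sub>R (vderiv ^^ Suc (Suc k)) f x"])
    show "((vderiv ^^ Suc k) f has_derivative (\<lambda>h. h *\<^sub>R (vderiv ^^ Suc (Suc k)) f x)) (at x)" for x
      using smooth_has_vector_derivative[OF f, of "Suc k" x] by (simp only: has_vector_derivative_def)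
    show "onorm (\<lambda>h::real. h *\<^sub>R (vderiv ^^ Suc (Suc k)) f x) \<le> M" for x
    proof (rule onorm_le)
      show "norm (h *\<^sub>R (vderiv ^^ Suc (Suc k)) f x) \<le> M * norm h" for h
        using mult_right_mono[OF M[of x], of "\<bar>h\<bar>"]
        by (simp add: mult.commute del: funpow.simps)
    qed
  qed auto
  have M0: "M \<ge> 0" using M[of 0] norm_ge_zero order_trans by blast
  have "norm ((vderiv ^^ k) f (t - h) - (vderiv ^^ k) f t - ((t - h) - t) *\<^sub>R (vderiv ^^ Suc k) f t)
      \<le> norm ((t - h) - t) * (M * \<bar>h\<bar>)"
  proof (rule vector_differentiable_bound_linearization[where S="closed_segment t (t - h)"])
    show "((vderiv ^^ k) f has_vector_derivative (vderiv ^^ Suc k) f x)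
        (at x within closed_segment t (t - h))" for x
      using smooth_has_vector_derivative[OF f, of k x] by (rule has_vector_derivative_at_within)
    show "norm ((vderiv ^^ Suc k) f x - (vderiv ^^ Suc k) f t) \<le> M * \<bar>h\<bar>"
      if "x \<in> closed_segment t (t - h)" for x
    proof -
      have "norm (x - t) \<le> \<bar>h\<bar>"
        using that by (auto simp: closed_segment_eq_real_ivl split: if_splits)
      then show ?thesis using b[of x] M0 mult_left_mono order_trans by blast
    qed
  qed auto
  then show ?thesis by (simp add: power2_eq_square abs_mult_self_eq mult.commute mult.left_commute)
qed

lemma pairing_shift_has_vector_derivative:
  assumes \<phi>: "test_fun \<phi>"
  shows "((\<lambda>x. pairing u (\<lambda>y. \<phi> (y - x))) has_vector_derivative
    - pairing u (\<lambda>y. vderiv \<phi> (y - x))) (at x)"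
proof -
  have u: "is_distribution (pairing u)" using pairing[of u] by simp
  obtain R where R: "R > 0" "\<And>t. \<bar>t\<bar> > R \<Longrightarrow> \<phi> t = 0" using test_fun_radius[OF \<phi>] by blast
  define K where "K = {- (R + \<bar>x\<bar> + 1)..R + \<bar>x\<bar> + 1}"
  have K: "compact K" by (simp add: K_def)
  obtain C N where C: "C \<ge> 0" and b: "\<forall>\<phi>. test_fun \<phi> \<longrightarrow> (\<forall>x. x \<notin> K \<longrightarrow> \<phi> x = 0) \<longrightarrow>
        norm (pairing u \<phi>) \<le> C * test_seminorm N \<phi>"
    by (rule is_distribution_bound[OF u K]) (rule that)
  define M where "M = test_seminorm (Suc (Suc N)) \<phi>"
  have v: "(vderiv ^^ k) \<phi> t = 0" if "\<bar>t\<bar> > R" for k t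
    using vderiv_funpow_outside[of "{-R..R}" \<phi> t k] R(2) that by force
  have main: "norm (pairing u (\<lambda>y. \<phi> (y - (x + h))) - pairing u (\<lambda>y. \<phi> (y - x)) -
      h *\<^sub>R (- pairing u (\<lambda>y. vderiv \<phi> (y - x)))) \<le> C * ((real N + 1) * (M * h\<^sup>2))"
    if h: "\<bar>h\<bar> < 1" for h
  proof -
    let ?a = "\<lambda>y. \<phi> (y - (x + h))" and ?b = "\<lambda>y. (- 1) * \<phi> (y - x)"
      and ?c = "\<lambda>y. of_real h * vderiv \<phi> (y - x)"
    let ?\<chi> = "\<lambda>y. ?a y + (?b y + ?c y)"
    have ta: "test_fun ?a" "test_fun ?b" "test_fun ?c"
      by (intro test_fun_cmult test_fun_shift test_fun_vderiv \<phi>)+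
    note tt = test_fun_shift[OF \<phi>] test_fun_shift[OF test_fun_vderiv[OF \<phi>]]
    have "pairing u ?\<chi> = pairing u ?a + (pairing u ?b + pairing u ?c)"
      using ta by (simp only: is_distribution_add[OF u] test_fun_add)
    also have "pairing u ?b = - 1 * pairing u (\<lambda>y. \<phi> (y - x))"
      by (rule is_distribution_cmult[OF u tt(1)])
    also have "pairing u ?c = of_real h * pairing u (\<lambda>y. vderiv \<phi> (y - x))"
      by (rule is_distribution_cmult[OF u tt(2)])
    finally have eq: "pairing u ?\<chi> = pairing u (\<lambda>y. \<phi> (y - (x + h))) - pairing u (\<lambda>y. \<phi> (y - x)) -
      h *\<^sub>R (- pairing u (\<lambda>y. vderiv \<phi> (y - x)))"
      by (simp add: scaleR_conv_of_real)
    have out: "?\<chi> y = 0" if "y \<notin> K" for y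
    proof -
      have "\<bar>y\<bar> > R + \<bar>x\<bar> + 1" using that by (auto simp: K_def)
      then have "\<bar>y - x\<bar> > R" "\<bar>y - (x + h)\<bar> > R" using h by linarith+
      then show ?thesis using R(2) v[of "y - x" 1] by simp
    qed
    have "norm (pairing u ?\<chi>) \<le> C * test_seminorm N ?\<chi>"
      by (rule b[rule_format]) (intro test_fun_add ta, rule out)
    also have "test_seminorm N ?\<chi> \<le> (real N + 1) * (M * h\<^sup>2)"
    proof (rule test_seminorm_le)
      fix k y assume k: "k \<le> N"
      have "(vderiv ^^ k) ?\<chi> y = (vderiv ^^ k) ?a y + ((vderiv ^^ k) ?b y + (vderiv ^^ k) ?c y)"
        using ta by (simp only: funpow_vderiv_add test_fun_smooth test_fun_add)
      also have "(vderiv ^^ k) ?a y = (vderiv ^^ k) \<phi> ((y - x) - h)"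
        using funpow_vderiv_shift[OF test_fun_smooth[OF \<phi>], of k "x + h"] by (simp add: algebra_simps)
      also have "(vderiv ^^ k) ?b y = - (vderiv ^^ k) \<phi> (y - x)"
        using funpow_vderiv_cmult[OF test_fun_smooth[OF tt(1)], of k "- 1"]
          funpow_vderiv_shift[OF test_fun_smooth[OF \<phi>], of k x] by simp
      also have "(vderiv ^^ k) ?c y = h *\<^sub>R (vderiv ^^ Suc k) \<phi> (y - x)"
        using funpow_vderiv_cmult[OF test_fun_smooth[OF tt(2)], of k "of_real h"]
          funpow_vderiv_shift[OF test_fun_smooth[OF test_fun_vderiv[OF \<phi>]], of k x]
        by (simp add: scaleR_conv_of_real vderiv_funpow_vderiv del: funpow.simps)
      finally have e: "(vderiv ^^ k) ?\<chi> y = (vderiv ^^ k) \<phi> ((y - x) - h) - (vderiv ^^ k) \<phi> (y - x)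
          + h *\<^sub>R (vderiv ^^ Suc k) \<phi> (y - x)" by (simp del: funpow.simps)
      show "norm ((vderiv ^^ k) ?\<chi> y) \<le> M * h\<^sup>2"
        unfolding e M_def using k
        by (intro smooth_taylor_bound test_fun_smooth[OF \<phi>] norm_le_test_seminorm[OF \<phi>]) auto
    qed
    finally show ?thesis using C unfolding eq by (simp add: mult_left_mono)
  qed
  define H where "H = (\<lambda>y. C * ((real N + 1) * M) * \<bar>y - x\<bar>)"
  have "(H \<longlongrightarrow> C * ((real N + 1) * M) * \<bar>x - x\<bar>) (at x)"
    unfolding H_def by (intro tendsto_intros)
  then have H: "(H \<longlongrightarrow> 0) (at x)" by simp
  show ?thesis
    unfolding has_vector_derivative_def
  proof (rule has_derivativeI_sandwich[where e=1 and H=H])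
    fix y assume y: "y \<noteq> x" "dist y x < 1"
    have "norm (pairing u (\<lambda>z. \<phi> (z - y)) - pairing u (\<lambda>y. \<phi> (y - x)) -
        (y - x) *\<^sub>R (- pairing u (\<lambda>y. vderiv \<phi> (y - x)))) \<le> C * ((real N + 1) * (M * (y - x)\<^sup>2))"
      using main[of "y - x"] y by (simp add: dist_real_def)
    also have "\<dots> = H y * norm (y - x)"
      by (simp add: H_def power2_eq_square)
    finally show "norm (pairing u (\<lambda>z. \<phi> (z - y)) - pairing u (\<lambda>y. \<phi> (y - x)) -
        (y - x) *\<^sub>R (- pairing u (\<lambda>y. vderiv \<phi> (y - x)))) / norm (y - x) \<le> H y"
      using y by (simp add: divide_le_eq)
  qed (use H in \<open>auto intro: bounded_linear_minus bounded_linear_scaleR_left\<close>)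
qed

lemma
  assumes "test_fun \<phi>"
  shows smooth_conv_reflect: "smooth (conv u (\<lambda>x. \<phi> (- x)))"
    and funpow_vderiv_conv_reflect: "(vderiv ^^ n) (conv u (\<lambda>x. \<phi> (- x))) =
      (\<lambda>x. (- 1) ^ n * pairing u (\<lambda>y. (vderiv ^^ n) \<phi> (y - x)))"
proof -
  let ?F = "\<lambda>n x. (- 1) ^ n * pairing u (\<lambda>y. (vderiv ^^ n) \<phi> (y - x))"
  have 0: "?F 0 = conv u (\<lambda>x. \<phi> (- x))" by (simp add: conv_def fun_eq_iff)
  have "(?F n has_vector_derivative ?F (Suc n) x) (at x)" for n x
    using has_vector_derivative_mult_right[OF
        pairing_shift_has_vector_derivative[OF test_fun_funpow[OF assms, of n], of u x], of "(- 1) ^ n"]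
    by simp
  then show "smooth (conv u (\<lambda>x. \<phi> (- x)))" "(vderiv ^^ n) (conv u (\<lambda>x. \<phi> (- x))) = ?F n"
    using smooth_family[where F="?F", OF 0] by blast+
qed

lemma moderate_conv_reflect: "(\<lambda>\<phi>. conv u (\<lambda>x. \<phi> (- x))) \<in> moderate"
proof (rule moderateI)
  show "(\<lambda>\<phi>. conv u (\<lambda>x. \<phi> (- x))) \<in> smooth_nets"
    unfolding smooth_nets_def by (auto intro: smooth_conv_reflect mollifiers_test_fun)
  fix K :: "real set" and p :: nat assume "compact K"
  then obtain S where S: "\<And>x. x \<in> K \<Longrightarrow> \<bar>x\<bar> \<le> S"
    using compact_imp_bounded bounded_iff by (metis real_norm_def)
  define L where "L = {- (S + 1)..S + 1}"
  have L: "compact L" by (simp add: L_def)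
  have u: "is_distribution (pairing u)" using pairing[of u] by simp
  obtain C N where C: "C \<ge> 0" and b: "\<forall>\<phi>. test_fun \<phi> \<longrightarrow> (\<forall>x. x \<notin> L \<longrightarrow> \<phi> x = 0) \<longrightarrow>
        norm (pairing u \<phi>) \<le> C * test_seminorm N \<phi>"
    by (rule is_distribution_bound[OF u L]) (rule that)
  define q where "q = Suc (p + N)"
  show "\<exists>q\<ge>1. \<forall>\<phi>\<in>mollifiers q. \<exists>C. \<forall>\<^sub>F \<epsilon> in at_right 0. \<forall>x\<in>K.
      norm ((vderiv ^^ p) (conv u (\<lambda>x. dilate \<epsilon> \<phi> (- x))) x) \<le> C * (1 / \<epsilon> ^ q)"
  proof (intro exI[of _ q] conjI ballI)
    show "q \<ge> 1" by (simp add: q_def)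
    fix \<phi> assume "\<phi> \<in> mollifiers q"
    then have \<phi>: "test_fun \<phi>" by (rule mollifiers_test_fun)
    obtain R where R: "R > 0" "\<And>t. \<bar>t\<bar> > R \<Longrightarrow> \<phi> t = 0" using test_fun_radius[OF \<phi>] by blast
    define B where "B = test_seminorm (p + N) \<phi>"
    have small: "\<forall>\<^sub>F \<epsilon> in at_right 0. \<epsilon> < 1 / R"
      using R(1) by (auto simp: eventually_at_right_field intro!: exI[of _ "1 / R"])
    have "\<forall>\<^sub>F \<epsilon> in at_right 0. \<forall>x\<in>K. norm ((vderiv ^^ p) (conv u (\<lambda>x. dilate \<epsilon> \<phi> (- x))) x)
        \<le> (C * ((real N + 1) * B)) * (1 / \<epsilon> ^ q)"
      using eventually_unit_interval small
    proof eventually_elim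
      case (elim \<epsilon>)
      have ts: "test_fun (dilate \<epsilon> \<phi>)" using \<phi> elim by (intro test_fun_dilate) auto
      have out: "dilate \<epsilon> \<phi> t = 0" if "\<bar>t\<bar> > 1" for t
      proof -
        have "R < 1 / \<epsilon>" using elim R(1) by (simp add: field_simps)
        also have "\<dots> < \<bar>t\<bar> / \<epsilon>" using elim that by (simp add: divide_strict_right_mono)
        finally have "\<bar>t / \<epsilon>\<bar> > R" using elim by simp
        then show ?thesis using R(2) by (simp add: dilate_def)
      qed
      have out': "(vderiv ^^ p) (dilate \<epsilon> \<phi>) t = 0" if "\<bar>t\<bar> > 1" for t
        using vderiv_funpow_outside[of "{-1..1}" "dilate \<epsilon> \<phi>" t p] out that by force
      show ?case
      proof
        fix x assume x: "x \<in> K"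
        let ?\<psi> = "\<lambda>y. (vderiv ^^ p) (dilate \<epsilon> \<phi>) (y - x)"
        have "norm ((vderiv ^^ p) (conv u (\<lambda>x. dilate \<epsilon> \<phi> (- x))) x) = norm (pairing u ?\<psi>)"
          unfolding funpow_vderiv_conv_reflect[OF ts] by (simp add: norm_mult norm_power)
        also have "\<dots> \<le> C * test_seminorm N ?\<psi>"
        proof (rule b[rule_format])
          show "test_fun ?\<psi>" by (intro test_fun_shift test_fun_funpow ts)
          fix y assume "y \<notin> L"
          then have "\<bar>y\<bar> > S + 1" by (auto simp: L_def)
          then have "\<bar>y - x\<bar> > 1" using S[OF x] by linarith
          then show "?\<psi> y = 0" by (rule out')
        qed
        also have "\<dots> \<le> C * ((real N + 1) * (B * (1 / \<epsilon> ^ q)))"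
        proof (intro mult_left_mono C test_seminorm_le)
          fix k y assume k: "k \<le> N"
          have "(vderiv ^^ k) ?\<psi> y = (vderiv ^^ (k + p)) (dilate \<epsilon> \<phi>) (y - x)"
            using funpow_vderiv_shift[OF test_fun_smooth[OF test_fun_funpow[OF ts, of p]], of k x]
            by (simp add: funpow_add)
          also have "\<dots> = (vderiv ^^ (k + p)) \<phi> ((y - x) / \<epsilon>) /\<^sub>R \<epsilon> ^ Suc (k + p)"
            by (simp only: funpow_vderiv_dilate[OF test_fun_smooth[OF \<phi>]])
          also have "norm \<dots> = norm ((vderiv ^^ (k + p)) \<phi> ((y - x) / \<epsilon>)) * (1 / \<epsilon> ^ Suc (k + p))"
            using elim by (simp add: divide_inverse mult.commute del: power_Suc)
          also have "\<dots> \<le> B * (1 / \<epsilon> ^ q)"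
          proof (rule mult_mono)
            show "norm ((vderiv ^^ (k + p)) \<phi> ((y - x) / \<epsilon>)) \<le> B"
              unfolding B_def using k by (intro norm_le_test_seminorm \<phi>) auto
            show "1 / \<epsilon> ^ Suc (k + p) \<le> 1 / \<epsilon> ^ q"
              using elim k by (intro divide_left_mono power_decreasing) (auto simp: q_def)
          qed (use elim test_seminorm_nonneg[OF \<phi>] in \<open>auto simp: B_def\<close>)
          finally show "norm ((vderiv ^^ k) ?\<psi> y) \<le> B * (1 / \<epsilon> ^ q)" .
        qed
        finally show "norm ((vderiv ^^ p) (conv u (\<lambda>x. dilate \<epsilon> \<phi> (- x))) x)
            \<le> (C * ((real N + 1) * B)) * (1 / \<epsilon> ^ q)" by (simp add: mult.assoc)
      qed
    qed
    then show "\<exists>C. \<forall>\<^sub>F \<epsilon> in at_right 0. \<forall>x\<in>K.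
        norm ((vderiv ^^ p) (conv u (\<lambda>x. dilate \<epsilon> \<phi> (- x))) x) \<le> C * (1 / \<epsilon> ^ q)" by blast
  qed
qed

lift_definition dist_embed :: "distribution \<Rightarrow> colombeau" is "\<lambda>u \<phi>. conv u (\<lambda>x. \<phi> (- x))"
  by (rule colombeau_rel_refl[OF moderate_conv_reflect])

definition associated :: "colombeau \<Rightarrow> distribution \<Rightarrow> bool" (infix "\<approx>" 50) where
  "f \<approx> u \<longleftrightarrow> (\<exists>F\<in>moderate. abs_colombeau F = f \<and>
     (\<forall>\<psi>. test_fun \<psi> \<longrightarrow> (\<exists>q. \<forall>\<phi>\<in>mollifiers q.
       ((\<lambda>\<epsilon>. LBINT x. F (dilate \<epsilon> \<phi>) x * \<psi> x) \<longlongrightarrow> pairing u \<psi>) (at_right 0))))"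

end

theory Submission
  imports Defs
begin

text \<open>
  Fix a mollifier \<open>f\<close> with integral one. The left-hand side has the representative
  \<open>H = F * G + (2 * a + 3) * D\<close> at \<open>f\<close>, where \<open>F\<close> and \<open>G\<close> are the regularisations of \<open>nu_plus a\<close> and
  \<open>nu_minus (- a - 3)\<close>, and \<open>D t = - f (- t) * f' (- t)\<close> comes from the Dirac distribution and its
  derivative. The regularised powers live on opposite half-lines up to the radius of \<open>f\<close>, so \<open>H\<close> is a
  test function. All factors are homogeneous and the degrees add up to \<open>-3\<close> in both products, so
  replacing \<open>f\<close> by its dilation replaces \<open>H\<close> by \<open>x \<mapsto> H (x / \<epsilon>) / \<epsilon> ^ 3\<close> (\<open>product_kernel_dilate\<close>). By
  Taylor's formula such a family converges to half the second moment of \<open>H\<close> times the second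
  derivative of the Dirac distribution, provided that the moments of order zero and one vanish
  (\<open>concentrating_kernel_tendsto\<close>). It remains to compute three moments (\<open>product_kernel_moments\<close>).

  For this, let \<open>B a b f g\<close> be the integral of the product of the regularisations of \<open>nu_plus a\<close> by \<open>f\<close>
  and of \<open>nu_minus b\<close> by \<open>g\<close> (\<open>nu_product\<close>). Integration by parts gives
  \<open>B (a - 1) b f g = B a (b - 1) f g\<close>, so up to integer shifts only \<open>a + b\<close> matters. If \<open>a + b = -1\<close> and
  \<open>a\<close> is not an integer, both exponents can be moved between \<open>-1\<close> and \<open>0\<close>, where the distributions are
  functions; the Beta integral and Fubini's theorem then show that \<open>B a b f g\<close> is the integral of
  \<open>f u * g v\<close> over \<open>u > v\<close>. Differentiating once and twice yields the integral of
  \<open>f * g\<close> for \<open>a + b = -2\<close> and minus the integral of \<open>f' * g\<close> for \<open>a + b = -3\<close>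
  (\<open>nu_product_minus_1\<close>, \<open>nu_product_minus_2\<close>, \<open>nu_product_minus_3\<close>).

  Moments are reduced to these values by \<open>x * nu_plus a = (a + 1) * nu_plus (a + 1)\<close>
  (\<open>pairing_nu_plus_mult_id\<close>). The moments of \<open>F * G\<close> of order zero, one and two come out as \<open>0\<close>,
  \<open>(a + 3 / 2) * \<integral> f\<^sup>2\<close> and \<open>(a + 1) * (a + 2) / 2 - (2 * a + 3) * \<integral> x f\<^sup>2\<close>, those of \<open>D\<close> as \<open>0\<close>,
  \<open>- 1 / 2 * \<integral> f\<^sup>2\<close> and \<open>\<integral> x f\<^sup>2\<close>. In \<open>H\<close> everything that depends on \<open>f\<close> cancels and the second moment
  \<open>(a + 1) * (a + 2) / 2\<close>, which is the binomial coefficient in the theorem, remains.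
\<close>

section \<open>Test functions and the pairing\<close>

lemma pairing_is_distribution: "is_distribution (pairing u)"
  using pairing[of u] by simp

lemma pairing_test_add:
  "test_fun f \<Longrightarrow> test_fun g \<Longrightarrow> pairing u (\<lambda>x. f x + g x) = pairing u f + pairing u g"
  by (rule is_distribution_add[OF pairing_is_distribution])

lemma pairing_test_cmult: "test_fun f \<Longrightarrow> pairing u (\<lambda>x. c * f x) = c * pairing u f"
  by (rule is_distribution_cmult[OF pairing_is_distribution])

lemma pairing_not_test: "\<not> test_fun f \<Longrightarrow> pairing u f = 0"
  by (rule is_distribution_outside[OF pairing_is_distribution])

lemma pairing_dist_deriv: "test_fun f \<Longrightarrow> pairing (dist_deriv u) f = - pairing u (vderiv f)"
  by (simp add: dist_deriv.rep_eq)

lemma pairing_dirac: "test_fun f \<Longrightarrow> pairing dirac f = f 0"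
  by (simp add: dirac.rep_eq)

lemma pairing_uminus: "pairing (- u) f = - pairing u f"
  unfolding uminus_distribution_def pairing_scaleR by simp

lemma has_vector_derivative_vderiv: "smooth f \<Longrightarrow> (f has_vector_derivative vderiv f x) (at x)"
  using smooth_has_vector_derivative[of f 0 x] by simp

lemma vderiv_eqI: "(\<And>x. (f has_vector_derivative f' x) (at x)) \<Longrightarrow> vderiv f = f'"
  by (auto simp: vderiv_def fun_eq_iff vector_derivative_at)

lemma vderiv_mult:
  assumes "smooth f" "smooth g"
  shows "vderiv (\<lambda>x. f x * g x) = (\<lambda>x. f x * vderiv g x + vderiv f x * g x)"
  by (rule vderiv_eqI) (intro has_vector_derivative_mult has_vector_derivative_vderiv assms)

lemma smooth_id: "smooth (\<lambda>x. of_real x)"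
  by (rule smooth_family(1)[where F="\<lambda>n x. if n = 0 then of_real x else if n = 1 then 1 else 0"])
    (auto intro!: derivative_eq_intros)

lemma vderiv_id: "vderiv (\<lambda>x. of_real x) = (\<lambda>x. 1)"
  by (rule vderiv_eqI) (auto intro!: derivative_eq_intros)

lemma test_fun_smooth_mult:
  assumes "smooth f" "test_fun g"
  shows "test_fun (\<lambda>x. f x * g x)"
proof -
  obtain R where "R > 0" "\<And>x. \<bar>x\<bar> > R \<Longrightarrow> g x = 0" by (rule test_fun_radius[OF assms(2)]) (rule that)
  then show ?thesis
    by (intro test_funI[of _ R] smooth_mult assms(1) test_fun_smooth[OF assms(2)]) auto
qed

lemma test_fun_id_mult: "test_fun f \<Longrightarrow> test_fun (\<lambda>x. of_real x * f x)"
  by (rule test_fun_smooth_mult[OF smooth_id])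

lemma vderiv_id_mult:
  assumes "smooth f"
  shows "vderiv (\<lambda>x. of_real x * f x) = (\<lambda>x. f x + of_real x * vderiv f x)"
  using vderiv_mult[OF smooth_id assms] by (simp add: vderiv_id add.commute)

lemma vderiv_affine: "smooth f \<Longrightarrow> vderiv (\<lambda>x. f (c * x + b)) = (\<lambda>x. c *\<^sub>R vderiv f (c * x + b))"
  using funpow_vderiv_affine[of f 1 c b] by simp

lemma vderiv_reflect: "smooth f \<Longrightarrow> vderiv (\<lambda>x. f (- x)) = (\<lambda>x. - vderiv f (- x))"
  using vderiv_affine[of f "-1" 0] by simp

lemma test_fun_reflect: "test_fun f \<Longrightarrow> test_fun (\<lambda>x. f (- x))"
  using test_fun_affine[of f "-1" 0] by simp

lemma vderiv_shift: "smooth f \<Longrightarrow> vderiv (\<lambda>y. f (y - x)) = (\<lambda>y. vderiv f (y - x))"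
  using funpow_vderiv_shift[of f 1 x] by simp


section \<open>Calculus of the distributions \<open>nu_plus\<close> and \<open>nu_minus\<close>\<close>

text \<open>Integrability on compact sets is reduced to gauge integrability of the norm on symmetric
  intervals, where the primitive of a power is available.\<close>

lemma locally_integrableI:
  assumes [measurable]: "f \<in> borel_measurable borel"
    and "\<And>c. c > 0 \<Longrightarrow> (\<lambda>x. norm (f x)) integrable_on {- c..c}"
  shows "locally_integrable f"
  unfolding locally_integrable_def
proof (intro allI impI)
  fix K :: "real set" assume K: "compact K"
  then obtain c where "c > 0" "\<And>x. x \<in> K \<Longrightarrow> norm x \<le> c"
    using compact_imp_bounded bounded_pos by metis
  then have c: "c > 0" "K \<subseteq> {-c..c}" by (force simp: abs_le_iff)+
  have "set_integrable lebesgue {-c..c} (\<lambda>x. norm (f x))"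
    by (rule nonnegative_absolutely_integrable_1) (use assms(2)[OF c(1)] in auto)
  then have "set_integrable lborel {-c..c} (\<lambda>x. norm (f x))"
    unfolding set_integrable_def by (subst (asm) integrable_completion) auto
  then have "set_integrable lborel {-c..c} f"
    unfolding set_integrable_def
    by (rule Bochner_Integration.integrable_bound) (auto simp: indicator_def)
  moreover have "K \<in> sets lborel" using K by (simp add: compact_imp_closed)
  ultimately show "set_integrable lborel K f" using c(2) by (rule set_integrable_subset)
qed

lemma borel_measurable_nu_plus_fun [measurable]: "nu_plus_fun a \<in> borel_measurable borel"
  unfolding nu_plus_fun_def[abs_def] by measurable

lemma nu_minus_fun_eq: "nu_minus_fun a x = nu_plus_fun a (- x)"
  by (simp add: nu_minus_fun_def nu_plus_fun_def)

lemma borel_measurable_nu_minus_fun [measurable]: "nu_minus_fun a \<in> borel_measurable borel"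
  unfolding nu_minus_fun_eq[abs_def] by measurable

lemma norm_nu_plus_fun_integrable_on:
  assumes "a > -1" "c > 0"
  shows "(\<lambda>x. norm (nu_plus_fun a x)) integrable_on {-c..c}"
proof -
  have "((\<lambda>x. x powr a * (1 / \<bar>Gamma (a + 1)\<bar>)) has_integral (c powr (a + 1) / (a + 1) * (1 / \<bar>Gamma (a + 1)\<bar>))) {0..c}"
    using assms by (intro has_integral_mult_left has_integral_powr_from_0) auto
  then have "(\<lambda>x. x powr a * (1 / \<bar>Gamma (a + 1)\<bar>)) integrable_on {0..c}" by blast
  then have r: "(\<lambda>x. norm (nu_plus_fun a x)) integrable_on {0..c}"
    by (rule integrable_spike[where S="{0}"]) (auto simp: nu_plus_fun_def norm_divide)
  have l: "(\<lambda>x. norm (nu_plus_fun a x)) integrable_on {-c..0}"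
    by (rule integrable_eq[where f="\<lambda>_. 0"]) (auto simp: nu_plus_fun_def)
  show ?thesis
    by (rule Henstock_Kurzweil_Integration.integrable_combine[OF _ _ l r]) (use assms in auto)
qed

lemma locally_integrable_nu_plus_fun: "a > -1 \<Longrightarrow> locally_integrable (nu_plus_fun a)"
  by (intro locally_integrableI norm_nu_plus_fun_integrable_on) auto

lemma locally_integrable_nu_minus_fun: "a > -1 \<Longrightarrow> locally_integrable (nu_minus_fun a)"
proof (rule locally_integrableI)
  fix c :: real assume "a > -1" "c > 0"
  then show "(\<lambda>x. norm (nu_minus_fun a x)) integrable_on {- c..c}"
    using Henstock_Kurzweil_Integration.integrable_reflect_real[where f="\<lambda>x. norm (nu_plus_fun a x)" and a="-c" and b=c]
      norm_nu_plus_fun_integrable_on[of a c] by (simp add: nu_minus_fun_eq)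
qed auto

lemma locally_integrable_times_test:
  assumes "locally_integrable f" "test_fun g"
  shows "integrable lborel (\<lambda>x. f x * g x)"
proof -
  obtain R where "R > 0" "\<And>x. \<bar>x\<bar> > R \<Longrightarrow> g x = 0" by (rule test_fun_radius[OF assms(2)]) (rule that)
  then have "\<And>x. x \<notin> {-R..R} \<Longrightarrow> g x = 0" by force
  moreover obtain B where "\<And>x. norm (g x) \<le> B" using test_fun_bounded[OF assms(2), of 0] by auto
  ultimately show ?thesis using locally_integrable_mult_test(1)[OF assms] by blast
qed

text \<open>Some number of differentiations always brings the exponent into the locally integrable
  range, so the least one in the definition of \<open>nu_plus\<close> and \<open>nu_minus\<close> exists.\<close>

lemma exists_shift_gt: "\<exists>r::nat. a + real r > - 1"
  using reals_Archimedean2[of "- 1 - a"] by (auto simp: algebra_simps)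

lemma nu_plus_eq_dist_of_fun:
  assumes "a > -1" shows "nu_plus a = dist_of_fun (nu_plus_fun a)"
proof -
  have "(LEAST r::nat. a + r > -1) = 0" by (rule Least_eq_0) (use assms in simp)
  then show ?thesis by (simp add: nu_plus_def)
qed

lemma pairing_nu_plus:
  assumes "a > -1" "test_fun f"
  shows "pairing (nu_plus a) f = (LBINT y. nu_plus_fun a y * f y)"
  using assms by (simp add: nu_plus_eq_dist_of_fun dist_of_fun.rep_eq locally_integrable_nu_plus_fun)

text \<open>Since \<open>a + 1 > 0\<close>, the power \<open>y powr (a + 1)\<close> is continuous and vanishes at
  \<open>0\<close>, so integrating the derivative of \<open>y powr (a + 1) * f y\<close> over a half-line gives no boundary
  term. The singularity of the derivative at \<open>0\<close> is harmless because it is integrable.\<close>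

lemma pairing_dist_deriv_nu_plus_locally_integrable:
  assumes a: "a > -1" and f: "test_fun f"
  shows "pairing (dist_deriv (nu_plus (a + 1))) f = pairing (nu_plus a) f"
proof -
  obtain R where R: "R > 0" "\<And>x. \<bar>x\<bar> > R \<Longrightarrow> f x = 0" by (rule test_fun_radius[OF f]) (rule that)
  have f0: "f x = 0" "vderiv f x = 0" if "\<bar>x\<bar> > R" for x
    using vderiv_funpow_outside[of "{-R..R}" f x 1] R(2) that by force+
  let ?g = "\<lambda>y. nu_plus_fun (a + 1) y * vderiv f y" and ?h = "\<lambda>y. nu_plus_fun a y * f y"
  let ?F = "\<lambda>y. complex_of_real (y powr (a + 1) / Gamma (a + 2)) * f y"
  have i: "integrable lborel ?g" "integrable lborel ?h"
    using a f by (auto intro!: locally_integrable_times_test locally_integrable_nu_plus_fun test_fun_vderiv)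
  have G: "Gamma (a + 2) = (a + 1) * Gamma (a + 1)"
    using Gamma_plus1[of "a + 1"] a nonpos_Ints_nonpos by (force simp: add.assoc)
  have "((\<lambda>y. ?g y + ?h y) has_integral (?F (R + 1) - ?F 0)) {0..R + 1}"
  proof (rule fundamental_theorem_of_calculus_interior)
    show "continuous_on {0..R + 1} ?F"
      using a smooth_continuous_on[OF test_fun_smooth[OF f], of _ 0]
      by (intro continuous_on_mult continuous_on_of_real continuous_on_divide continuous_on_powr' continuous_intros)
        (auto simp: Gamma_eq_zero_iff dest: nonpos_Ints_nonpos)
    fix y assume y: "y \<in> {0<..<R + 1}"
    have "((\<lambda>y. y powr (a + 1) / Gamma (a + 2)) has_real_derivative ((a + 1) * y powr a / Gamma (a + 2))) (at y)"
      using y has_real_derivative_powr[of y "a + 1"] by (intro DERIV_cdivide) auto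
    then have "((\<lambda>y. complex_of_real (y powr (a + 1) / Gamma (a + 2))) has_vector_derivative
        of_real ((a + 1) * y powr a / Gamma (a + 2))) (at y)"
      by (intro has_vector_derivative_of_real) (simp add: has_real_derivative_iff_has_vector_derivative)
    also have "(a + 1) * y powr a / Gamma (a + 2) = y powr a / Gamma (a + 1)"
      using a by (simp add: G)
    finally have "((\<lambda>y. complex_of_real (y powr (a + 1) / Gamma (a + 2))) has_vector_derivative
        of_real (y powr a / Gamma (a + 1))) (at y)" .
    from has_vector_derivative_mult[OF this has_vector_derivative_vderiv[OF test_fun_smooth[OF f]]]
    show "(?F has_vector_derivative ?g y + ?h y) (at y)"
      using y by (simp add: nu_plus_fun_def add.assoc)
  qed (use R in simp)
  moreover have "?F (R + 1) - ?F 0 = 0" using f0 R(1) by simp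
  ultimately have "((\<lambda>y. ?g y + ?h y) has_integral 0) {0..R + 1}" by (simp only:)
  then have "((\<lambda>y. ?g y + ?h y) has_integral 0) UNIV"
    by (rule has_integral_on_superset) (use f0 in \<open>auto simp: nu_plus_fun_def\<close>)
  moreover have "((\<lambda>y. ?g y + ?h y) has_integral (LBINT y. ?g y + ?h y)) UNIV"
    by (intro has_integral_integral_lborel Bochner_Integration.integrable_add i)
  ultimately have "(LBINT y. ?g y + ?h y) = 0" by (rule has_integral_unique[symmetric])
  then have "(LBINT y. ?g y) = - (LBINT y. ?h y)"
    using i by (simp add: eq_neg_iff_add_eq_0)
  then show ?thesis
    using a f by (simp add: pairing_dist_deriv pairing_nu_plus test_fun_vderiv)
qed

lemma Least_shift_Suc:
  assumes "\<not> a > (-1::real)"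
  shows "(LEAST r::nat. a + r > -1) = Suc (LEAST r::nat. a + 1 + r > -1)"
proof -
  obtain r :: nat where "a + r > -1" using exists_shift_gt by blast
  then have "(LEAST r::nat. a + r > -1) = Suc (LEAST r::nat. a + Suc r > -1)"
    by (rule Least_Suc) (use assms in simp)
  then show ?thesis by (simp add: algebra_simps)
qed

text \<open>Outside the locally integrable range, raising the exponent by one lowers the number of
  differentiations by one, and the identity holds by definition.\<close>

lemma dist_deriv_nu_plus: "dist_deriv (nu_plus (a + 1)) = nu_plus a"
proof (cases "a > -1")
  case True
  show ?thesis
  proof (rule distribution_eqI)
    fix f show "pairing (dist_deriv (nu_plus (a + 1))) f = pairing (nu_plus a) f"
      by (cases "test_fun f") (simp_all add: pairing_dist_deriv_nu_plus_locally_integrable[OF True] pairing_not_test)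
  qed
next
  case False
  show ?thesis
    unfolding nu_plus_def Least_shift_Suc[OF False] Let_def by (simp add: algebra_simps)
qed

lemma pairing_nu_plus_vderiv:
  assumes "test_fun f"
  shows "pairing (nu_plus a) (vderiv f) = - pairing (nu_plus (a - 1)) f"
  using dist_deriv_nu_plus[of "a - 1"] pairing_dist_deriv[OF assms, of "nu_plus a"] by simp

text \<open>The sign \<open>(- 1) ^ r\<close> in the definition of \<open>nu_minus\<close> is exactly the one by which
  reflection fails to commute with \<open>r\<close> derivatives. Hence all facts about \<open>nu_minus\<close> follow from
  those about \<open>nu_plus\<close>.\<close>

lemma pairing_nu_minus:
  assumes f: "test_fun f"
  shows "pairing (nu_minus a) f = pairing (nu_plus a) (\<lambda>y. f (- y))"
proof -
  define r where "r = (LEAST r::nat. a + r > -1)"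
  have r: "a + r > -1" unfolding r_def by (rule LeastI_ex[OF exists_shift_gt])
  have "pairing ((-1) ^ n *\<^sub>R (dist_deriv ^^ n) (dist_of_fun (nu_minus_fun (a + r)))) f =
      pairing ((dist_deriv ^^ n) (dist_of_fun (nu_plus_fun (a + r)))) (\<lambda>y. f (- y))" for n
    using f
  proof (induction n arbitrary: f)
    case 0
    have "(LBINT y. nu_minus_fun (a + r) y * f y) = (LBINT y. nu_plus_fun (a + r) y * f (- y))"
      by (subst lborel_integral_real_affine[where c="-1" and t=0]) (simp_all add: nu_minus_fun_eq)
    with r 0 show ?case
      by (simp add: dist_of_fun.rep_eq locally_integrable_nu_plus_fun locally_integrable_nu_minus_fun
          test_fun_reflect)
  next
    case (Suc n)
    have "pairing ((dist_deriv ^^ n) (dist_of_fun (nu_plus_fun (a + r)))) (\<lambda>y. - vderiv f (- y)) =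
        - pairing ((dist_deriv ^^ n) (dist_of_fun (nu_plus_fun (a + r)))) (\<lambda>y. vderiv f (- y))"
      using pairing_test_cmult[OF test_fun_reflect[OF test_fun_vderiv[OF Suc.prems]], of _ "-1"] by simp
    with Suc.IH[OF test_fun_vderiv[OF Suc.prems]] Suc.prems show ?case
      by (simp add: pairing_scaleR pairing_uminus pairing_dist_deriv test_fun_reflect vderiv_reflect test_fun_smooth)
  qed
  then show ?thesis unfolding nu_minus_def nu_plus_def Let_def r_def .
qed

text \<open>Properties of all \<open>nu_plus a\<close> are checked for the locally integrable functions and then
  carried down by differentiation, one exponent at a time.\<close>

lemma shift_induct [case_names base step]:
  fixes a :: real
  assumes "\<And>a. a > -1 \<Longrightarrow> P a" "\<And>a. P (a + 1) \<Longrightarrow> P a"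
  shows "P a"
proof -
  have "\<forall>a. a + real n > -1 \<longrightarrow> P a" for n
  proof (induction n)
    case (Suc n)
    then show ?case using assms(2) by (auto simp: algebra_simps)
  qed (use assms(1) in auto)
  then show ?thesis using exists_shift_gt by blast
qed

lemma pairing_nu_plus_eq_0:
  assumes "test_fun f" "\<And>y. y > 0 \<Longrightarrow> f y = 0"
  shows "pairing (nu_plus a) f = 0"
  using assms
proof (induction a arbitrary: f rule: shift_induct)
  case (base a)
  then have "(\<lambda>y. nu_plus_fun a y * f y) = (\<lambda>y. 0)" by (auto simp: nu_plus_fun_def fun_eq_iff)
  then show ?case using base by (simp add: pairing_nu_plus)
next
  case (step a)
  have "vderiv f y = 0" if "y > 0" for y
    using vderiv_funpow_outside[of "{..0}" f y 1] step.prems that by auto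
  then have "pairing (nu_plus (a + 1)) (vderiv f) = 0"
    by (intro step.IH test_fun_vderiv step.prems(1))
  then show ?case using pairing_nu_plus_vderiv[OF step.prems(1), of "a + 1"] by simp
qed

lemma nu_plus_fun_mult_id:
  assumes "a > -1"
  shows "nu_plus_fun a y * of_real y = of_real (a + 1) * nu_plus_fun (a + 1) y"
proof (cases "y > 0")
  case True
  have "Gamma (a + 1 + 1) = (a + 1) * Gamma (a + 1)"
    using Gamma_plus1[of "a + 1"] assms nonpos_Ints_nonpos by force
  then have r: "y powr a / Gamma (a + 1) * y = (a + 1) * (y powr (a + 1) / Gamma (a + 1 + 1))"
    using True assms by (simp add: powr_add)
  have "nu_plus_fun a y * of_real y = of_real (y powr a / Gamma (a + 1) * y)"
    using True by (simp add: nu_plus_fun_def)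
  also have "\<dots> = of_real (a + 1) * of_real (y powr (a + 1) / Gamma (a + 1 + 1))"
    unfolding r of_real_mult ..
  also have "\<dots> = of_real (a + 1) * nu_plus_fun (a + 1) y"
    using True by (simp add: nu_plus_fun_def)
  finally show ?thesis .
qed (simp add: nu_plus_fun_def)

text \<open>The relation \<open>x * nu_plus a = (a + 1) * nu_plus (a + 1)\<close> between consecutive exponents, which turns a moment
  into a product with a raised exponent. Downward induction works because multiplication by \<open>x\<close> and
  differentiation commute up to the identity, and this changes the factor by one.\<close>

lemma pairing_nu_plus_mult_id:
  assumes "test_fun f"
  shows "pairing (nu_plus a) (\<lambda>y. of_real y * f y) = of_real (a + 1) * pairing (nu_plus (a + 1)) f"
  using assms
proof (induction a arbitrary: f rule: shift_induct)
  case (base a)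
  have "nu_plus_fun a y * (of_real y * f y) = of_real (a + 1) * (nu_plus_fun (a + 1) y * f y)" for y
    unfolding mult.assoc[symmetric] nu_plus_fun_mult_id[OF base(1)] ..
  then have "(LBINT y. nu_plus_fun a y * (of_real y * f y)) =
      of_real (a + 1) * (LBINT y. nu_plus_fun (a + 1) y * f y)"
    by (simp only: integral_mult_right_zero)
  with base show ?case
    by (simp add: pairing_nu_plus test_fun_id_mult del: of_real_add)
next
  case (step a)
  note f = step.prems test_fun_vderiv[OF step.prems]
  have "pairing (nu_plus a) (\<lambda>y. of_real y * f y) =
      - pairing (nu_plus (a + 1)) (\<lambda>y. f y + of_real y * vderiv f y)"
    using pairing_nu_plus_vderiv[OF test_fun_id_mult[OF f(1)], of "a + 1"] f(1)
    by (simp add: vderiv_id_mult test_fun_smooth)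
  also have "\<dots> = - pairing (nu_plus (a + 1)) f - of_real (a + 2) * pairing (nu_plus (a + 2)) (vderiv f)"
    using step.IH[OF f(2)] f by (simp add: pairing_test_add test_fun_id_mult add.assoc)
  also have "\<dots> = of_real (a + 1) * pairing (nu_plus (a + 1)) f"
    using pairing_nu_plus_vderiv[OF f(1), of "a + 2"] by (simp add: algebra_simps)
  finally show ?case .
qed

text \<open>Homogeneity of degree \<open>a\<close>, in its form dual to the dilation of test functions.\<close>

lemma pairing_nu_plus_dilate:
  assumes "test_fun f" "\<epsilon> > 0"
  shows "pairing (nu_plus a) (\<lambda>y. f (y / \<epsilon>)) = of_real (\<epsilon> powr (a + 1)) * pairing (nu_plus a) f"
  using assms(1)
proof (induction a arbitrary: f rule: shift_induct)
  case (base a)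
  have t: "test_fun (\<lambda>y. f (y / \<epsilon>))" using test_fun_affine[OF base(2), of "1 / \<epsilon>" 0] assms by simp
  have "(LBINT y. nu_plus_fun a y * f (y / \<epsilon>)) =
      \<bar>\<epsilon>\<bar> *\<^sub>R (LBINT y. nu_plus_fun a (0 + \<epsilon> * y) * f ((0 + \<epsilon> * y) / \<epsilon>))"
    using assms(2) by (intro lborel_integral_real_affine) auto
  also have "(\<lambda>y. nu_plus_fun a (0 + \<epsilon> * y) * f ((0 + \<epsilon> * y) / \<epsilon>)) =
      (\<lambda>y. of_real (\<epsilon> powr a) * (nu_plus_fun a y * f y))"
    using assms(2) by (auto simp: nu_plus_fun_def fun_eq_iff powr_mult zero_less_mult_iff)
  also have "\<bar>\<epsilon>\<bar> *\<^sub>R (LBINT y. of_real (\<epsilon> powr a) * (nu_plus_fun a y * f y)) =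
      of_real (\<epsilon> powr (a + 1)) * (LBINT y. nu_plus_fun a y * f y)"
    unfolding integral_mult_right_zero using assms(2) by (simp add: scaleR_conv_of_real powr_add)
  finally show ?case
    unfolding pairing_nu_plus[OF base(1) t] pairing_nu_plus[OF base] .
next
  case (step a)
  have t: "test_fun (\<lambda>y. f (y / \<epsilon>))" using test_fun_affine[OF step.prems, of "1 / \<epsilon>" 0] assms by simp
  have "vderiv (\<lambda>y. f (y / \<epsilon>)) = (\<lambda>y. of_real (1 / \<epsilon>) * vderiv f (y / \<epsilon>))"
    using vderiv_affine[OF test_fun_smooth[OF step.prems], of "1 / \<epsilon>" 0] by (simp add: scaleR_conv_of_real)
  moreover have "test_fun (\<lambda>y. vderiv f (y / \<epsilon>))"
    using test_fun_affine[OF test_fun_vderiv[OF step.prems], of "1 / \<epsilon>" 0] assms by simp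
  ultimately have "pairing (nu_plus (a + 1)) (vderiv (\<lambda>y. f (y / \<epsilon>))) =
      of_real (1 / \<epsilon>) * (of_real (\<epsilon> powr (a + 1 + 1)) * pairing (nu_plus (a + 1)) (vderiv f))"
    using step.IH[OF test_fun_vderiv[OF step.prems]] by (simp only: pairing_test_cmult)
  also have "of_real (1 / \<epsilon>) * (of_real (\<epsilon> powr (a + 1 + 1)) * pairing (nu_plus (a + 1)) (vderiv f)) =
     of_real (\<epsilon> powr (a + 1)) * pairing (nu_plus (a + 1)) (vderiv f)"
    using assms(2) by (simp add: powr_add power2_eq_square)
  finally show ?case
    using pairing_nu_plus_vderiv[OF t, of "a + 1"] pairing_nu_plus_vderiv[OF step.prems, of "a + 1"] by simp
qed

section \<open>Regularised distributions and integration by parts\<close>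

text \<open>The representative of an embedded distribution at the mollifier \<open>f\<close>, with the two
  reflections in its definition cancelled.\<close>

definition regularize :: "distribution \<Rightarrow> (real \<Rightarrow> complex) \<Rightarrow> real \<Rightarrow> complex" where
  "regularize u f t = pairing u (\<lambda>y. f (y - t))"

lemma conv_reflect_eq_regularize: "conv u (\<lambda>x. f (- x)) = regularize u f"
  by (simp add: conv_def regularize_def fun_eq_iff)

lemma smooth_regularize: "test_fun f \<Longrightarrow> smooth (regularize u f)"
  using smooth_conv_reflect[of f u] by (simp add: conv_reflect_eq_regularize)

lemma vderiv_regularize:
  assumes "test_fun f" shows "vderiv (regularize u f) = (\<lambda>t. - regularize u (vderiv f) t)"
  unfolding regularize_def[abs_def]
  by (rule vderiv_eqI) (rule pairing_shift_has_vector_derivative[OF assms])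

lemma borel_measurable_smooth: "smooth f \<Longrightarrow> f \<in> borel_measurable borel"
  using smooth_continuous_on[of f UNIV 0] by (simp add: borel_measurable_continuous_onI)

lemma integrable_test_fun:
  assumes "test_fun f" shows "integrable lborel f"
proof -
  have "continuous_on {- c..c} (\<lambda>x. norm (1::complex))" for c :: real by simp
  then have "locally_integrable (\<lambda>x. 1)"
    by (intro locally_integrableI) auto
  from locally_integrable_times_test[OF this assms] show ?thesis by simp
qed

lemma regularize_nu_plus_vderiv:
  assumes "test_fun f"
  shows "regularize (nu_plus a) (vderiv f) t = - regularize (nu_plus (a - 1)) f t"
  using pairing_nu_plus_vderiv[OF test_fun_shift[OF assms, of t]] assms
  by (simp add: regularize_def vderiv_shift test_fun_smooth)

lemma pairing_nu_minus_vderiv: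
  assumes "test_fun f"
  shows "pairing (nu_minus a) (vderiv f) = pairing (nu_minus (a - 1)) f"
proof -
  have "pairing (nu_plus a) (\<lambda>y. vderiv f (- y)) = - pairing (nu_plus a) (vderiv (\<lambda>y. f (- y)))"
    using pairing_test_cmult[OF test_fun_reflect[OF test_fun_vderiv[OF assms]], of "nu_plus a" "-1"] assms
    by (simp add: vderiv_reflect test_fun_smooth)
  also have "\<dots> = pairing (nu_plus (a - 1)) (\<lambda>y. f (- y))"
    using pairing_nu_plus_vderiv[OF test_fun_reflect[OF assms]] by simp
  finally show ?thesis using assms by (simp add: pairing_nu_minus test_fun_vderiv)
qed

lemma regularize_nu_minus_vderiv:
  assumes "test_fun f"
  shows "regularize (nu_minus a) (vderiv f) t = regularize (nu_minus (a - 1)) f t"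
  using pairing_nu_minus_vderiv[OF test_fun_shift[OF assms, of t]] assms
  by (simp add: regularize_def vderiv_shift test_fun_smooth)

text \<open>Half-line supports survive regularisation up to the radius of the mollifier. As the half-lines
  point in opposite directions, a product of a regularised \<open>nu_plus\<close> and a regularised \<open>nu_minus\<close> is a
  test function, and all its moments exist.\<close>

lemma regularize_nu_plus_eq_0:
  assumes "test_fun f" "\<And>x. \<bar>x\<bar> > R \<Longrightarrow> f x = 0" "t < - R"
  shows "regularize (nu_plus a) f t = 0"
  unfolding regularize_def using assms by (intro pairing_nu_plus_eq_0 test_fun_shift) auto

lemma regularize_nu_minus_eq_0:
  assumes "test_fun f" "\<And>x. \<bar>x\<bar> > R \<Longrightarrow> f x = 0" "t > R"
  shows "regularize (nu_minus a) f t = 0"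
  unfolding regularize_def pairing_nu_minus[OF test_fun_shift[OF assms(1)]]
  using assms by (intro pairing_nu_plus_eq_0 test_fun_reflect[OF test_fun_shift]) auto

lemma test_fun_regularize_prod:
  assumes f: "test_fun f" and g: "test_fun g"
  shows "test_fun (\<lambda>t. regularize (nu_plus a) f t * regularize (nu_minus b) g t)"
proof -
  obtain R where R: "R > 0" "\<And>x. \<bar>x\<bar> > R \<Longrightarrow> f x = 0" by (rule test_fun_radius[OF f]) (rule that)
  obtain S where S: "S > 0" "\<And>x. \<bar>x\<bar> > S \<Longrightarrow> g x = 0" by (rule test_fun_radius[OF g]) (rule that)
  show ?thesis
  proof (rule test_funI[of _ "max R S"])
    fix t :: real assume "\<bar>t\<bar> > max R S"
    then have "t < - R \<or> t > S" by linarith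
    then show "regularize (nu_plus a) f t * regularize (nu_minus b) g t = 0"
      using regularize_nu_plus_eq_0[OF f R(2)] regularize_nu_minus_eq_0[OF g S(2)] by auto
  qed (intro smooth_mult smooth_regularize f g)
qed

lemma integral_vderiv_test_fun:
  assumes f: "test_fun f" shows "(LBINT x. vderiv f x) = 0"
proof -
  obtain R where R: "R > 0" "\<And>x. \<bar>x\<bar> > R \<Longrightarrow> f x = 0" by (rule test_fun_radius[OF f]) (rule that)
  have "(vderiv f has_integral (f (R + 1) - f (- (R + 1)))) {- (R + 1)..R + 1}"
    using R(1) by (intro fundamental_theorem_of_calculus
        has_vector_derivative_at_within[OF has_vector_derivative_vderiv[OF test_fun_smooth[OF f]]]) auto
  then have "(vderiv f has_integral 0) {- (R + 1)..R + 1}" using R by simp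
  moreover have "vderiv f x = 0" if "x \<notin> {- (R + 1)..R + 1}" for x
    using vderiv_funpow_outside[of "{-R..R}" f x 1] R(2) that by force
  ultimately have "(vderiv f has_integral 0) UNIV" by (rule has_integral_on_superset) auto
  moreover have "(vderiv f has_integral (LBINT x. vderiv f x)) UNIV"
    by (intro has_integral_integral_lborel integrable_test_fun test_fun_vderiv f)
  ultimately show ?thesis by (rule has_integral_unique[symmetric])
qed

lemma integral_by_parts_test_fun:
  assumes "smooth f" "smooth g" "test_fun (\<lambda>x. f x * g x)"
    and "test_fun (\<lambda>x. f x * vderiv g x)" "test_fun (\<lambda>x. vderiv f x * g x)"
  shows "(LBINT x. vderiv f x * g x) = - (LBINT x. f x * vderiv g x)"
proof -
  have "(LBINT x. f x * vderiv g x + vderiv f x * g x) = 0"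
    using integral_vderiv_test_fun[OF assms(3)] vderiv_mult[OF assms(1,2)] by simp
  then show ?thesis
    using integrable_test_fun[OF assms(4)] integrable_test_fun[OF assms(5)]
    by (simp add: eq_neg_iff_add_eq_0 add.commute)
qed

text \<open>Two independent test functions are allowed because taking moments and derivatives changes
  one factor and not the other.\<close>

definition nu_product :: "real \<Rightarrow> real \<Rightarrow> (real \<Rightarrow> complex) \<Rightarrow> (real \<Rightarrow> complex) \<Rightarrow> complex" where
  "nu_product a b f g = (LBINT t. regularize (nu_plus a) f t * regularize (nu_minus b) g t)"

text \<open>Differentiation lowers the exponent of either factor by one, with opposite signs; integration
  by parts cancels the signs. Hence \<open>nu_product\<close> depends on the exponents through their sum, as long as
  they move by integers.\<close>

lemma nu_product_shift_1:
  assumes f: "test_fun f" and g: "test_fun g"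
  shows "nu_product (a - 1) b f g = nu_product a (b - 1) f g"
proof -
  have F: "vderiv (regularize (nu_plus a) f) = regularize (nu_plus (a - 1)) f"
    using f by (simp add: vderiv_regularize regularize_nu_plus_vderiv)
  have G: "vderiv (regularize (nu_minus b) g) = (\<lambda>t. - regularize (nu_minus (b - 1)) g t)"
    using g by (simp add: vderiv_regularize regularize_nu_minus_vderiv)
  have m: "test_fun (\<lambda>t. regularize (nu_plus a) f t * - regularize (nu_minus (b - 1)) g t)"
    using test_fun_cmult[OF test_fun_regularize_prod[OF f g], of "-1" a "b - 1"] by simp
  show ?thesis
    unfolding nu_product_def
    using integral_by_parts_test_fun[OF smooth_regularize[OF f, of "nu_plus a"] smooth_regularize[OF g, of "nu_minus b"]]
    unfolding F G using m test_fun_regularize_prod[OF f g] by simp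
qed

lemma nu_product_shift:
  assumes "test_fun f" "test_fun g"
  shows "nu_product (a - of_int n) b f g = nu_product a (b - of_int n) f g"
proof (induction n arbitrary: b rule: int_induct[where k=0])
  case (step1 i)
  have "nu_product (a - of_int (i + 1)) b f g = nu_product (a - of_int i) (b - 1) f g"
    using nu_product_shift_1[OF assms, of "a - of_int i" b] by (simp add: algebra_simps)
  also have "\<dots> = nu_product a (b - 1 - of_int i) f g" by (rule step1.IH)
  finally show ?case by (simp add: algebra_simps)
next
  case (step2 i)
  have "nu_product (a - of_int (i - 1)) b f g = nu_product (a - of_int i) (b + 1) f g"
    using nu_product_shift_1[OF assms, of "a - of_int i + 1" "b + 1"] by (simp add: algebra_simps)
  also have "\<dots> = nu_product a (b + 1 - of_int i) f g" by (rule step2.IH)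
  finally show ?case by (simp add: algebra_simps)
qed simp

lemma nu_product_vderiv:
  assumes "test_fun f"
  shows "nu_product (a - 1) b f g = - nu_product a b (vderiv f) g"
  unfolding nu_product_def using regularize_nu_plus_vderiv[OF assms] by simp

section \<open>Pairings of regularised powers\<close>

text \<open>The substitution \<open>t = - u + (u - v) * s\<close> turns the integral over the interval between
  \<open>- u\<close> and \<open>- v\<close> into the Beta integral, whose Gamma factors are the normalisations of the powers. This is the
  convolution identity for \<open>nu_plus a\<close> and \<open>nu_plus b\<close>.\<close>

lemma has_bochner_integral_nu_plus_minus:
  assumes a: "a > -1" and b: "b > -1"
  shows "has_bochner_integral lborel (\<lambda>t. nu_plus_fun a (t + u) * nu_minus_fun b (t + v))
    (nu_plus_fun (a + b + 1) (u - v))"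
proof (cases "u > v")
  case False
  then have "(\<lambda>t. nu_plus_fun a (t + u) * nu_minus_fun b (t + v)) = (\<lambda>t. 0)"
    by (auto simp: fun_eq_iff nu_plus_fun_def nu_minus_fun_def)
  then show ?thesis using False by (simp add: nu_plus_fun_def has_bochner_integral_zero)
next
  case True
  define w where "w = u - v"
  have w: "w > 0" using True by (simp add: w_def)
  define C where "C = w powr (a + b) / (Gamma (a + 1) * Gamma (b + 1))"
  \<comment> \<open>The factor \<open>w\<close> from the substitution is missing in \<open>C\<close>; it is supplied by the affine change of
    variables at the end.\<close>
  let ?h = "\<lambda>s. indicator {0..1} s *\<^sub>R (s powr a * (1 - s) powr b)"
  have i: "set_integrable lborel {0..1} (\<lambda>s. s powr a * (1 - s) powr b)"
    using integrable_Beta[of "a + 1" "b + 1"] a b by simp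
  have "(LBINT s:{0..1}. s powr a * (1 - s) powr b) = integral {0..1} (\<lambda>s. s powr a * (1 - s) powr b)"
    using set_borel_integral_eq_integral(2)[OF i] .
  also have "\<dots> = Beta (a + 1) (b + 1)"
    using has_integral_Beta_real[of "a + 1" "b + 1"] a b by (simp add: integral_unique)
  finally have "has_bochner_integral lborel ?h (Beta (a + 1) (b + 1))"
    using i by (simp add: has_bochner_integral_iff set_integrable_def set_lebesgue_integral_def)
  from has_bochner_integral_bounded_linear[OF bounded_linear_of_real
      has_bochner_integral_mult_right[OF this, of C]]
  have 1: "has_bochner_integral lborel (\<lambda>s. complex_of_real (C * ?h s)) (of_real (C * Beta (a + 1) (b + 1)))"
    by simp
  have G: "Gamma (a + 1) \<noteq> 0" "Gamma (b + 1) \<noteq> 0"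
    using Gamma_real_pos[of "a + 1"] Gamma_real_pos[of "b + 1"] a b by linarith+
  have "complex_of_real (C * ?h s) =
     nu_plus_fun a (- u + w * s + u) * nu_minus_fun b (- u + w * s + v)" for s
  proof (cases "0 < s \<and> s < 1")
    case s: True
    have e: "- u + w * s + u = w * s" "- (- u + w * s + v) = w * (1 - s)"
      by (simp_all add: w_def algebra_simps)
    have p: "w * s > 0" "w * (1 - s) > 0" using s w by auto
    then have "nu_plus_fun a (- u + w * s + u) * nu_minus_fun b (- u + w * s + v) =
        of_real ((w * s) powr a / Gamma (a + 1) * ((w * (1 - s)) powr b / Gamma (b + 1)))"
      unfolding nu_minus_fun_eq e nu_plus_fun_def by simp
    also have "\<dots> = of_real (C * ?h s)"
      using s w by (simp add: C_def powr_mult powr_add)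
    finally show ?thesis by simp
  next
    case s: False
    have "\<not> (w * s > 0 \<and> w * (1 - s) > 0)" using s w by (simp add: zero_less_mult_iff)
    then have "nu_plus_fun a (- u + w * s + u) * nu_minus_fun b (- u + w * s + v) = 0"
      by (auto simp: nu_plus_fun_def nu_minus_fun_def w_def algebra_simps)
    moreover have "?h s = 0" using s by (auto simp: indicator_def)
    ultimately show ?thesis by (simp only: mult_zero_right of_real_0)
  qed
  with 1 have "has_bochner_integral lborel
      (\<lambda>s. nu_plus_fun a (- u + w * s + u) * nu_minus_fun b (- u + w * s + v)) (of_real (C * Beta (a + 1) (b + 1)))"
    by simp
  also have "of_real (C * Beta (a + 1) (b + 1)) = nu_plus_fun (a + b + 1) (u - v) /\<^sub>R \<bar>w\<bar>"
    using w G True by (simp add: C_def Beta_def nu_plus_fun_def w_def[symmetric] powr_add scaleR_conv_of_real field_simps)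
  finally show ?thesis
    using w by (subst lborel_has_bochner_integral_real_affine_iff[where c=w and t="- u"]) auto
qed

lemma norm_nu_plus_fun: "a > -1 \<Longrightarrow> norm (nu_plus_fun a x) = Re (nu_plus_fun a x)"
  and of_real_Re_nu_plus_fun: "of_real (Re (nu_plus_fun a x)) = nu_plus_fun a x"
  using Gamma_real_pos[of "a + 1"] by (auto simp: nu_plus_fun_def norm_divide)

lemma nu_plus_fun_0: "nu_plus_fun 0 x = (if x > 0 then 1 else 0)"
  by (simp add: nu_plus_fun_def)

lemma has_bochner_integral_norm_nu_plus_minus:
  assumes a: "a > -1" and b: "b > -1"
  shows "has_bochner_integral lborel (\<lambda>t. norm (nu_plus_fun a (t + u) * nu_minus_fun b (t + v)))
    (norm (nu_plus_fun (a + b + 1) (u - v)))"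
proof -
  have "nu_plus_fun a (t + u) * nu_minus_fun b (t + v) =
      of_real (norm (nu_plus_fun a (t + u) * nu_minus_fun b (t + v)))" for t
    using a b by (simp add: norm_mult norm_nu_plus_fun nu_minus_fun_eq of_real_Re_nu_plus_fun)
  then have "Re (nu_plus_fun a (t + u) * nu_minus_fun b (t + v)) =
      norm (nu_plus_fun a (t + u) * nu_minus_fun b (t + v))" for t
    by (metis Re_complex_of_real)
  moreover have "norm (nu_plus_fun (a + b + 1) (u - v)) = Re (nu_plus_fun (a + b + 1) (u - v))"
    using a b by (intro norm_nu_plus_fun) auto
  ultimately show ?thesis
    using has_bochner_integral_bounded_linear[OF bounded_linear_Re has_bochner_integral_nu_plus_minus[OF a b, of u v]]
    by simp
qed

lemma regularize_nu_plus_integral: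
  assumes "a > -1" "test_fun f"
  shows "regularize (nu_plus a) f t = (LBINT u. nu_plus_fun a (t + u) * f u)"
  unfolding regularize_def pairing_nu_plus[OF assms(1) test_fun_shift[OF assms(2)]]
  by (subst lborel_integral_real_affine[where c=1 and t=t]) simp_all

lemma regularize_nu_minus_integral:
  assumes "a > -1" "test_fun f"
  shows "regularize (nu_minus a) f t = (LBINT u. nu_minus_fun a (t + u) * f u)"
proof -
  have "regularize (nu_minus a) f t = (LBINT y. nu_plus_fun a y * f (- y - t))"
    unfolding regularize_def using assms
    by (simp add: pairing_nu_minus pairing_nu_plus test_fun_shift test_fun_reflect[OF test_fun_shift])
  also have "\<dots> = (LBINT u. nu_minus_fun a (t + u) * f u)"
    by (subst lborel_integral_real_affine[where c="-1" and t="- t"]) (simp_all add: nu_minus_fun_eq)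
  finally show ?thesis .
qed

text \<open>Integrating out \<open>t\<close> first is legitimate because the kernel is nonnegative and its
  integral over \<open>t\<close> is the Heaviside function. The third claim, uniform in \<open>v\<close>, is what the second
  exchange of integrals requires.\<close>

lemma integral_regularize_nu_plus_times_nu_minus:
  assumes a: "a > -1" and b: "b > -1" and ab: "a + b = -1" and f: "test_fun f"
  defines "F \<equiv> regularize (nu_plus a) f"
  shows "(LBINT t. F t * nu_minus_fun b (t + v)) = (LBINT u. nu_plus_fun 0 (u - v) * f u)"
    and "integrable lborel (\<lambda>t. F t * nu_minus_fun b (t + v))"
    and "(LBINT t. norm (F t * nu_minus_fun b (t + v))) \<le> (LBINT u. norm (f u))"
proof -
  define k where "k = (\<lambda>u t. nu_plus_fun a (t + u) * nu_minus_fun b (t + v) * f u)"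
  have ab': "a + b + 1 = 0" using ab by simp
  have [measurable]: "f \<in> borel_measurable borel" by (rule borel_measurable_smooth[OF test_fun_smooth[OF f]])
  have kn: "(LBINT t. norm (k u t)) = norm (nu_plus_fun 0 (u - v)) * norm (f u)" for u
    using has_bochner_integral_norm_nu_plus_minus[OF a b, of u v]
    by (simp add: k_def norm_mult has_bochner_integral_iff ab')
  have ki: "integrable lborel (k u)" for u
    unfolding k_def using has_bochner_integral_nu_plus_minus[OF a b, of u v]
    by (intro integrable_mult_left) (simp add: has_bochner_integral_iff)
  have fi: "integrable lborel (\<lambda>u. norm (f u))" by (intro integrable_norm integrable_test_fun f)
  have fk: "integrable lborel (\<lambda>u. norm (nu_plus_fun 0 (u - v)) * norm (f u))"
    by (rule Bochner_Integration.integrable_bound[OF fi]) (auto simp: nu_plus_fun_0)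
  have int: "integrable (lborel \<Otimes>\<^sub>M lborel) (case_prod k)"
  proof (rule lborel_pair.Fubini_integrable)
    show "case_prod k \<in> borel_measurable (lborel \<Otimes>\<^sub>M lborel)" unfolding k_def by measurable
  qed (use kn ki fk in simp_all)
  have F: "F t * nu_minus_fun b (t + v) = (LBINT u. k u t)" for t
    unfolding F_def regularize_nu_plus_integral[OF a f] k_def
    by (subst integral_mult_left_zero[symmetric]) (simp add: mult_ac)
  have "(LBINT t. F t * nu_minus_fun b (t + v)) = (LBINT u. LBINT t. k u t)"
    unfolding F by (rule lborel_pair.Fubini_integral[OF int])
  also have "(\<lambda>u. LBINT t. k u t) = (\<lambda>u. nu_plus_fun 0 (u - v) * f u)"
    using has_bochner_integral_nu_plus_minus[OF a b, of _ v]
    by (simp add: k_def has_bochner_integral_iff ab')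
  finally show "(LBINT t. F t * nu_minus_fun b (t + v)) = (LBINT u. nu_plus_fun 0 (u - v) * f u)" .
  show i: "integrable lborel (\<lambda>t. F t * nu_minus_fun b (t + v))"
    unfolding F by (rule lborel_pair.integrable_snd[OF int])
  have intn: "integrable (lborel \<Otimes>\<^sub>M lborel) (case_prod (\<lambda>u t. norm (k u t)))"
    using integrable_norm[OF int] by (simp add: case_prod_unfold)
  have "(LBINT t. norm (F t * nu_minus_fun b (t + v))) \<le> (LBINT t. LBINT u. norm (k u t))"
    by (intro integral_mono integrable_norm i lborel_pair.integrable_snd[OF intn]) (simp add: F integral_norm_bound)
  also have "\<dots> = (LBINT u. LBINT t. norm (k u t))"
    by (rule lborel_pair.Fubini_integral[OF intn])
  also have "\<dots> = (LBINT u. norm (nu_plus_fun 0 (u - v)) * norm (f u))" unfolding kn ..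
  also have "\<dots> \<le> (LBINT u. norm (f u))"
    by (intro integral_mono fk fi) (simp add: nu_plus_fun_0)
  finally show "(LBINT t. norm (F t * nu_minus_fun b (t + v))) \<le> (LBINT u. norm (f u))" .
qed

text \<open>With both exponents above \<open>-1\<close> and sum \<open>-1\<close>, two applications of Fubini reduce the triple
  integral in \<open>t\<close>, \<open>u\<close> and \<open>v\<close> to a double integral against the Heaviside function of \<open>u - v\<close>.\<close>

lemma nu_product_locally_integrable:
  assumes a: "a > -1" and b: "b > -1" and ab: "a + b = -1" and f: "test_fun f" and g: "test_fun g"
  shows "nu_product a b f g = (LBINT v. (LBINT u. nu_plus_fun 0 (u - v) * f u) * g v)"
proof -
  define F where "F = regularize (nu_plus a) f"
  have [measurable]: "F \<in> borel_measurable borel" "g \<in> borel_measurable borel"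
    unfolding F_def by (intro borel_measurable_smooth smooth_regularize test_fun_smooth f g)+
  note fub = integral_regularize_nu_plus_times_nu_minus[OF a b ab f, folded F_def]
  define k where "k = (\<lambda>v t. F t * nu_minus_fun b (t + v) * g v)"
  have gi: "integrable lborel (\<lambda>v. (LBINT u. norm (f u)) * norm (g v))"
    by (intro integrable_mult_right integrable_norm integrable_test_fun g)
  have int: "integrable (lborel \<Otimes>\<^sub>M lborel) (case_prod k)"
  proof (rule lborel_pair.Fubini_integrable)
    show "case_prod k \<in> borel_measurable (lborel \<Otimes>\<^sub>M lborel)" unfolding k_def by measurable
    show "integrable lborel (\<lambda>v. LBINT t. norm (case_prod k (v, t)))"
    proof (rule Bochner_Integration.integrable_bound[OF gi])
      show "(\<lambda>v. LBINT t. norm (case_prod k (v, t))) \<in> borel_measurable lborel"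
        unfolding k_def by measurable
      have "norm (LBINT t. norm (k v t)) \<le> norm ((LBINT u. norm (f u)) * norm (g v))" for v
      proof -
        have "(LBINT t. norm (k v t)) = (LBINT t. norm (F t * nu_minus_fun b (t + v))) * norm (g v)"
          unfolding k_def norm_mult[of _ "g v"] by simp
        also have "\<dots> \<le> (LBINT u. norm (f u)) * norm (g v)"
          by (intro mult_right_mono fub(3)) simp
        finally show ?thesis by simp
      qed
      then show "AE v in lborel. norm (LBINT t. norm (case_prod k (v, t))) \<le> norm ((LBINT u. norm (f u)) * norm (g v))"
        by simp
    qed
    show "AE v in lborel. integrable lborel (\<lambda>t. case_prod k (v, t))"
      unfolding k_def using fub(2) by (auto intro: integrable_mult_left)
  qed
  have "nu_product a b f g = (LBINT t. LBINT v. k v t)"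
    unfolding nu_product_def F_def[symmetric] regularize_nu_minus_integral[OF b g] k_def
    by (simp add: mult.assoc)
  also have "\<dots> = (LBINT v. LBINT t. k v t)"
    by (rule lborel_pair.Fubini_integral[OF int])
  also have "\<dots> = (LBINT v. (LBINT u. nu_plus_fun 0 (u - v) * f u) * g v)"
    unfolding k_def by (simp add: fub(1))
  finally show ?thesis .
qed

text \<open>An integer shift moves \<open>a\<close> into the interval between \<open>-1\<close> and \<open>0\<close>, and \<open>- a - 1\<close> then
  lies there too. This is where integer exponents have to be excluded.\<close>

lemma nu_product_minus_1:
  assumes a: "a \<notin> \<int>" and f: "test_fun f" and g: "test_fun g"
  shows "nu_product a (- a - 1) f g = (LBINT v. (LBINT u. nu_plus_fun 0 (u - v) * f u) * g v)"
proof -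
  define n where "n = \<lfloor>a\<rfloor> + 1"
  have "a \<noteq> of_int \<lfloor>a\<rfloor>" using a Ints_of_int by metis
  then have n: "a - of_int n > -1" "a - of_int n < 0"
    using floor_correct[of a] unfolding n_def of_int_add of_int_1 by linarith+
  have "nu_product a (- a - 1) f g = nu_product a ((- a - 1 + of_int n) - of_int n) f g" by simp
  also have "\<dots> = nu_product (a - of_int n) (- a - 1 + of_int n) f g"
    by (rule nu_product_shift[OF f g, symmetric])
  also have "\<dots> = (LBINT v. (LBINT u. nu_plus_fun 0 (u - v) * f u) * g v)"
    using n by (intro nu_product_locally_integrable f g) auto
  finally show ?thesis .
qed

lemma integral_heaviside_vderiv:
  assumes f: "test_fun f"
  shows "(LBINT u. nu_plus_fun 0 (u - v) * vderiv f u) = - f v"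
proof -
  obtain R where R: "R > 0" "\<And>x. \<bar>x\<bar> > R \<Longrightarrow> f x = 0" by (rule test_fun_radius[OF f]) (rule that)
  define M where "M = max v R + 1"
  have M: "v \<le> M" "R < \<bar>M\<bar>" using R(1) by (auto simp: M_def)
  have f0: "vderiv f x = 0" if "x > M" for x
    using vderiv_funpow_outside[of "{-R..R}" f x 1] R(2) that by (force simp: M_def)
  have "(vderiv f has_integral (f M - f v)) {v..M}"
    using M(1) by (intro fundamental_theorem_of_calculus
        has_vector_derivative_at_within[OF has_vector_derivative_vderiv[OF test_fun_smooth[OF f]]]) auto
  then have "((\<lambda>u. nu_plus_fun 0 (u - v) * vderiv f u) has_integral (f M - f v)) {v..M}"
    by (rule has_integral_spike[OF negligible_sing[of v], rotated]) (auto simp: nu_plus_fun_0)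
  then have "((\<lambda>u. nu_plus_fun 0 (u - v) * vderiv f u) has_integral (f M - f v)) UNIV"
    by (rule has_integral_on_superset) (auto simp: nu_plus_fun_0 f0 not_le)
  moreover have "integrable lborel (\<lambda>u. nu_plus_fun 0 (u - v) * vderiv f u)"
  proof (rule Bochner_Integration.integrable_bound[OF integrable_test_fun[OF test_fun_vderiv[OF f]]])
    have [measurable]: "vderiv f \<in> borel_measurable borel"
      by (rule borel_measurable_smooth[OF smooth_vderiv[OF test_fun_smooth[OF f]]])
    show "(\<lambda>u. nu_plus_fun 0 (u - v) * vderiv f u) \<in> borel_measurable lborel" by measurable
  qed (auto simp: nu_plus_fun_0)
  then have "((\<lambda>u. nu_plus_fun 0 (u - v) * vderiv f u) has_integral
      (LBINT u. nu_plus_fun 0 (u - v) * vderiv f u)) UNIV"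
    by (rule has_integral_integral_lborel)
  ultimately show ?thesis using R(2)[OF M(2)] by (simp add: has_integral_unique)
qed

text \<open>Lowering the total degree by one puts one derivative on \<open>f\<close>, and the derivative of the
  Heaviside kernel is the delta kernel on the diagonal.\<close>

lemma nu_product_minus_2:
  assumes a: "a \<notin> \<int>" and f: "test_fun f" and g: "test_fun g"
  shows "nu_product a (- a - 2) f g = (LBINT v. f v * g v)"
proof -
  have "nu_product a (- a - 2) f g = - nu_product (a + 1) (- (a + 1) - 1) (vderiv f) g"
    using nu_product_vderiv[OF f, of "a + 1" "- a - 2" g] by (simp add: algebra_simps)
  also have "\<dots> = (LBINT v. f v * g v)"
    using a by (subst nu_product_minus_1) (simp_all add: f g test_fun_vderiv integral_heaviside_vderiv)
  finally show ?thesis .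
qed

lemma nu_product_minus_3:
  assumes a: "a \<notin> \<int>" and f: "test_fun f" and g: "test_fun g"
  shows "nu_product a (- a - 3) f g = - (LBINT v. vderiv f v * g v)"
proof -
  have "nu_product a (- a - 3) f g = - nu_product (a + 1) (- (a + 1) - 2) (vderiv f) g"
    using nu_product_vderiv[OF f, of "a + 1" "- a - 3" g] by (simp add: algebra_simps)
  also have "\<dots> = - (LBINT v. vderiv f v * g v)"
    using a by (subst nu_product_minus_2) (simp_all add: f g test_fun_vderiv)
  finally show ?thesis .
qed

text \<open>Exchanging the two variables shows that the parts \<open>u > v\<close> and \<open>u < v\<close> of the plane contribute
  equally, and the diagonal is a null set.\<close>

lemma integral_heaviside_square:
  assumes f: "test_fun f"
  shows "(LBINT v. (LBINT u. nu_plus_fun 0 (u - v) * f u) * f v) = (LBINT v. f v)\<^sup>2 / 2"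
proof -
  have fi: "integrable lborel f" by (rule integrable_test_fun[OF f])
  have [measurable]: "f \<in> borel_measurable borel" by (rule borel_measurable_smooth[OF test_fun_smooth[OF f]])
  define k where "k = (\<lambda>v u. nu_plus_fun 0 (u - v) * f u * f v)"
  have hi: "integrable lborel (\<lambda>u. nu_plus_fun 0 (u - v) * f u)"
      "integrable lborel (\<lambda>u. nu_plus_fun 0 (v - u) * f u)" for v
    by (rule Bochner_Integration.integrable_bound[OF fi]; auto simp: nu_plus_fun_0)+
  have int: "integrable (lborel \<Otimes>\<^sub>M lborel) (case_prod k)"
  proof (rule Bochner_Integration.integrable_bound)
    show "integrable (lborel \<Otimes>\<^sub>M lborel) (\<lambda>(v, u). f v * f u)"
    proof (rule lborel_pair.Fubini_integrable)
      show "integrable lborel (\<lambda>v. LBINT u. norm (case (v, u) of (v, u) \<Rightarrow> f v * f u))"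
        using fi by (simp add: norm_mult)
    qed (use fi in simp_all)
    show "case_prod k \<in> borel_measurable (lborel \<Otimes>\<^sub>M lborel)" unfolding k_def by measurable
  qed (auto simp: k_def nu_plus_fun_0 norm_mult intro!: AE_I2)
  let ?T = "LBINT v. (LBINT u. nu_plus_fun 0 (u - v) * f u) * f v"
  have 1: "?T = (LBINT v. LBINT u. k v u)" unfolding k_def by simp
  also have "\<dots> = (LBINT u. LBINT v. k v u)" by (rule lborel_pair.Fubini_integral[OF int, symmetric])
  also have "\<dots> = (LBINT v. (LBINT u. nu_plus_fun 0 (v - u) * f u) * f v)"
    unfolding k_def by (simp add: mult_ac)
  finally have 2: "?T = (LBINT v. (LBINT u. nu_plus_fun 0 (v - u) * f u) * f v)" .
  have s: "(LBINT u. nu_plus_fun 0 (u - v) * f u) + (LBINT u. nu_plus_fun 0 (v - u) * f u) = (LBINT u. f u)" for v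
  proof -
    have "(LBINT u. nu_plus_fun 0 (u - v) * f u) + (LBINT u. nu_plus_fun 0 (v - u) * f u) =
        (LBINT u. nu_plus_fun 0 (u - v) * f u + nu_plus_fun 0 (v - u) * f u)"
      using hi by simp
    also have "\<dots> = (LBINT u. f u)"
    proof (rule integral_cong_AE)
      show "AE u in lborel. nu_plus_fun 0 (u - v) * f u + nu_plus_fun 0 (v - u) * f u = f u"
        using AE_lborel_singleton[of v] by eventually_elim (auto simp: nu_plus_fun_0)
    qed measurable
    finally show ?thesis .
  qed
  have i1: "integrable lborel (\<lambda>v. (LBINT u. nu_plus_fun 0 (u - v) * f u) * f v)"
    using lborel_pair.integrable_fst[OF int] by (simp add: k_def)
  have i2: "integrable lborel (\<lambda>v. (LBINT u. nu_plus_fun 0 (v - u) * f u) * f v)"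
    using lborel_pair.integrable_snd[OF int] by (simp add: k_def mult_ac)
  have "?T + ?T = (LBINT v. (LBINT u. nu_plus_fun 0 (u - v) * f u) * f v + (LBINT u. nu_plus_fun 0 (v - u) * f u) * f v)"
    using i1 i2 2 by simp
  also have "\<dots> = (LBINT u. f u) * (LBINT v. f v)"
    unfolding distrib_right[symmetric] s by simp
  finally show ?thesis by (simp add: power2_eq_square mult.commute)
qed

section \<open>Moments of the products\<close>

lemma regularize_nu_plus_mult_id:
  assumes "test_fun f"
  shows "of_real t * regularize (nu_plus a) f t =
    of_real (a + 1) * regularize (nu_plus (a + 1)) f t - regularize (nu_plus a) (\<lambda>x. of_real x * f x) t"
proof -
  let ?g = "\<lambda>y. f (y - t)" and ?h = "\<lambda>y. of_real (y - t) * f (y - t)"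
  have g: "test_fun ?g" by (rule test_fun_shift[OF assms])
  have h: "test_fun ?h" by (rule test_fun_shift[OF test_fun_id_mult[OF assms]])
  have "of_real (a + 1) * pairing (nu_plus (a + 1)) ?g = pairing (nu_plus a) (\<lambda>y. of_real y * ?g y)"
    by (rule pairing_nu_plus_mult_id[OF g, symmetric])
  also have "(\<lambda>y. of_real y * ?g y) = (\<lambda>y. ?h y + of_real t * ?g y)"
    by (simp add: fun_eq_iff algebra_simps)
  also have "pairing (nu_plus a) \<dots> = pairing (nu_plus a) ?h + of_real t * pairing (nu_plus a) ?g"
    using g h by (simp only: pairing_test_add pairing_test_cmult test_fun_cmult)
  finally show ?thesis unfolding regularize_def by (simp add: algebra_simps)
qed

lemma nu_product_first_moment:
  assumes f: "test_fun f" and g: "test_fun g"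
  shows "(LBINT t. of_real t * (regularize (nu_plus a) f t * regularize (nu_minus b) g t)) =
    of_real (a + 1) * nu_product (a + 1) b f g - nu_product a b (\<lambda>x. of_real x * f x) g"
proof -
  have "of_real t * (regularize (nu_plus a) f t * regularize (nu_minus b) g t) =
      of_real (a + 1) * (regularize (nu_plus (a + 1)) f t * regularize (nu_minus b) g t) -
      regularize (nu_plus a) (\<lambda>x. of_real x * f x) t * regularize (nu_minus b) g t" for t
    unfolding mult.assoc[symmetric] regularize_nu_plus_mult_id[OF f] by (simp only: left_diff_distrib)
  then show ?thesis
    unfolding nu_product_def
    by (simp only: Bochner_Integration.integral_diff integrable_mult_right integral_mult_right_zero
        integrable_test_fun test_fun_regularize_prod test_fun_id_mult f g)
qed

text \<open>The multiplication rule is applied twice. The two cross terms coincide, which gives the factor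
  \<open>2\<close>.\<close>

lemma nu_product_second_moment:
  assumes f: "test_fun f" and g: "test_fun g"
  shows "(LBINT t. of_real t * (of_real t * (regularize (nu_plus a) f t * regularize (nu_minus b) g t))) =
    of_real ((a + 1) * (a + 2)) * nu_product (a + 2) b f g
    - of_real (2 * (a + 1)) * nu_product (a + 1) b (\<lambda>x. of_real x * f x) g
    + nu_product a b (\<lambda>x. of_real x * (of_real x * f x)) g"
proof -
  let ?X = "\<lambda>f x. complex_of_real x * f x"
  let ?P = "\<lambda>a f t. regularize (nu_plus a) f t * regularize (nu_minus b) g t"
  have "of_real t * (of_real t * ?P a f t) =
      of_real (a + 1) * (of_real t * ?P (a + 1) f t) - of_real t * ?P a (?X f) t" for t
  proof -
    have "of_real t * ?P a f t = of_real (a + 1) * ?P (a + 1) f t - ?P a (?X f) t"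
      unfolding mult.assoc[symmetric] regularize_nu_plus_mult_id[OF f] by (simp only: left_diff_distrib)
    then show ?thesis by (simp only: right_diff_distrib mult.left_commute)
  qed
  moreover have "test_fun (\<lambda>t. of_real t * ?P a f t)" if "test_fun f" for a f
    by (intro test_fun_id_mult test_fun_regularize_prod that g)
  ultimately have "(LBINT t. of_real t * (of_real t * ?P a f t)) =
      of_real (a + 1) * (LBINT t. of_real t * ?P (a + 1) f t) - (LBINT t. of_real t * ?P a (?X f) t)"
    by (simp only: Bochner_Integration.integral_diff integrable_mult_right integral_mult_right_zero
        integrable_test_fun test_fun_id_mult f)
  also have "\<dots> = of_real (a + 1) * (of_real (a + 1 + 1) * nu_product (a + 1 + 1) b f g - nu_product (a + 1) b (?X f) g)
      - (of_real (a + 1) * nu_product (a + 1) b (?X f) g - nu_product a b (?X (?X f)) g)"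
    by (simp only: nu_product_first_moment f g test_fun_id_mult)
  finally show ?thesis by (simp add: algebra_simps)
qed

text \<open>The test functions \<open>f\<^sup>2\<close>, \<open>x f\<^sup>2\<close> and \<open>x\<^sup>2 f\<^sup>2\<close> have derivatives of integral zero; expand these
  with \<open>(f\<^sup>2)' = 2 f f'\<close>.\<close>

lemma integral_mult_vderiv_self:
  assumes f: "test_fun f"
  shows "(LBINT x. f x * vderiv f x) = 0"
    and "(LBINT x. of_real x * (f x * vderiv f x)) = - (LBINT x. f x * f x) / 2"
    and "(LBINT x. of_real x * (of_real x * (f x * vderiv f x))) = - (LBINT x. of_real x * (f x * f x))"
proof -
  let ?p = "\<lambda>x. f x * f x" and ?q = "\<lambda>x. f x * vderiv f x"
  have solve1: "B = - A / 2" if "A + 2 * B = 0" for A B :: complex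
  proof -
    have "B * 2 = - A" using that by (simp add: add_eq_0_iff mult.commute)
    then show ?thesis by (metis nonzero_eq_divide_eq zero_neq_numeral)
  qed
  have solve2: "B = - A" if "2 * A + 2 * B = 0" for A B :: complex
  proof -
    have "2 * (A + B) = 0" using that by (simp only: distrib_left)
    then show ?thesis by (simp add: add_eq_0_iff)
  qed
  have sf: "smooth f" by (rule test_fun_smooth[OF f])
  have p: "test_fun ?p" by (rule test_fun_smooth_mult[OF sf f])
  have q: "test_fun ?q" by (rule test_fun_smooth_mult[OF sf test_fun_vderiv[OF f]])
  have dp: "vderiv ?p = (\<lambda>x. 2 * ?q x)" by (simp add: vderiv_mult[OF sf sf] fun_eq_iff)
  show "(LBINT x. ?q x) = 0" using integral_vderiv_test_fun[OF p] by (simp add: dp)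
  have d1: "vderiv (\<lambda>x. of_real x * ?p x) = (\<lambda>x. ?p x + 2 * (of_real x * ?q x))"
    unfolding vderiv_id_mult[OF test_fun_smooth[OF p]] dp by (simp add: fun_eq_iff)
  have "(LBINT x. ?p x + 2 * (of_real x * ?q x)) = 0"
    using integral_vderiv_test_fun[OF test_fun_id_mult[OF p]] unfolding d1 .
  then have "(LBINT x. ?p x) + 2 * (LBINT x. of_real x * ?q x) = 0"
    by (simp only: Bochner_Integration.integral_add integrable_mult_right integral_mult_right_zero
        integrable_test_fun test_fun_id_mult p q)
  then show "(LBINT x. of_real x * ?q x) = - (LBINT x. ?p x) / 2"
    by (rule solve1)
  have d2: "vderiv (\<lambda>x. of_real x * (of_real x * ?p x)) = (\<lambda>x. 2 * (of_real x * ?p x) + 2 * (of_real x * (of_real x * ?q x)))"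
    unfolding vderiv_id_mult[OF test_fun_smooth[OF test_fun_id_mult[OF p]]] d1 by (simp add: fun_eq_iff algebra_simps)
  have "(LBINT x. 2 * (of_real x * ?p x) + 2 * (of_real x * (of_real x * ?q x))) = 0"
    using integral_vderiv_test_fun[OF test_fun_id_mult[OF test_fun_id_mult[OF p]]] unfolding d2 .
  then have "2 * (LBINT x. of_real x * ?p x) + 2 * (LBINT x. of_real x * (of_real x * ?q x)) = 0"
    by (simp only: Bochner_Integration.integral_add integrable_mult_right integral_mult_right_zero
        integrable_test_fun test_fun_id_mult p q)
  then show "(LBINT x. of_real x * (of_real x * ?q x)) = - (LBINT x. of_real x * ?p x)"
    by (rule solve2)
qed

text \<open>The first moment and the last term of the second one depend on the mollifier beyond its own
  integral. These are the contributions that the product of the Dirac distribution and its derivative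
  has to cancel.\<close>

lemma nu_product_moments:
  assumes a: "a \<notin> \<int>" and f: "test_fun f"
  defines "P \<equiv> \<lambda>t. regularize (nu_plus a) f t * regularize (nu_minus (- a - 3)) f t"
  shows "(LBINT t. P t) = 0"
    and "(LBINT t. of_real t * P t) = of_real (a + 3 / 2) * (LBINT x. f x * f x)"
    and "(LBINT t. of_real t * (of_real t * P t)) =
      of_real ((a + 1) * (a + 2) / 2) * (LBINT x. f x)\<^sup>2 - of_real (2 * a + 3) * (LBINT x. of_real x * (f x * f x))"
proof -
  let ?f1 = "\<lambda>x. of_real x * f x" and ?f2 = "\<lambda>x. of_real x * (of_real x * f x)"
  let ?p = "\<lambda>x. f x * f x" and ?q = "\<lambda>x. f x * vderiv f x"
  note f1 = test_fun_id_mult[OF f] and f2 = test_fun_id_mult[OF test_fun_id_mult[OF f]]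
  have sf: "smooth f" by (rule test_fun_smooth[OF f])
  have p: "test_fun ?p" by (rule test_fun_smooth_mult[OF sf f])
  have q: "test_fun ?q" by (rule test_fun_smooth_mult[OF sf test_fun_vderiv[OF f]])
  note I = integral_mult_vderiv_self[OF f]
  have a1: "a + 1 \<notin> \<int>" "a + 2 \<notin> \<int>" using a by simp_all
  have m3: "nu_product a (- a - 3) h f = - (LBINT v. vderiv h v * f v)" if "test_fun h" for h
    by (rule nu_product_minus_3[OF a that f])
  have m2: "nu_product (a + 1) (- a - 3) h f = (LBINT v. h v * f v)" if "test_fun h" for h
    using nu_product_minus_2[OF a1(1) that f] by (simp add: algebra_simps)
  have m1: "nu_product (a + 2) (- a - 3) f f = (LBINT v. f v)\<^sup>2 / 2"
    using nu_product_minus_1[OF a1(2) f f] integral_heaviside_square[OF f] by (simp add: algebra_simps)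
  show "(LBINT t. P t) = 0"
    using m3[OF f] I(1) by (simp add: P_def nu_product_def mult.commute)
  have v1: "(LBINT v. vderiv ?f1 v * f v) = (LBINT x. ?p x) / 2"
  proof -
    have "(LBINT v. vderiv ?f1 v * f v) = (LBINT x. ?p x + of_real x * ?q x)"
      unfolding vderiv_id_mult[OF sf] by (simp add: algebra_simps)
    also have "\<dots> = (LBINT x. ?p x) + (LBINT x. of_real x * ?q x)"
      by (simp only: Bochner_Integration.integral_add integrable_test_fun test_fun_id_mult p q)
    finally show ?thesis unfolding I(2) by simp
  qed
  have v2: "(LBINT v. vderiv ?f2 v * f v) = (LBINT x. of_real x * ?p x)"
  proof -
    have "(LBINT v. vderiv ?f2 v * f v) = (LBINT x. 2 * (of_real x * ?p x) + of_real x * (of_real x * ?q x))"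
      unfolding vderiv_id_mult[OF test_fun_smooth[OF f1]] vderiv_id_mult[OF sf] by (simp add: algebra_simps)
    also have "\<dots> = 2 * (LBINT x. of_real x * ?p x) + (LBINT x. of_real x * (of_real x * ?q x))"
      by (simp only: Bochner_Integration.integral_add integrable_mult_right integral_mult_right_zero
          integrable_test_fun test_fun_id_mult p q)
    finally show ?thesis unfolding I(3) by simp
  qed
  show "(LBINT t. of_real t * P t) = of_real (a + 3 / 2) * (LBINT x. ?p x)"
    unfolding P_def nu_product_first_moment[OF f f] m2[OF f] m3[OF f1] v1 by (simp add: algebra_simps)
  show "(LBINT t. of_real t * (of_real t * P t)) =
      of_real ((a + 1) * (a + 2) / 2) * (LBINT x. f x)\<^sup>2 - of_real (2 * a + 3) * (LBINT x. of_real x * ?p x)"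
    unfolding P_def nu_product_second_moment[OF f f] m1 m2[OF f1] m3[OF f2] v2
    by (simp add: mult.assoc) (simp add: algebra_simps)
qed

lemma regularize_dirac: "test_fun f \<Longrightarrow> regularize dirac f t = f (- t)"
  by (simp add: regularize_def pairing_dirac test_fun_shift)

lemma regularize_dist_deriv_dirac: "test_fun f \<Longrightarrow> regularize (dist_deriv dirac) f t = - vderiv f (- t)"
  by (simp add: regularize_def pairing_dist_deriv pairing_dirac test_fun_shift test_fun_vderiv
      vderiv_shift test_fun_smooth)

lemma dirac_product_moments:
  assumes f: "test_fun f"
  defines "D \<equiv> \<lambda>t. regularize dirac f t * regularize (dist_deriv dirac) f t"
  shows "test_fun D"
    and "(LBINT t. D t) = 0"
    and "(LBINT t. of_real t * D t) = - (LBINT x. f x * f x) / 2"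
    and "(LBINT t. of_real t * (of_real t * D t)) = (LBINT x. of_real x * (f x * f x))"
proof -
  have D: "D = (\<lambda>t. - 1 * (f (- t) * vderiv f (- t)))"
    using f by (simp add: D_def regularize_dirac regularize_dist_deriv_dirac)
  have "test_fun (\<lambda>x. f x * vderiv f x)"
    by (rule test_fun_smooth_mult[OF test_fun_smooth[OF f] test_fun_vderiv[OF f]])
  from test_fun_cmult[OF test_fun_reflect[OF this], of "- 1"] show "test_fun D" unfolding D .
  have r: "(LBINT t. h t) = (LBINT t. h (- t))" for h :: "real \<Rightarrow> complex"
    using lborel_integral_real_affine[of "-1" h 0] by simp
  note I = integral_mult_vderiv_self[OF f]
  show "(LBINT t. D t) = 0" by (subst r) (simp add: D I)
  show "(LBINT t. of_real t * D t) = - (LBINT x. f x * f x) / 2" by (subst r) (simp add: D I)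
  show "(LBINT t. of_real t * (of_real t * D t)) = (LBINT x. of_real x * (f x * f x))"
    by (subst r) (simp add: D I)
qed

section \<open>Concentrating kernels\<close>

text \<open>The constant is not sharp. The quadratic term is subtracted first, so that the mean value
  inequality applied to the remainder needs only a second-order estimate of \<open>vderiv f\<close>.\<close>

lemma smooth_taylor_bound_third_order:
  assumes f: "smooth f" and M: "\<And>t. norm ((vderiv ^^ 3) f t) \<le> M"
  shows "norm (f h - f 0 - h *\<^sub>R vderiv f 0 - (h\<^sup>2 / 2) *\<^sub>R vderiv (vderiv f) 0) \<le> M * \<bar>h\<bar> ^ 3"
proof -
  define g where "g = (\<lambda>y. f y - (y\<^sup>2 / 2) *\<^sub>R vderiv (vderiv f) 0)"
  have M0: "M \<ge> 0" using M[of 0] norm_ge_zero order_trans by blast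
  have "norm (g h - g 0 - (h - 0) *\<^sub>R (vderiv f 0 - 0 *\<^sub>R vderiv (vderiv f) 0)) \<le> norm (h - 0) * (M * h\<^sup>2)"
  proof (rule vector_differentiable_bound_linearization[where S="closed_segment 0 h"
        and f'="\<lambda>x. vderiv f x - x *\<^sub>R vderiv (vderiv f) 0"])
    fix x assume x: "x \<in> closed_segment 0 h"
    have "((\<lambda>y. y\<^sup>2 / 2) has_real_derivative x) (at x)"
      by (auto intro!: derivative_eq_intros)
    then have "((\<lambda>y. y\<^sup>2 / 2) has_vector_derivative x) (at x)"
      by (simp add: has_real_derivative_iff_has_vector_derivative)
    from bounded_linear.has_vector_derivative[OF bounded_linear_scaleR_left this]
    have "(g has_vector_derivative vderiv f x - x *\<^sub>R vderiv (vderiv f) 0) (at x)"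
      unfolding g_def by (rule has_vector_derivative_diff[OF has_vector_derivative_vderiv[OF f]])
    then show "(g has_vector_derivative vderiv f x - x *\<^sub>R vderiv (vderiv f) 0) (at x within closed_segment 0 h)"
      by (rule has_vector_derivative_at_within)
    have "norm ((vderiv ^^ 1) f (0 - (- x)) - (vderiv ^^ 1) f 0 + (- x) *\<^sub>R (vderiv ^^ Suc 1) f 0) \<le> M * (- x)\<^sup>2"
      by (rule smooth_taylor_bound[OF f]) (use M in \<open>simp add: numeral_3_eq_3\<close>)
    also have "\<dots> \<le> M * h\<^sup>2"
    proof -
      have "\<bar>x\<bar> \<le> \<bar>h\<bar>" using x by (auto simp: closed_segment_eq_real_ivl split: if_splits)
      then show ?thesis using M0 by (intro mult_left_mono) (auto simp: abs_le_square_iff)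
    qed
    finally show "norm (vderiv f x - x *\<^sub>R vderiv (vderiv f) 0 - (vderiv f 0 - 0 *\<^sub>R vderiv (vderiv f) 0)) \<le> M * h\<^sup>2"
      by (simp add: algebra_simps)
  qed auto
  then show ?thesis
    by (simp add: g_def algebra_simps power3_eq_cube power2_eq_square abs_mult_self_eq)
qed

text \<open>After rescaling, the integral is \<open>1 / \<epsilon>\<^sup>2\<close> times the integral of \<open>H t * \<psi> (\<epsilon> * t)\<close>. The first two
  moments remove the terms of the Taylor expansion of \<open>\<psi>\<close> that would be divided by a positive power of \<open>\<epsilon>\<close>,
  the quadratic term survives, and the cubic remainder is of size \<open>\<epsilon>\<close>.\<close>

lemma concentrating_kernel_tendsto:
  assumes H: "test_fun H" and m0: "(LBINT t. H t) = 0" and m1: "(LBINT t. of_real t * H t) = 0"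
    and m2: "(LBINT t. of_real t * (of_real t * H t)) = m" and \<psi>: "test_fun \<psi>"
  shows "((\<lambda>\<epsilon>. LBINT x. of_real (1 / \<epsilon> ^ 3) * H (x / \<epsilon>) * \<psi> x) \<longlongrightarrow> m / 2 * vderiv (vderiv \<psi>) 0) (at_right 0)"
proof -
  define M where "M = test_seminorm 3 \<psi>"
  define N where "N = (LBINT t. norm (of_real t * (of_real t * (of_real t * H t))))"
  define L where "L = m / 2 * vderiv (vderiv \<psi>) 0"
  have M: "norm ((vderiv ^^ 3) \<psi> t) \<le> M" for t
    unfolding M_def by (rule norm_le_test_seminorm[OF \<psi>]) simp
  have bound: "norm ((LBINT x. of_real (1 / \<epsilon> ^ 3) * H (x / \<epsilon>) * \<psi> x) - L) \<le> (M * N) * \<epsilon>"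
    if e: "\<epsilon> > 0" for \<epsilon>
  proof -
    define c where "c = complex_of_real (1 / \<epsilon>\<^sup>2)"
    define r where "r = (\<lambda>t. \<psi> (\<epsilon> * t) - \<psi> 0 - (\<epsilon> * t) *\<^sub>R vderiv \<psi> 0 - ((\<epsilon> * t)\<^sup>2 / 2) *\<^sub>R vderiv (vderiv \<psi>) 0)"
    have sr: "test_fun (\<lambda>t. H t * \<psi> (\<epsilon> * t))"
    proof -
      have "smooth (\<lambda>t. \<psi> (\<epsilon> * t + 0))" by (rule smooth_affine[OF test_fun_smooth[OF \<psi>]])
      from test_fun_smooth_mult[OF this H] show ?thesis by (simp add: mult.commute)
    qed
    have e1: "H t * r t = H t * \<psi> (\<epsilon> * t) - \<psi> 0 * H t - (of_real \<epsilon> * vderiv \<psi> 0) * (of_real t * H t)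
        - (of_real (\<epsilon>\<^sup>2) / 2 * vderiv (vderiv \<psi>) 0) * (of_real t * (of_real t * H t))" for t
      by (simp add: r_def scaleR_conv_of_real algebra_simps power2_eq_square)
    have ir: "integrable lborel (\<lambda>t. H t * r t)"
      unfolding e1
      by (intro Bochner_Integration.integrable_diff integrable_mult_right integrable_test_fun test_fun_id_mult H sr)
    have "(LBINT t. H t * r t) = (LBINT t. H t * \<psi> (\<epsilon> * t)) - \<psi> 0 * (LBINT t. H t)
        - (of_real \<epsilon> * vderiv \<psi> 0) * (LBINT t. of_real t * H t)
        - (of_real (\<epsilon>\<^sup>2) / 2 * vderiv (vderiv \<psi>) 0) * (LBINT t. of_real t * (of_real t * H t))"
      unfolding e1
      by (simp only: Bochner_Integration.integral_diff Bochner_Integration.integrable_diff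
          integrable_mult_right integral_mult_right_zero integrable_test_fun test_fun_id_mult H sr)
    then have "(LBINT t. H t * \<psi> (\<epsilon> * t)) = (LBINT t. H t * r t) + of_real (\<epsilon>\<^sup>2) * L"
      unfolding m0 m1 m2 L_def by (simp add: algebra_simps)
    moreover have "(LBINT x. of_real (1 / \<epsilon> ^ 3) * H (x / \<epsilon>) * \<psi> x) = c * (LBINT t. H t * \<psi> (\<epsilon> * t))"
    proof -
      have "(LBINT x. of_real (1 / \<epsilon> ^ 3) * H (x / \<epsilon>) * \<psi> x) =
          \<bar>\<epsilon>\<bar> *\<^sub>R (LBINT t. of_real (1 / \<epsilon> ^ 3) * H ((0 + \<epsilon> * t) / \<epsilon>) * \<psi> (0 + \<epsilon> * t))"
        using e by (intro lborel_integral_real_affine) auto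
      also have "\<dots> = c * (LBINT t. H t * \<psi> (\<epsilon> * t))"
        using e by (simp add: mult.assoc scaleR_conv_of_real c_def power3_eq_cube power2_eq_square)
      finally show ?thesis .
    qed
    moreover have "c * of_real (\<epsilon>\<^sup>2) = 1" using e by (simp add: c_def flip: of_real_mult)
    ultimately have "(LBINT x. of_real (1 / \<epsilon> ^ 3) * H (x / \<epsilon>) * \<psi> x) - L = c * (LBINT t. H t * r t)"
      by (simp add: distrib_left mult.assoc[symmetric])
    also have "norm \<dots> \<le> norm c * (LBINT t. norm (H t * r t))"
      unfolding norm_mult[of c] by (intro mult_left_mono integral_norm_bound) simp
    also have "(LBINT t. norm (H t * r t)) \<le> (LBINT t. (M * \<epsilon> ^ 3) * norm (of_real t * (of_real t * (of_real t * H t))))"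
    proof (intro integral_mono integrable_norm integrable_mult_right ir integrable_test_fun test_fun_id_mult H)
      fix t
      have "norm (r t) \<le> M * \<bar>\<epsilon> * t\<bar> ^ 3"
        unfolding r_def by (rule smooth_taylor_bound_third_order[OF test_fun_smooth[OF \<psi>] M])
      then have "norm (H t) * norm (r t) \<le> norm (H t) * (M * \<bar>\<epsilon> * t\<bar> ^ 3)" by (intro mult_left_mono) auto
      then show "norm (H t * r t) \<le> (M * \<epsilon> ^ 3) * norm (of_real t * (of_real t * (of_real t * H t)))"
        using e by (simp add: norm_mult abs_mult power_mult_distrib power3_eq_cube mult_ac)
    qed
    also have "\<dots> = (M * \<epsilon> ^ 3) * N" unfolding N_def by simp
    also have "norm c * ((M * \<epsilon> ^ 3) * N) = (M * N) * \<epsilon>"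
      unfolding c_def norm_of_real using e by (simp add: power3_eq_cube power2_eq_square)
    finally show ?thesis by (simp add: mult_left_mono)
  qed
  have "((\<lambda>\<epsilon>. (LBINT x. of_real (1 / \<epsilon> ^ 3) * H (x / \<epsilon>) * \<psi> x) - L) \<longlongrightarrow> 0) (at_right 0)"
  proof (rule Lim_null_comparison)
    show "\<forall>\<^sub>F \<epsilon> in at_right 0. norm ((LBINT x. of_real (1 / \<epsilon> ^ 3) * H (x / \<epsilon>) * \<psi> x) - L) \<le> (M * N) * \<epsilon>"
      using eventually_unit_interval by eventually_elim (rule bound, simp)
    have "((\<lambda>\<epsilon>. (M * N) * \<epsilon>) \<longlongrightarrow> (M * N) * 0) (at_right 0)" by (intro tendsto_intros)
    then show "((\<lambda>\<epsilon>. (M * N) * \<epsilon>) \<longlongrightarrow> 0) (at_right 0)" by simp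
  qed
  then show ?thesis unfolding L_def by (rule LIM_zero_cancel)
qed

section \<open>Homogeneity and the product formula\<close>

lemma dilate_shift_eq: "dilate \<epsilon> f (y - x) = of_real (1 / \<epsilon>) * f (y / \<epsilon> - x / \<epsilon>)"
  by (simp add: dilate_def scaleR_conv_of_real field_simps diff_divide_distrib)

lemma regularize_nu_plus_dilate:
  assumes f: "test_fun f" and e: "\<epsilon> > 0"
  shows "regularize (nu_plus a) (dilate \<epsilon> f) x = of_real (\<epsilon> powr a) * regularize (nu_plus a) f (x / \<epsilon>)"
proof -
  note h = test_fun_shift[OF f, of "x / \<epsilon>"]
  have he: "test_fun (\<lambda>y. f (y / \<epsilon> - x / \<epsilon>))" using test_fun_affine[OF h, of "1 / \<epsilon>" 0] e by simp
  show ?thesis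
    unfolding regularize_def dilate_shift_eq pairing_test_cmult[OF he] pairing_nu_plus_dilate[OF h e]
    using e by (simp add: powr_add)
qed

lemma regularize_nu_minus_dilate:
  assumes f: "test_fun f" and e: "\<epsilon> > 0"
  shows "regularize (nu_minus a) (dilate \<epsilon> f) x = of_real (\<epsilon> powr a) * regularize (nu_minus a) f (x / \<epsilon>)"
proof -
  note h = test_fun_shift[OF f, of "x / \<epsilon>"]
  have he: "test_fun (\<lambda>y. f (y / \<epsilon> - x / \<epsilon>))" using test_fun_affine[OF h, of "1 / \<epsilon>" 0] e by simp
  have "pairing (nu_minus a) (\<lambda>y. f (y / \<epsilon> - x / \<epsilon>)) = of_real (\<epsilon> powr (a + 1)) * pairing (nu_minus a) (\<lambda>y. f (y - x / \<epsilon>))"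
    using pairing_nu_plus_dilate[OF test_fun_reflect[OF h] e, of a]
    by (simp add: pairing_nu_minus[OF he] pairing_nu_minus[OF h])
  then show ?thesis
    unfolding regularize_def dilate_shift_eq pairing_test_cmult[OF he]
    using e by (simp add: powr_add)
qed

text \<open>The representative of the left-hand side of the product formula at the mollifier \<open>f\<close>.\<close>

definition product_kernel :: "real \<Rightarrow> (real \<Rightarrow> complex) \<Rightarrow> real \<Rightarrow> complex" where
  "product_kernel a f t = regularize (nu_plus a) f t * regularize (nu_minus (- a - 3)) f t +
     of_real (2 * a + 3) * (regularize dirac f t * regularize (dist_deriv dirac) f t)"

text \<open>The coefficient \<open>2 * a + 3\<close> is determined by the vanishing of the first moment; it then also
  removes the mollifier-dependent part of the second moment.\<close>

lemma product_kernel_moments: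
  assumes a: "a \<notin> \<int>" and f: "test_fun f"
  shows "test_fun (product_kernel a f)"
    and "(LBINT t. product_kernel a f t) = 0"
    and "(LBINT t. of_real t * product_kernel a f t) = 0"
    and "(LBINT t. of_real t * (of_real t * product_kernel a f t)) = of_real ((a + 1) * (a + 2) / 2) * (LBINT x. f x)\<^sup>2"
proof -
  note D = dirac_product_moments[OF f] and P = nu_product_moments[OF a f]
  note P0 = test_fun_regularize_prod[OF f f, of a "- a - 3"]
  show "test_fun (product_kernel a f)"
    unfolding product_kernel_def[abs_def] by (intro test_fun_add test_fun_cmult D P0)
  show "(LBINT t. product_kernel a f t) = 0"
    unfolding product_kernel_def
    by (simp only: Bochner_Integration.integral_add integrable_mult_right integral_mult_right_zero
        integrable_test_fun P0 D P) simp
  let ?P = "\<lambda>t. regularize (nu_plus a) f t * regularize (nu_minus (- a - 3)) f t"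
  let ?D = "\<lambda>t. regularize dirac f t * regularize (dist_deriv dirac) f t"
  have e1: "of_real t * product_kernel a f t = of_real t * ?P t + of_real (2 * a + 3) * (of_real t * ?D t)" for t
    unfolding product_kernel_def by (simp only: distrib_left mult.left_commute)
  have e2: "of_real t * (of_real t * product_kernel a f t) =
      of_real t * (of_real t * ?P t) + of_real (2 * a + 3) * (of_real t * (of_real t * ?D t))" for t
    unfolding e1 by (simp only: distrib_left mult.left_commute)
  have "(LBINT t. of_real t * product_kernel a f t) = of_real (a + 3 / 2) * (LBINT x. f x * f x) +
      of_real (2 * a + 3) * (- (LBINT x. f x * f x) / 2)"
    unfolding e1
    by (simp only: Bochner_Integration.integral_add integrable_mult_right integral_mult_right_zero
        integrable_test_fun test_fun_id_mult P0 D P)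
  also have "\<dots> = 0" by (simp add: field_simps)
  finally show "(LBINT t. of_real t * product_kernel a f t) = 0" .
  have "(LBINT t. of_real t * (of_real t * product_kernel a f t)) = (of_real ((a + 1) * (a + 2) / 2) * (LBINT x. f x)\<^sup>2
      - of_real (2 * a + 3) * (LBINT x. of_real x * (f x * f x))) +
      of_real (2 * a + 3) * (LBINT x. of_real x * (f x * f x))"
    unfolding e2
    by (simp only: Bochner_Integration.integral_add integrable_mult_right integral_mult_right_zero
        integrable_test_fun test_fun_id_mult P0 D P)
  then show "(LBINT t. of_real t * (of_real t * product_kernel a f t)) = of_real ((a + 1) * (a + 2) / 2) * (LBINT x. f x)\<^sup>2"
    by simp
qed

text \<open>Both products are homogeneous of degree \<open>-3\<close>: the exponents \<open>a\<close> and \<open>- a - 3\<close> add up to it, as do the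
  degrees \<open>-1\<close> and \<open>-2\<close> of the Dirac distribution and its derivative.\<close>

lemma product_kernel_dilate:
  assumes f: "test_fun f" and e: "\<epsilon> > 0"
  shows "product_kernel a (dilate \<epsilon> f) x = of_real (1 / \<epsilon> ^ 3) * product_kernel a f (x / \<epsilon>)"
proof -
  have "complex_of_real (\<epsilon> powr a) * of_real (\<epsilon> powr (- a - 3)) = of_real (\<epsilon> powr (- 3))"
    by (simp flip: of_real_mult powr_add)
  also have "\<epsilon> powr (- 3) = 1 / \<epsilon> ^ 3"
    using e by (simp add: powr_minus_divide powr_numeral)
  finally have p: "complex_of_real (\<epsilon> powr a) * of_real (\<epsilon> powr (- a - 3)) = of_real (1 / \<epsilon> ^ 3)" .
  have "regularize (nu_plus a) (dilate \<epsilon> f) x * regularize (nu_minus (- a - 3)) (dilate \<epsilon> f) x =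
      of_real (1 / \<epsilon> ^ 3) * (regularize (nu_plus a) f (x / \<epsilon>) * regularize (nu_minus (- a - 3)) f (x / \<epsilon>))"
    unfolding p[symmetric] regularize_nu_plus_dilate[OF f e] regularize_nu_minus_dilate[OF f e] by simp
  moreover have "regularize dirac (dilate \<epsilon> f) x * regularize (dist_deriv dirac) (dilate \<epsilon> f) x =
      of_real (1 / \<epsilon> ^ 3) * (regularize dirac f (x / \<epsilon>) * regularize (dist_deriv dirac) f (x / \<epsilon>))"
  proof -
    have "vderiv (dilate \<epsilon> f) (- x) = of_real (1 / \<epsilon>\<^sup>2) * vderiv f (- (x / \<epsilon>))"
      using funpow_vderiv_dilate[OF test_fun_smooth[OF f], of 1 \<epsilon>]
      by (simp add: scaleR_conv_of_real power2_eq_square divide_inverse)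
    moreover have "dilate \<epsilon> f (- x) = of_real (1 / \<epsilon>) * f (- (x / \<epsilon>))"
      by (simp add: dilate_def scaleR_conv_of_real divide_inverse)
    ultimately show ?thesis
      by (simp add: regularize_dirac regularize_dist_deriv_dirac f test_fun_dilate[OF f e]
          power3_eq_cube power2_eq_square)
  qed
  ultimately show ?thesis
    unfolding product_kernel_def by (simp only: distrib_left mult.left_commute)
qed

theorem theorem3:
  fixes a :: real
  assumes "a \<notin> \<int>"
  shows "dist_embed (nu_plus a) * dist_embed (nu_minus (- a - 3)) +
      (2 * a + 3) *\<^sub>R (dist_embed dirac * dist_embed (dist_deriv dirac))
    \<approx> (1 / 2 * ((a + 2) gchoose 2)) *\<^sub>R dist_deriv (dist_deriv dirac)"
proof -
  let ?c = "\<lambda>u \<phi>. conv u (\<lambda>x. \<phi> (- x))"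
  have emb: "dist_embed u = abs_colombeau (?c u)" for u by (rule dist_embed.abs_eq)
  note mod = moderate_conv_reflect colombeau_rel_refl moderate_mult moderate_cmult moderate_add
  have "dist_embed (nu_plus a) * dist_embed (nu_minus (- a - 3)) +
      (2 * a + 3) *\<^sub>R (dist_embed dirac * dist_embed (dist_deriv dirac)) = abs_colombeau (product_kernel a)"
    unfolding emb product_kernel_def[abs_def] conv_reflect_eq_regularize[symmetric]
    by (simp only: times_colombeau.abs_eq scaleR_colombeau.abs_eq plus_colombeau.abs_eq mod)
  moreover have "product_kernel a \<in> moderate"
    unfolding product_kernel_def[abs_def] conv_reflect_eq_regularize[symmetric]
    by (rule moderate_add[OF moderate_mult moderate_cmult[OF moderate_mult]]) (rule moderate_conv_reflect)+
  moreover have "((\<lambda>\<epsilon>. LBINT x. product_kernel a (dilate \<epsilon> \<phi>) x * \<psi> x) \<longlongrightarrow>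
      pairing ((1 / 2 * ((a + 2) gchoose 2)) *\<^sub>R dist_deriv (dist_deriv dirac)) \<psi>) (at_right 0)"
    if \<psi>: "test_fun \<psi>" and \<phi>: "\<phi> \<in> mollifiers 0" for \<phi> \<psi>
  proof -
    have t: "test_fun \<phi>" by (rule mollifiers_test_fun[OF \<phi>])
    have "(LBINT x. \<phi> x) = 1" using \<phi> by (simp add: mollifiers_def)
    then have m2: "(LBINT t. of_real t * (of_real t * product_kernel a \<phi> t)) = of_real ((a + 1) * (a + 2) / 2)"
      using product_kernel_moments(4)[OF assms t] by simp
    have g: "((a + 2) gchoose 2) = (a + 1) * (a + 2) / 2"
      by (simp add: gbinomial_prod_rev numeral_2_eq_2 algebra_simps)
    have "pairing ((1 / 2 * ((a + 2) gchoose 2)) *\<^sub>R dist_deriv (dist_deriv dirac)) \<psi> =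
        of_real ((a + 1) * (a + 2) / 2) / 2 * vderiv (vderiv \<psi>) 0"
      unfolding g using \<psi> by (simp add: pairing_scaleR pairing_dist_deriv pairing_dirac test_fun_vderiv)
    moreover have "((\<lambda>\<epsilon>. LBINT x. of_real (1 / \<epsilon> ^ 3) * product_kernel a \<phi> (x / \<epsilon>) * \<psi> x) \<longlongrightarrow>
        of_real ((a + 1) * (a + 2) / 2) / 2 * vderiv (vderiv \<psi>) 0) (at_right 0)"
      using product_kernel_moments[OF assms t] m2 \<psi> by (intro concentrating_kernel_tendsto) auto
    moreover have "\<forall>\<^sub>F \<epsilon> in at_right 0. (LBINT x. of_real (1 / \<epsilon> ^ 3) * product_kernel a \<phi> (x / \<epsilon>) * \<psi> x) =
        (LBINT x. product_kernel a (dilate \<epsilon> \<phi>) x * \<psi> x)"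
      using eventually_unit_interval by eventually_elim (simp only: product_kernel_dilate[OF t])
    ultimately show ?thesis by (simp only: tendsto_cong)
  qed
  \<comment> \<open>The order \<open>q = 0\<close> is enough, since the limit involves the mollifier only through its integral.\<close>
  ultimately show ?thesis
    unfolding associated_def by (intro bexI[of _ "product_kernel a"] conjI allI impI exI[of _ 0] ballI) simp_all
qed

end
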